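(* For every fixed constant $c$, \textsc{DTS} and \textsc{DTD} restricted to instances with $\delta_{\max}\le c$ admit a polynomial kernel when parameterized by $D_{\max}+|F|$.
   Context: A classification instance (CI) $E=E^+\cup E^-$ is a finite set of examples $e:F\to\mathbb{Z}$ over a common feature set $F$, partitioned into positive and negative examples. $\lambda(e,e')$ is the set of features on which $e,e'$ differ; $\delta_{\max}=\max_{e^+\in E^+,e^-\in E^-}|\lambda(e^+,e^-)|$; $D_{\max}=\max_{f\in F}|\{e(f):e\in E\}|$. A decision tree (DT) is a rooted tree whose test nodes $v$ carry a feature $f(v)$ and integer threshold $\lambda(v)$ (examples with $e(f(v))\le\lambda(v)$ go left, others right) and whose leaves are labeled positive or negative; $T$ classifies $E$ if every example reaches a leaf with its own label. Size = number of test nodes; depth = maximum number of test nodes on a root-to-leaf path. \textsc{DTS}: given $(E,s)$, is there a DT of size at most $s$ classifying $E$? \textsc{DTD}: given $(E,d)$, is there a DT of depth at most $d$ classifying $E$? A kernel is a polynomial-time algorithm mapping an instance with parameter $k$ to an equivalent instance of the same problem whose size is bounded by a function of $k$; it is polynomial if that function is a polynomial. *)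

theory Defs
  imports Main
begin

text \<open>A classification instance over the feature set F = {0..<nfeat}. An example
  e : F -> int is represented by the list [e 0, ..., e (nfeat-1)].
  pos / neg list the positive / negative examples (set semantics).\<close>

record ci =
  nfeat :: nat
  pos :: "int list list"
  neg :: "int list list"

definition examples :: "ci \<Rightarrow> int list set" where
  "examples I = set (pos I) \<union> set (neg I)"

definition wf_ci :: "ci \<Rightarrow> bool" where
  "wf_ci I \<longleftrightarrow> (\<forall>e \<in> examples I. length e = nfeat I) \<and> set (pos I) \<inter> set (neg I) = {}"

definition diff_feats :: "ci \<Rightarrow> int list \<Rightarrow> int list \<Rightarrow> nat set" where
  "diff_feats I e e' = {f. f < nfeat I \<and> e ! f \<noteq> e' ! f}"

definition delta_max :: "ci \<Rightarrow> nat" where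
  "delta_max I = Max (insert 0 {card (diff_feats I p q) | p q. p \<in> set (pos I) \<and> q \<in> set (neg I)})"

definition D_max :: "ci \<Rightarrow> nat" where
  "D_max I = Max (insert 0 {card {e ! f | e. e \<in> examples I} | f. f < nfeat I})"

definition param :: "ci \<Rightarrow> nat" where
  "param I = D_max I + nfeat I"

datatype dt = Leaf bool | Node nat int dt dt

fun dt_eval :: "dt \<Rightarrow> int list \<Rightarrow> bool" where
  "dt_eval (Leaf b) e = b"
| "dt_eval (Node f t l r) e = (if e ! f \<le> t then dt_eval l e else dt_eval r e)"

fun dt_size :: "dt \<Rightarrow> nat" where
  "dt_size (Leaf b) = 0"
| "dt_size (Node f t l r) = 1 + dt_size l + dt_size r"

fun dt_depth :: "dt \<Rightarrow> nat" where
  "dt_depth (Leaf b) = 0"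
| "dt_depth (Node f t l r) = 1 + max (dt_depth l) (dt_depth r)"

fun dt_feats :: "dt \<Rightarrow> nat set" where
  "dt_feats (Leaf b) = {}"
| "dt_feats (Node f t l r) = insert f (dt_feats l \<union> dt_feats r)"

definition classifies :: "dt \<Rightarrow> ci \<Rightarrow> bool" where
  "classifies T I \<longleftrightarrow> (\<forall>f \<in> dt_feats T. f < nfeat I)
     \<and> (\<forall>e \<in> set (pos I). dt_eval T e) \<and> (\<forall>e \<in> set (neg I). \<not> dt_eval T e)"

definition DTS :: "ci \<times> nat \<Rightarrow> bool" where
  "DTS x \<longleftrightarrow> (\<exists>T. classifies T (fst x) \<and> dt_size T \<le> snd x)"

definition DTD :: "ci \<times> nat \<Rightarrow> bool" where
  "DTD x \<longleftrightarrow> (\<exists>T. classifies T (fst x) \<and> dt_depth T \<le> snd x)"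

fun bin :: "nat \<Rightarrow> bool list" where
  "bin n = (if n = 0 then [] else odd n # bin (n div 2))"

text \<open>Self-delimiting binary encoding: each bit doubled, terminated by [False, True].\<close>
definition enc_nat :: "nat \<Rightarrow> bool list" where
  "enc_nat n = concat (map (\<lambda>b. [b, b]) (bin n)) @ [False, True]"

definition enc_int :: "int \<Rightarrow> bool list" where
  "enc_int i = (i < 0) # enc_nat (nat \<bar>i\<bar>)"

definition enc_list :: "('a \<Rightarrow> bool list) \<Rightarrow> 'a list \<Rightarrow> bool list" where
  "enc_list enc xs = enc_nat (length xs) @ concat (map enc xs)"

definition enc_inst :: "ci \<times> nat \<Rightarrow> bool list" where
  "enc_inst x = enc_nat (nfeat (fst x))
     @ enc_list (enc_list enc_int) (pos (fst x))
     @ enc_list (enc_list enc_int) (neg (fst x))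
     @ enc_nat (snd x)"

text \<open>States 0..<tm_states, symbols 0..<tm_syms; 0 is the blank symbol, symbols 1 and 2
  encode the bits False and True. State 0 is the start state, state 1 the halting state.
  Moves are -1, 0, 1.\<close>

record tm =
  tm_states :: nat
  tm_syms :: nat
  tm_delta :: "nat \<Rightarrow> nat \<Rightarrow> nat \<times> nat \<times> int"

definition wf_tm :: "tm \<Rightarrow> bool" where
  "wf_tm M \<longleftrightarrow> 2 \<le> tm_states M \<and> 3 \<le> tm_syms M \<and>
     (\<forall>q < tm_states M. \<forall>a < tm_syms M.
        case tm_delta M q a of (q', a', d) \<Rightarrow>
          q' < tm_states M \<and> a' < tm_syms M \<and> d \<in> {-1, 0, 1})"

type_synonym config = "nat \<times> (int \<Rightarrow> nat) \<times> int"

definition bit_sym :: "bool \<Rightarrow> nat" where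
  "bit_sym b = (if b then 2 else 1)"

definition tm_step :: "tm \<Rightarrow> config \<Rightarrow> config" where
  "tm_step M c = (case c of (q, tp, h) \<Rightarrow>
     if q = 1 then (q, tp, h)
     else (case tm_delta M q (tp h) of (q', a', d) \<Rightarrow> (q', tp(h := a'), h + d)))"

definition tm_run :: "tm \<Rightarrow> nat \<Rightarrow> config \<Rightarrow> config" where
  "tm_run M t = (tm_step M ^^ t)"

definition tm_init :: "bool list \<Rightarrow> config" where
  "tm_init w = (0, (\<lambda>i. if 0 \<le> i \<and> i < int (length w) then bit_sym (w ! nat i) else 0), 0)"

definition tm_output :: "config \<Rightarrow> nat list" where
  "tm_output c = (case c of (q, tp, h) \<Rightarrow>
     map (\<lambda>i. tp (h + int i)) [0..<(LEAST m. tp (h + int m) = 0)])"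

definition tm_computes_within :: "tm \<Rightarrow> bool list \<Rightarrow> bool list \<Rightarrow> nat \<Rightarrow> bool" where
  "tm_computes_within M w v t \<longleftrightarrow>
     fst (tm_run M t (tm_init w)) = 1 \<and> tm_output (tm_run M t (tm_init w)) = map bit_sym v"

definition has_poly_kernel ::
    "(ci \<times> nat \<Rightarrow> bool) \<Rightarrow> (ci \<Rightarrow> bool) \<Rightarrow> (ci \<Rightarrow> nat) \<Rightarrow> bool" where
  "has_poly_kernel P R k \<longleftrightarrow>
     (\<exists>M a b c d. wf_tm M \<and>
        (\<forall>x. wf_ci (fst x) \<and> R (fst x) \<longrightarrow>
           (\<exists>y t. tm_computes_within M (enc_inst x) (enc_inst y) t
              \<and> t \<le> a * length (enc_inst x) ^ b + a
              \<and> wf_ci (fst y) \<and> R (fst y)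
              \<and> (P y \<longleftrightarrow> P x)
              \<and> length (enc_inst y) \<le> c * k (fst x) ^ d + c)))"

end

theory Submission
  imports Defs
begin

text \<open>If one class of examples is empty, the instance is trivial. Otherwise all positive examples lie
  within Hamming distance \<open>c\<close> of any fixed negative one and vice versa, so with \<open>F\<close> features and at
  most \<open>D\<close> values per feature each class has at most \<open>(1 + F * D) ^ c\<close> distinct examples. After
  removing duplicates, feature values matter only through their order and may be replaced by
  numbers determined by their ranks. Any consistent instance with \<open>n\<close> positive examples has a decision
  tree of depth at most \<open>2 * F * n\<close>, so larger budgets can be cut down.

  To see that this is computable by a Turing machine in polynomial time, structured data are coded as
  binary trees in preorder on a stack; the functions computed by polynomial-time stack programs are
  closed under pairing, composition, case distinction and loops with polynomially bounded state, and
  a stack program is simulated on a single tape with one track per stack.\<close>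

text \<open>A kernel is measured in bits, so bounding the number of examples is not enough: the
  integer values and the budget may be arbitrarily long numbers. Values are pooled over all
  features, so that a single order embedding \<open>\<rho>\<close> serves every coordinate and
  thresholds can be carried along it in both directions. A value of rank \<open>r\<close> becomes
  \<open>2 ^ r\<close>, whose encoding grows only linearly in \<open>r\<close>. The budget is cut at
  \<open>2 ^ L\<close>, where \<open>L\<close> is the length of the encoded list of positive
  examples. Every value costs at least two bits, so \<open>L\<close> is at least the depth of the
  explicit tree for the deduplicated positive examples, and that tree has fewer than
  \<open>2 ^ L\<close> test nodes. One cut therefore serves size and depth alike, and it can be
  written down without multiplication. The constant \<open>c\<close> enters only the analysis of the
  output length; the computed function is the same for every \<open>c\<close>.\<close>

section \<open>A structured tape language and its compilation to Turing machines\<close>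

text \<open>\<open>Loop\<close> is a loop with its test in the middle: it behaves as
  \<open>p; If P (b; Loop p P b q) q\<close>. Having the exit code \<open>q\<close> inside the loop
  makes the compilation of stack loops below compositional.\<close>

datatype 's cmd =
    Wr "'s \<Rightarrow> 's"
  | Go bool
  | Seq "'s cmd" "'s cmd"
  | If "'s \<Rightarrow> bool" "'s cmd" "'s cmd"
  | Loop "'s cmd" "'s \<Rightarrow> bool" "'s cmd" "'s cmd"

type_synonym 's tape = "(int \<Rightarrow> 's) \<times> int"

inductive run :: "'s cmd \<Rightarrow> 's tape \<Rightarrow> nat \<Rightarrow> 's tape \<Rightarrow> bool" where
  run_Wr: "run (Wr f) (tp, h) 1 (tp(h := f (tp h)), h)"
| run_Go: "run (Go r) (tp, h) 1 (tp, h + (if r then 1 else -1))"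
| run_Seq: "run c s t s' \<Longrightarrow> run d s' u s'' \<Longrightarrow> run (Seq c d) s (t + u + 1) s''"
| run_If: "run (if P (tp h) then c else d) (tp, h) t s' \<Longrightarrow> run (If P c d) (tp, h) (t + 1) s'"
| run_Loop: "run p s t s' \<Longrightarrow> run (If P (Seq b (Loop p P b q)) q) s' u s''
    \<Longrightarrow> run (Loop p P b q) s (t + u + 1) s''"
| run_mono: "run c s t s' \<Longrightarrow> t \<le> u \<Longrightarrow> run c s u s'"

text \<open>The control state of the machine is the list of commands still to be executed.\<close>

fun ctrl_step :: "'s cmd list \<Rightarrow> 's \<Rightarrow> 's cmd list \<times> 's \<times> int" where
  "ctrl_step [] a = ([], a, 0)"
| "ctrl_step (Wr f # k) a = (k, f a, 0)"
| "ctrl_step (Go r # k) a = (k, a, if r then 1 else -1)"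
| "ctrl_step (Seq c d # k) a = (c # d # k, a, 0)"
| "ctrl_step (If P c d # k) a = ((if P a then c else d) # k, a, 0)"
| "ctrl_step (Loop p P b q # k) a = (p # If P (Seq b (Loop p P b q)) q # k, a, 0)"

definition conf_step :: "'s cmd list \<times> 's tape \<Rightarrow> 's cmd list \<times> 's tape" where
  "conf_step c = (case c of (k, tp, h) \<Rightarrow>
     case ctrl_step k (tp h) of (k', a, d) \<Rightarrow> (k', tp(h := a), h + d))"

text \<open>The rule \<open>run_mono\<close> makes the time index an upper bound, hence
  \<open>u \<le> t\<close> instead of equality. The continuation \<open>k\<close> must be arbitrary,
  because the first half of a \<open>Seq\<close> runs above a longer one.\<close>

lemma run_conf_step:
  "run c s t s' \<Longrightarrow> \<exists>u\<le>t. (conf_step ^^ u) (c # k, s) = (k, s')"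
proof (induction arbitrary: k rule: run.induct)
  case (run_Wr f tp h)
  show ?case by (rule exI[of _ 1]) (simp add: conf_step_def)
next
  case (run_Go r tp h)
  show ?case by (rule exI[of _ 1]) (simp add: conf_step_def)
next
  case (run_Seq c s t s' d u s'')
  obtain m where m: "m \<le> t" "(conf_step ^^ m) (c # d # k, s) = (d # k, s')"
    using run_Seq.IH(1) by blast
  obtain n where n: "n \<le> u" "(conf_step ^^ n) (d # k, s') = (k, s'')"
    using run_Seq.IH(2) by blast
  have "(conf_step ^^ (n + m + 1)) (Seq c d # k, s) = (conf_step ^^ n) ((conf_step ^^ m) (conf_step (Seq c d # k, s)))"
    by (simp add: funpow_add funpow_swap1)
  moreover have "conf_step (Seq c d # k, s) = (c # d # k, s)"
    by (cases s) (simp add: conf_step_def)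
  ultimately have "(conf_step ^^ (n + m + 1)) (Seq c d # k, s) = (k, s'')"
    using m n by simp
  then show ?case using m n by (intro exI[of _ "n + m + 1"]) auto
next
  case (run_If P tp h c d t s')
  obtain m where m: "m \<le> t" "(conf_step ^^ m) ((if P (tp h) then c else d) # k, (tp, h)) = (k, s')"
    using run_If.IH by blast
  have "conf_step (If P c d # k, (tp, h)) = ((if P (tp h) then c else d) # k, (tp, h))"
    by (simp add: conf_step_def)
  then have "(conf_step ^^ (m + 1)) (If P c d # k, (tp, h)) = (k, s')"
    using m by (simp add: funpow_swap1)
  then show ?case using m by (intro exI[of _ "m + 1"]) auto
next
  case (run_Loop p s t s' P b q u s'')
  let ?I = "If P (Seq b (Loop p P b q)) q"
  obtain m where m: "m \<le> t" "(conf_step ^^ m) (p # ?I # k, s) = (?I # k, s')"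
    using run_Loop.IH(1) by blast
  obtain n where n: "n \<le> u" "(conf_step ^^ n) (?I # k, s') = (k, s'')"
    using run_Loop.IH(2) by blast
  have "(conf_step ^^ (n + m + 1)) (Loop p P b q # k, s) = (conf_step ^^ n) ((conf_step ^^ m) (conf_step (Loop p P b q # k, s)))"
    by (simp add: funpow_add funpow_swap1)
  moreover have "conf_step (Loop p P b q # k, s) = (p # ?I # k, s)"
    by (cases s) (simp add: conf_step_def)
  ultimately have "(conf_step ^^ (n + m + 1)) (Loop p P b q # k, s) = (k, s'')"
    using m n by simp
  then show ?case using m n by (intro exI[of _ "n + m + 1"]) auto
next
  case (run_mono c s t s' u)
  then show ?case by (meson le_trans)
qed

text \<open>The control lists that can occur while a command runs above \<open>k\<close>. The body
  of a loop has the loop itself as continuation, so the set is finite although execution may be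
  unbounded.\<close>

fun conts :: "'s cmd \<Rightarrow> 's cmd list \<Rightarrow> 's cmd list set" where
  "conts (Wr f) k = {Wr f # k}"
| "conts (Go r) k = {Go r # k}"
| "conts (Seq c d) k = insert (Seq c d # k) (conts c (d # k) \<union> conts d k)"
| "conts (If P c d) k = insert (If P c d # k) (conts c k \<union> conts d k)"
| "conts (Loop p P b q) k =
     {Loop p P b q # k, If P (Seq b (Loop p P b q)) q # k, Seq b (Loop p P b q) # k}
     \<union> conts p (If P (Seq b (Loop p P b q)) q # k) \<union> conts b (Loop p P b q # k) \<union> conts q k"

lemma finite_conts: "finite (conts c k)"
  by (induction c arbitrary: k) auto

lemma start_in_conts: "c # k \<in> conts c k"
  by (cases c) auto

text \<open>Each part of a command receives exactly the continuation under which
  \<open>conts\<close> recorded it, so a step can leave the set only by reaching \<open>k\<close>.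
  This closure lets control lists serve as machine states.\<close>

lemma conts_closed: "l \<in> conts c k \<Longrightarrow> fst (ctrl_step l a) \<in> insert k (conts c k)"
proof (induction c arbitrary: k)
  case (Seq c d)
  consider "l = Seq c d # k" | "l \<in> conts c (d # k)" | "l \<in> conts d k"
    using Seq.prems by auto
  then show ?case
  proof cases
    case 1 then show ?thesis using start_in_conts[of c "d # k"] by simp
  next
    case 2 then show ?thesis using Seq.IH(1)[of "d # k"] start_in_conts[of d k] by auto
  next
    case 3 then show ?thesis using Seq.IH(2)[of k] by auto
  qed
next
  case (If P c d)
  consider "l = If P c d # k" | "l \<in> conts c k" | "l \<in> conts d k"
    using If.prems by auto
  then show ?case
  proof cases
    case 1 then show ?thesis using start_in_conts[of c k] start_in_conts[of d k] by simp
  next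
    case 2 then show ?thesis using If.IH(1)[of k] by auto
  next
    case 3 then show ?thesis using If.IH(2)[of k] by auto
  qed
next
  case (Loop p P b q)
  let ?L = "Loop p P b q" and ?I = "If P (Seq b (Loop p P b q)) q"
  consider "l = ?L # k" | "l = ?I # k" | "l = Seq b ?L # k" | "l \<in> conts p (?I # k)"
    | "l \<in> conts b (?L # k)" | "l \<in> conts q k"
    using Loop.prems by auto
  then show ?case
  proof cases
    case 1 then show ?thesis using start_in_conts[of p "?I # k"] by simp
  next
    case 2 then show ?thesis using start_in_conts[of q k] by simp
  next
    case 3 then show ?thesis using start_in_conts[of b "?L # k"] by simp
  next
    case 4 then show ?thesis using Loop.IH(1)[of "?I # k"] by auto
  next
    case 5 then show ?thesis using Loop.IH(2)[of "?L # k"] by auto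
  next
    case 6 then show ?thesis using Loop.IH(3)[of k] by auto
  qed
qed auto

lemma ctrl_step_move: "snd (snd (ctrl_step k a)) \<in> {-1, 0, 1}"
  by (cases "(k, a)" rule: ctrl_step.cases) auto

section \<open>Numbering control lists and tape symbols\<close>

lemma obtain_enumeration:
  assumes "finite A" "distinct ys" "set ys \<subseteq> A"
  obtains zs where "distinct (ys @ zs)" "set (ys @ zs) = A"
proof -
  obtain zs where "distinct zs" "set zs = A - set ys"
    using finite_distinct_list[of "A - set ys"] assms(1) by auto
  then show ?thesis using that[of zs] assms by auto
qed

definition index :: "'a list \<Rightarrow> 'a \<Rightarrow> nat" where
  "index xs x = (THE i. i < length xs \<and> xs ! i = x)"

lemma index_nth: "distinct xs \<Longrightarrow> i < length xs \<Longrightarrow> index xs (xs ! i) = i"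
  unfolding index_def by (rule the_equality) (auto simp: nth_eq_iff_index_eq)

lemma nth_index: "distinct xs \<Longrightarrow> x \<in> set xs \<Longrightarrow> index xs x < length xs \<and> xs ! index xs x = x"
  by (metis in_set_conv_nth index_nth)

definition tm_of :: "'s cmd list list \<Rightarrow> 's list \<Rightarrow> tm" where
  "tm_of qs ss = \<lparr>tm_states = length qs, tm_syms = length ss,
     tm_delta = (\<lambda>q a. case ctrl_step (qs ! q) (ss ! a) of (k, b, d) \<Rightarrow> (index qs k, index ss b, d))\<rparr>"

lemma tm_computes_if_run:
  fixes c :: "'s::finite cmd" and sym :: "bool \<Rightarrow> 's" and blank :: 's
  assumes dist: "distinct [blank, sym False, sym True]"
  obtains M where "wf_tm M"
    "\<And>w v t tp h. \<lbrakk>run c (\<lambda>i. if 0 \<le> i \<and> i < int (length w) then sym (w ! nat i) else blank, 0) t (tp, h);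
        \<And>i. i < length v \<Longrightarrow> tp (h + int i) = sym (v ! i); tp (h + int (length v)) = blank\<rbrakk>
      \<Longrightarrow> \<exists>u\<le>t. tm_computes_within M w v u"
proof -
  define Q where "Q = insert [] (conts c [])"
  \<comment> \<open>\<open>[c]\<close> and \<open>[]\<close> are listed first because the machine
    model fixes 0 as start state and 1 as halting state; for the same reason blank and the two bit
    symbols receive the numbers 0, 1 and 2.\<close>
  have "finite Q" "distinct [[c], []]" "set [[c], []] \<subseteq> Q"
    using finite_conts[of c] start_in_conts[of c] by (auto simp: Q_def)
  from obtain_enumeration[OF this] obtain qr where qr: "distinct ([[c], []] @ qr)" "set ([[c], []] @ qr) = Q"
    by blast
  obtain sr where sr: "distinct ([blank, sym False, sym True] @ sr)"
      "set ([blank, sym False, sym True] @ sr) = UNIV"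
    using obtain_enumeration[OF finite dist, of UNIV] by blast
  define qs where "qs = [[c], []] @ qr"
  define ss where "ss = [blank, sym False, sym True] @ sr"
  have dqs: "distinct qs" "set qs = Q" and dss: "distinct ss" "set ss = UNIV"
    using qr sr by (simp_all only: qs_def ss_def)
  define M where "M = tm_of qs ss"
  have closed: "fst (ctrl_step k a) \<in> Q" if "k \<in> Q" for k a
    using that conts_closed[of k c "[]" a] by (auto simp: Q_def)
  have qs0: "qs ! 0 = [c]" "qs ! 1 = []" "1 < length qs" "qs \<noteq> []"
    by (simp_all add: qs_def)
  have ss0: "ss ! 0 = blank" "ss ! 1 = sym False" "ss ! 2 = sym True" "2 < length ss" "ss \<noteq> []"
    by (simp_all add: ss_def)
  have iq: "index qs [c] = 0" "index qs [] = 1"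
    using index_nth[OF dqs(1), of 0] index_nth[OF dqs(1), of 1] qs0 by auto
  have is0: "index ss blank = 0" and is1: "index ss (sym False) = 1" and is2: "index ss (sym True) = 2"
    using index_nth[OF dss(1), of 0] index_nth[OF dss(1), of 1] index_nth[OF dss(1), of 2] ss0 by simp_all
  have isy: "index ss blank = 0" "index ss (sym b) = bit_sym b" for b
    using is0 is1 is2 by (cases b; simp add: bit_sym_def)+
  have isU: "index ss a < length ss \<and> ss ! index ss a = a" for a
    using nth_index[OF dss(1), of a] dss(2) by blast
  have inj0: "index ss a = 0 \<longleftrightarrow> a = blank" for a
    by (metis isU isy(1) ss0(1))
  have wf: "wf_tm M"
    unfolding wf_tm_def
  proof (intro conjI allI impI)
    show "2 \<le> tm_states M" "3 \<le> tm_syms M"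
      using qs0 ss0 by (simp_all add: M_def tm_of_def)
    fix q a assume qa: "q < tm_states M" "a < tm_syms M"
    obtain k b d where kbd: "ctrl_step (qs ! q) (ss ! a) = (k, b, d)" by (metis prod_cases3)
    have "qs ! q \<in> Q" using qa nth_mem[of q qs] unfolding dqs(2) by (simp add: M_def tm_of_def)
    then have "k \<in> Q" using closed[of "qs ! q" "ss ! a"] kbd by simp
    then have "index qs k < length qs" using nth_index[OF dqs(1), of k] dqs(2) by simp
    moreover have "index ss b < length ss" using isU by blast
    moreover have "d \<in> {-1,0,1}" using ctrl_step_move[of "qs ! q" "ss ! a"] kbd by simp
    ultimately show "case tm_delta M q a of (q', a', d) \<Rightarrow> q' < tm_states M \<and> a' < tm_syms M \<and> d \<in> {- 1, 0, 1}"
      using kbd by (auto simp: M_def tm_of_def)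
  qed
  define rep where "rep = (\<lambda>(k, tp :: int \<Rightarrow> 's, h :: int). (index qs k, index ss \<circ> tp, h))"
  have step: "tm_step M (rep x) = rep (conf_step x) \<and> fst (conf_step x) \<in> Q" if "fst x \<in> Q" for x
  proof -
    obtain k tp h where x: "x = (k, tp, h)" by (metis prod_cases3)
    have k: "k \<in> Q" using that x by simp
    obtain k' b d where kbd: "ctrl_step k (tp h) = (k', b, d)" by (metis prod_cases3)
    have nk: "qs ! index qs k = k" "ss ! index ss (tp h) = tp h"
      using nth_index[OF dqs(1), of k] dqs(2) k isU by auto
    have "fst (conf_step x) \<in> Q"
      using closed[OF k, of "tp h"] kbd by (simp add: x conf_step_def)
    moreover have "tm_step M (rep x) = rep (conf_step x)"
    \<comment> \<open>In state 1 \<open>tm_step\<close> freezes, and \<open>ctrl_step\<close> idles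
      on the empty list. For any other \<open>k\<close> it must be checked that its number differs
      from 1.\<close>
    proof (cases "k = []")
      case True
      then show ?thesis using iq by (simp add: x rep_def tm_step_def conf_step_def)
    next
      case False
      then have "index qs k \<noteq> 1" using nk qs0 by force
      then show ?thesis using kbd nk
        by (auto simp: x rep_def tm_step_def conf_step_def M_def tm_of_def)
    qed
    ultimately show ?thesis by blast
  qed
  have steps: "(tm_step M ^^ n) (rep x) = rep ((conf_step ^^ n) x) \<and> fst ((conf_step ^^ n) x) \<in> Q"
    if "fst x \<in> Q" for x n
    using that step by (induction n) auto
  have "\<exists>u\<le>t. tm_computes_within M w v u"
    if r: "run c (\<lambda>i. if 0 \<le> i \<and> i < int (length w) then sym (w ! nat i) else blank, 0) t (tp, h)"
      and v: "\<And>i. i < length v \<Longrightarrow> tp (h + int i) = sym (v ! i)" and e: "tp (h + int (length v)) = blank"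
    for w v t tp h
  proof -
    define tp0 where "tp0 = (\<lambda>i. if 0 \<le> i \<and> i < int (length w) then sym (w ! nat i) else blank)"
    obtain u where u: "u \<le> t" "(conf_step ^^ u) ([c], tp0, 0) = ([], tp, h)"
      using run_conf_step[OF r, of "[]"] unfolding tp0_def by blast
    have init: "tm_init w = rep ([c], tp0, 0)"
      using iq isy by (auto simp: tm_init_def rep_def tp0_def fun_eq_iff)
    have fin: "tm_run M u (tm_init w) = (1, index ss \<circ> tp, h)"
      using steps[of "([c], tp0, 0)" u] u iq start_in_conts[of c "[]"]
      by (simp add: tm_run_def init rep_def Q_def)
    \<comment> \<open>By \<open>dist\<close> no bit symbol equals the blank, so the output cannot
      end before the last bit of \<open>v\<close>.\<close>
    have "(LEAST m. (index ss \<circ> tp) (h + int m) = 0) = length v"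
    proof (rule Least_equality)
      show "(index ss \<circ> tp) (h + int (length v)) = 0" using e isy by simp
      fix m assume "(index ss \<circ> tp) (h + int m) = 0"
      then have "tp (h + int m) = blank" using inj0 by simp
      then show "length v \<le> m" using v[of m] dist by (cases "v ! m") (auto intro: leI)
    qed
    then have "tm_output (tm_run M u (tm_init w)) = map bit_sym v"
      using v isy by (auto simp: fin tm_output_def intro!: nth_equalityI)
    then show ?thesis using u fin by (auto simp: tm_computes_within_def)
  qed
  with wf that show thesis by blast
qed

section \<open>Stack programs\<close>

datatype stk = IO | MS | SA | SB | SC

instance stk :: finite
proof
  have "(UNIV :: stk set) \<subseteq> {IO, MS, SA, SB, SC}" using stk.exhaust by blast
  then show "finite (UNIV :: stk set)" using finite_subset by blast
qed

type_synonym store = "stk \<Rightarrow> bool list"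

datatype scmd =
    Skip
  | Push stk bool
  | Pop stk
  | SSeq scmd scmd (infixr ";;" 60)
  | SIf stk "bool option \<Rightarrow> bool" scmd scmd
  | SWhile stk "bool option \<Rightarrow> bool" scmd

definition top_of :: "'a list \<Rightarrow> 'a option" where
  "top_of xs = (case xs of [] \<Rightarrow> None | x # _ \<Rightarrow> Some x)"

lemma top_of_simps [simp]: "top_of [] = None" "top_of (x # xs) = Some x"
  by (simp_all add: top_of_def)

inductive srun :: "scmd \<Rightarrow> store \<Rightarrow> nat \<Rightarrow> store \<Rightarrow> bool" where
  srun_Skip: "srun Skip s 1 s"
| srun_Push: "srun (Push i b) s 1 (s(i := b # s i))"
| srun_Pop: "srun (Pop i) s 1 (s(i := tl (s i)))"
| srun_Seq: "srun c s t s' \<Longrightarrow> srun d s' u s'' \<Longrightarrow> srun (c ;; d) s (t + u + 1) s''"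
| srun_If: "srun (if P (top_of (s i)) then c else d) s t s' \<Longrightarrow> srun (SIf i P c d) s (t + 1) s'"
| srun_While_False: "\<not> P (top_of (s i)) \<Longrightarrow> srun (SWhile i P c) s 1 s"
| srun_While_True: "P (top_of (s i)) \<Longrightarrow> srun c s t s' \<Longrightarrow> srun (SWhile i P c) s' u s''
    \<Longrightarrow> srun (SWhile i P c) s (t + u + 1) s''"
| srun_mono: "srun c s t s' \<Longrightarrow> t \<le> u \<Longrightarrow> srun c s u s'"

text \<open>Only \<open>Push\<close> lengthens a stack, by one bit at unit cost. The bound limits
  the head travel in the simulation and later the size of every computed value.\<close>

lemma srun_length: "srun c s t s' \<Longrightarrow> length (s' j) \<le> length (s j) + t"
proof (induction rule: srun.induct)
  case (srun_Seq c s t s' d u s'')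
  then show ?case by linarith
next
  case (srun_While_True P s i c t s' u s'')
  then show ?case by linarith
qed auto

text \<open>Every stack occupies one track of the tape, its bottom at position 0; position -1 carries
  the marker \<open>True\<close>, to which the head returns after every operation.\<close>

type_synonym sym = "bool \<times> (stk \<Rightarrow> bool option)"

definition tape_of :: "store \<Rightarrow> int \<Rightarrow> sym" where
  "tape_of s p = (p = -1, \<lambda>i. if 0 \<le> p \<and> p < int (length (s i)) then Some (rev (s i) ! nat p) else None)"

text \<open>The move precedes the test: from the marker at -1 the first cell inspected is 0, so an
  empty track is recognized at once.\<close>

definition scan :: "stk \<Rightarrow> sym cmd" where
  "scan i = Loop (Go True) (\<lambda>a. snd a i \<noteq> None) (Wr id) (Wr id)"

definition home :: "sym cmd" where
  "home = Loop (Wr id) (\<lambda>a. \<not> fst a) (Go False) (Wr id)"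

definition put :: "stk \<Rightarrow> bool option \<Rightarrow> sym cmd" where
  "put i x = Wr (\<lambda>a. (fst a, (snd a)(i := x)))"

definition to_top :: "stk \<Rightarrow> sym cmd" where
  "to_top i = Seq (scan i) (Go False)"

text \<open>During a test the head stands on the top cell of stack \<open>i\<close>, away from the
  marker. Both outcomes must therefore begin with \<open>home\<close>, which for a loop becomes its
  exit code.\<close>

fun compile :: "scmd \<Rightarrow> sym cmd" where
  "compile Skip = Wr id"
| "compile (Push i b) = Seq (scan i) (Seq (put i (Some b)) home)"
| "compile (Pop i) = Seq (to_top i) (Seq (put i None) home)"
| "compile (c ;; d) = Seq (compile c) (compile d)"
| "compile (SIf i P c d) = Seq (to_top i)
     (If (\<lambda>a. P (snd a i)) (Seq home (compile c)) (Seq home (compile d)))"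
| "compile (SWhile i P c) = Loop (to_top i) (\<lambda>a. P (snd a i)) (Seq home (compile c)) home"

lemma run_Wr_id: "run (Wr id) s 1 s"
  using run_Wr[of id "fst s" "snd s"] by simp

lemma run_home_aux: "run home (tape_of s, int n - 1) (5 * n + 4) (tape_of s, -1)"
proof (induction n)
  case 0
  have "run (If (\<lambda>a. \<not> fst a) (Seq (Go False) home) (Wr id)) (tape_of s, -1) (1 + 1) (tape_of s, -1)"
    by (rule run_If) (simp add: tape_of_def run_Wr_id[simplified])
  then have "run home (tape_of s, -1) (1 + (1 + 1) + 1) (tape_of s, -1)"
    unfolding home_def by (intro run_Loop[OF run_Wr_id])
  then show ?case by (auto intro: run_mono)
next
  case (Suc n)
  have "run (Go False) (tape_of s, int n) 1 (tape_of s, int n - 1)"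
    using run_Go[of False "tape_of s" "int n"] by simp
  then have "run (Seq (Go False) home) (tape_of s, int n) (1 + (5 * n + 4) + 1) (tape_of s, -1)"
    using Suc.IH by (rule run_Seq)
  then have "run (If (\<lambda>a. \<not> fst a) (Seq (Go False) home) (Wr id)) (tape_of s, int n)
      (1 + (5 * n + 4) + 1 + 1) (tape_of s, -1)"
    by (intro run_If) (simp add: tape_of_def)
  then have "run home (tape_of s, int n) (1 + (1 + (5 * n + 4) + 1 + 1) + 1) (tape_of s, -1)"
    unfolding home_def by (intro run_Loop[OF run_Wr_id])
  then show ?case by (auto intro: run_mono)
qed

lemma run_home:
  assumes "p \<ge> -1" "p \<le> int n"
  shows "run home (tape_of s, p) (5 * n + 9) (tape_of s, -1)"
proof -
  have "int (nat (p + 1)) - 1 = p" using assms by simp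
  then have "run home (tape_of s, p) (5 * nat (p + 1) + 4) (tape_of s, -1)"
    using run_home_aux[of s "nat (p + 1)"] by simp
  moreover have "5 * nat (p + 1) + 4 \<le> 5 * n + 9" using assms by auto
  ultimately show ?thesis by (rule run_mono)
qed

lemma run_scan_aux:
  "m + k = length (s i) \<Longrightarrow> run (scan i) (tape_of s, int m - 1) (5 * k + 4) (tape_of s, int (length (s i)))"
proof (induction k arbitrary: m)
  case 0
  have "run (Go True) (tape_of s, int m - 1) 1 (tape_of s, int m)"
    using run_Go[of True "tape_of s" "int m - 1"] by simp
  moreover have "run (If (\<lambda>a. snd a i \<noteq> None) (Seq (Wr id) (scan i)) (Wr id)) (tape_of s, int m) (1 + 1) (tape_of s, int m)"
    using 0 by (intro run_If) (simp add: tape_of_def run_Wr_id[simplified])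
  ultimately have "run (scan i) (tape_of s, int m - 1) (1 + (1 + 1) + 1) (tape_of s, int m)"
    unfolding scan_def by (rule run_Loop)
  then show ?case using 0 by (auto intro: run_mono)
next
  case (Suc k)
  have "run (scan i) (tape_of s, int (Suc m) - 1) (5 * k + 4) (tape_of s, int (length (s i)))"
    by (rule Suc.IH) (use Suc.prems in simp)
  then have "run (Seq (Wr id) (scan i)) (tape_of s, int m) (1 + (5 * k + 4) + 1) (tape_of s, int (length (s i)))"
    by (intro run_Seq[OF run_Wr_id]) simp
  then have 1: "run (If (\<lambda>a. snd a i \<noteq> None) (Seq (Wr id) (scan i)) (Wr id)) (tape_of s, int m)
      (1 + (5 * k + 4) + 1 + 1) (tape_of s, int (length (s i)))"
    using Suc.prems by (intro run_If) (simp add: tape_of_def)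
  have "run (Go True) (tape_of s, int m - 1) 1 (tape_of s, int m)"
    using run_Go[of True "tape_of s" "int m - 1"] by simp
  from run_Loop[OF this 1[unfolded scan_def]]
  show ?case unfolding scan_def by (auto intro: run_mono)
qed

lemma run_scan: "run (scan i) (tape_of s, -1) (5 * length (s i) + 4) (tape_of s, int (length (s i)))"
  using run_scan_aux[of 0 "length (s i)" s i] by simp

lemma run_to_top:
  "run (to_top i) (tape_of s, -1) (5 * length (s i) + 6) (tape_of s, int (length (s i)) - 1)"
  unfolding to_top_def
  using run_Seq[OF run_scan[of i s] run_Go[of False]] by (simp add: add.commute)

text \<open>For an empty stack the position is -1, where all tracks are \<open>None\<close>; this
  matches \<open>top_of []\<close>.\<close>

lemma track_at_top: "snd (tape_of s (int (length (s i)) - 1)) i = top_of (s i)"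
  by (cases "s i") (auto simp: tape_of_def nth_append)

lemma tape_of_push:
  "(tape_of s)(int (length (s i)) := (fst (tape_of s (int (length (s i)))), (snd (tape_of s (int (length (s i)))))(i := Some b)))
    = tape_of (s(i := b # s i))"
  by (rule ext) (auto simp: tape_of_def nth_append fun_eq_iff)

text \<open>Popping an empty stack writes \<open>None\<close> into the marker cell, whose tracks are
  empty anyway, in accordance with \<open>tl [] = []\<close>.\<close>

lemma tape_of_pop:
  "(tape_of s)(int (length (s i)) - 1 := (fst (tape_of s (int (length (s i)) - 1)),
     (snd (tape_of s (int (length (s i)) - 1)))(i := None))) = tape_of (s(i := tl (s i)))"
proof (cases "s i")
  case Nil
  then show ?thesis by (auto simp: tape_of_def fun_eq_iff)
next
  case (Cons b bs)
  show ?thesis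
    by (rule ext) (auto simp: tape_of_def nth_append Cons fun_eq_iff)
qed

text \<open>Heights grow by at most the elapsed time, so \<open>B\<close> bounds every stack
  throughout the run, and a stack operation is a sweep to the top and back within
  \<open>10 * B + 30\<close> steps. The hypothesis on \<open>B\<close> passes to later subcommands
  because the growth caused so far is paid for by the time already spent.\<close>

lemma run_compile:
  assumes "srun c s t s'" "\<And>i. length (s i) + t \<le> B"
  shows "run (compile c) (tape_of s, -1) (t * (10 * B + 30)) (tape_of s', -1)"
  using assms
proof (induction arbitrary: B rule: srun.induct)
  case (srun_Skip s)
  show ?case by (auto intro: run_mono[OF run_Wr_id])
next
  case (srun_Push i b s)
  have B: "length (s i) + 1 \<le> B" using srun_Push by simp
  have "run (put i (Some b)) (tape_of s, int (length (s i))) 1 (tape_of (s(i := b # s i)), int (length (s i)))"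
    unfolding put_def tape_of_push[symmetric] by (rule run_Wr)
  from run_Seq[OF run_scan run_Seq[OF this run_home[where n = "length (s i)"]]]
  have "run (compile (Push i b)) (tape_of s, -1)
     (5 * length (s i) + 4 + (1 + (5 * length (s i) + 9) + 1) + 1) (tape_of (s(i := b # s i)), -1)"
    by simp
  then show ?case by (rule run_mono) (use B in simp)
next
  case (srun_Pop i s)
  have B: "length (s i) + 1 \<le> B" using srun_Pop by simp
  have "run (put i None) (tape_of s, int (length (s i)) - 1) 1 (tape_of (s(i := tl (s i))), int (length (s i)) - 1)"
    unfolding put_def tape_of_pop[symmetric] by (rule run_Wr)
  from run_Seq[OF run_to_top run_Seq[OF this run_home[where n = "length (s i)"]]]
  have "run (compile (Pop i)) (tape_of s, -1)
     (5 * length (s i) + 6 + (1 + (5 * length (s i) + 9) + 1) + 1) (tape_of (s(i := tl (s i))), -1)"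
    by simp
  then show ?case by (rule run_mono) (use B in simp)
next
  case (srun_Seq c s t s' d u s'')
  have "length (s' i) + u \<le> B" for i
    using srun_length[OF srun_Seq.hyps(1), of i] srun_Seq.prems[of i] by simp
  then have "run (compile d) (tape_of s', -1) (u * (10 * B + 30)) (tape_of s'', -1)"
    by (rule srun_Seq.IH(2))
  moreover have "length (s i) + t \<le> B" for i using srun_Seq.prems[of i] by simp
  then have "run (compile c) (tape_of s, -1) (t * (10 * B + 30)) (tape_of s', -1)"
    by (rule srun_Seq.IH(1))
  ultimately have "run (compile (c ;; d)) (tape_of s, -1)
     (t * (10 * B + 30) + u * (10 * B + 30) + 1) (tape_of s'', -1)"
    unfolding compile.simps by (metis run_Seq)
  then show ?case by (rule run_mono) (simp add: algebra_simps)
next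
  case (srun_If P s i c d t s')
  let ?h = "int (length (s i)) - 1" and ?e = "if P (top_of (s i)) then c else d"
  have B: "length (s i) + t + 1 \<le> B" using srun_If.prems[of i] by simp
  have "length (s i) + t \<le> B" for i using srun_If.prems[of i] by simp
  then have "run (compile ?e) (tape_of s, -1) (t * (10 * B + 30)) (tape_of s', -1)"
    by (rule srun_If.IH)
  then have "run (Seq home (compile ?e)) (tape_of s, ?h) (5 * length (s i) + 9 + t * (10 * B + 30) + 1) (tape_of s', -1)"
    by (intro run_Seq[OF run_home]) simp_all
  then have "run (If (\<lambda>a. P (snd a i)) (Seq home (compile c)) (Seq home (compile d))) (tape_of s, ?h)
     (5 * length (s i) + 9 + t * (10 * B + 30) + 1 + 1) (tape_of s', -1)"
    by (intro run_If) (simp add: track_at_top if_distrib split: if_splits)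
  from run_Seq[OF run_to_top this]
  have "run (compile (SIf i P c d)) (tape_of s, -1)
     (5 * length (s i) + 6 + (5 * length (s i) + 9 + t * (10 * B + 30) + 1 + 1) + 1) (tape_of s', -1)"
    by simp
  then show ?case by (rule run_mono) (use B in simp)
next
  case (srun_While_False P s i c)
  let ?h = "int (length (s i)) - 1"
  have B: "length (s i) + 1 \<le> B" using srun_While_False by simp
  have "run (If (\<lambda>a. P (snd a i)) (Seq (Seq home (compile c)) (compile (SWhile i P c))) home) (tape_of s, ?h)
     (5 * length (s i) + 9 + 1) (tape_of s, -1)"
    by (rule run_If) (simp add: track_at_top srun_While_False.hyps run_home)
  from run_Loop[OF run_to_top this[simplified compile.simps]]
  have "run (compile (SWhile i P c)) (tape_of s, -1)
     (5 * length (s i) + 6 + (5 * length (s i) + 9 + 1) + 1) (tape_of s, -1)"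
    by simp
  then show ?case by (rule run_mono) (use B in simp)
next
  case (srun_While_True P s i c t s' u s'')
  let ?h = "int (length (s i)) - 1"
  have B: "length (s i) + t + u + 1 \<le> B" using srun_While_True.prems[of i] by simp
  have "length (s' i) + u \<le> B" for i
    using srun_length[OF srun_While_True.hyps(2), of i] srun_While_True.prems[of i] by simp
  then have 2: "run (compile (SWhile i P c)) (tape_of s', -1) (u * (10 * B + 30)) (tape_of s'', -1)"
    by (rule srun_While_True.IH(2))
  have "length (s i) + t \<le> B" for i using srun_While_True.prems[of i] by simp
  then have 1: "run (compile c) (tape_of s, -1) (t * (10 * B + 30)) (tape_of s', -1)"
    by (rule srun_While_True.IH(1))
  have "run home (tape_of s, ?h) (5 * length (s i) + 9) (tape_of s, -1)"
    by (rule run_home) simp_all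
  from run_Seq[OF run_Seq[OF this 1] 2]
  have "run (If (\<lambda>a. P (snd a i)) (Seq (Seq home (compile c)) (compile (SWhile i P c))) home) (tape_of s, ?h)
     (5 * length (s i) + 9 + t * (10 * B + 30) + 1 + u * (10 * B + 30) + 1 + 1) (tape_of s'', -1)"
    by (intro run_If) (simp add: track_at_top srun_While_True.hyps)
  from run_Loop[OF run_to_top this[simplified compile.simps]]
  have "run (compile (SWhile i P c)) (tape_of s, -1)
     (5 * length (s i) + 6 + (5 * length (s i) + 9 + t * (10 * B + 30) + 1 + u * (10 * B + 30) + 1 + 1) + 1) (tape_of s'', -1)"
    by simp
  then show ?case by (rule run_mono) (use B in \<open>simp add: algebra_simps\<close>)
next
  case (srun_mono c s t s' u)
  have "length (s i) + t \<le> B" for i using srun_mono.prems[of i] srun_mono.hyps by simp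
  then have "run (compile c) (tape_of s, -1) (t * (10 * B + 30)) (tape_of s', -1)"
    by (rule srun_mono.IH)
  then show ?case by (rule run_mono) (use srun_mono.hyps in simp)
qed

text \<open>Stacks grow to the right, so \<open>IO\<close> holds the word reversed. Its tape image
  is then the machine input except for the marker at -1, and it suffices to set the marker before
  the compiled program and to erase it afterwards.\<close>

lemma tm_computes_if_srun:
  fixes c :: scmd
  obtains M where "wf_tm M"
    "\<And>w v t. srun c ((\<lambda>_. [])(IO := rev w)) t ((\<lambda>_. [])(IO := rev v))
      \<Longrightarrow> \<exists>u \<le> t * (10 * (length w + t) + 30) + 9. tm_computes_within M w v u"
proof -
  define bsym :: "bool \<Rightarrow> sym" where "bsym b = (False, (\<lambda>_. None)(IO := Some b))" for b
  define blank :: sym where "blank = (False, \<lambda>_. None)"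
  define mark :: "bool \<Rightarrow> sym cmd" where "mark b = Wr (\<lambda>a. (b, snd a))" for b
  define prog where "prog = Seq (Go False) (Seq (mark True) (Seq (compile c) (Seq (mark False) (Go True))))"
  define inp :: "bool list \<Rightarrow> int \<Rightarrow> sym"
    where "inp w = (\<lambda>i. if 0 \<le> i \<and> i < int (length w) then bsym (w ! nat i) else blank)" for w
  define io where "io w = (\<lambda>_. [])(IO := rev w)" for w :: "bool list"
  have dist: "distinct [blank, bsym False, bsym True]"
    by (auto simp: blank_def bsym_def fun_eq_iff)
  obtain M where M: "wf_tm M"
    "\<And>w v t tp h. \<lbrakk>run prog (inp w, 0) t (tp, h);
        \<And>i. i < length v \<Longrightarrow> tp (h + int i) = bsym (v ! i); tp (h + int (length v)) = blank\<rbrakk>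
      \<Longrightarrow> \<exists>u\<le>t. tm_computes_within M w v u"
    using tm_computes_if_run[OF dist, of prog] unfolding inp_def by blast
  have mark1: "(inp w)(-1 := (True, snd (inp w (-1)))) = tape_of (io w)" for w
    by (rule ext) (auto simp: inp_def tape_of_def io_def bsym_def blank_def fun_eq_iff)
  have mark0: "(tape_of (io w))(-1 := (False, snd (tape_of (io w) (-1)))) = inp w" for w
    by (rule ext) (auto simp: inp_def tape_of_def io_def bsym_def blank_def fun_eq_iff)
  have "\<exists>u \<le> t * (10 * (length w + t) + 30) + 9. tm_computes_within M w v u"
    if r: "srun c (io w) t (io v)" for w v t
  proof -
    let ?T = "t * (10 * (length w + t) + 30)"
    have "run (compile c) (tape_of (io w), -1) ?T (tape_of (io v), -1)"
      by (rule run_compile[OF r]) (simp add: io_def)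
    moreover have "run (Seq (mark False) (Go True)) (tape_of (io v), -1) (1 + 1 + 1) (inp v, 0)"
      using run_Seq[OF run_Wr[of "\<lambda>a. (False, snd a)" "tape_of (io v)" "-1"] run_Go[of True]]
      by (simp add: mark0 mark_def)
    ultimately have "run (Seq (compile c) (Seq (mark False) (Go True))) (tape_of (io w), -1) (?T + (1 + 1 + 1) + 1) (inp v, 0)"
      by (rule run_Seq)
    moreover have "run (mark True) (inp w, -1) 1 (tape_of (io w), -1)"
      using run_Wr[of "\<lambda>a. (True, snd a)" "inp w" "-1"] by (simp add: mark1 mark_def)
    ultimately have "run (Seq (mark True) (Seq (compile c) (Seq (mark False) (Go True)))) (inp w, -1) (1 + (?T + (1 + 1 + 1) + 1) + 1) (inp v, 0)"
      by (metis run_Seq)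
    then have "run (Seq (mark True) (Seq (compile c) (Seq (mark False) (Go True)))) (inp w, 0 + (if False then 1 else - 1)) (1 + (?T + (1 + 1 + 1) + 1) + 1) (inp v, 0)"
      by simp
    with run_Go[of False "inp w" 0] have "run prog (inp w, 0) (1 + (1 + (?T + (1 + 1 + 1) + 1) + 1) + 1) (inp v, 0)"
      unfolding prog_def by (rule run_Seq)
    then have "run prog (inp w, 0) (?T + 9) (inp v, 0)"
      by (rule run_mono) simp
    then show ?thesis
      by (rule M(2)) (auto simp: inp_def)
  qed
  with M(1) that show thesis unfolding io_def by blast
qed

section \<open>Polynomial-time functions on structured data\<close>

text \<open>Polynomials with natural coefficients, hence monotone: an upper bound for an
  intermediate size may be substituted into a running time.\<close>

inductive polyfun :: "(nat \<Rightarrow> nat) \<Rightarrow> bool" where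
  polyfun_const: "polyfun (\<lambda>_. k)"
| polyfun_id: "polyfun (\<lambda>n. n)"
| polyfun_add: "polyfun p \<Longrightarrow> polyfun q \<Longrightarrow> polyfun (\<lambda>n. p n + q n)"
| polyfun_mult: "polyfun p \<Longrightarrow> polyfun q \<Longrightarrow> polyfun (\<lambda>n. p n * q n)"

lemma polyfun_mono: "polyfun p \<Longrightarrow> m \<le> n \<Longrightarrow> p m \<le> p n"
  by (induction rule: polyfun.induct) (auto intro: add_mono mult_mono)

lemma polyfun_comp: "polyfun p \<Longrightarrow> polyfun f \<Longrightarrow> polyfun (\<lambda>n. p (f n))"
  by (induction rule: polyfun.induct) (auto intro: polyfun.intros)

lemma polyfun_power: "polyfun p \<Longrightarrow> polyfun (\<lambda>n. p n ^ k)"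
  by (induction k) (auto intro: polyfun.intros)

lemma polyfun_Suc: "polyfun p \<Longrightarrow> polyfun (\<lambda>n. Suc (p n))"
  using polyfun_add[OF _ polyfun_const[of 1]] by simp

lemmas polyfun_intros = polyfun.intros polyfun_power polyfun_Suc

text \<open>The summand 1 absorbs the case \<open>n = 0\<close>, in which the smaller exponent may
  be 0 while the larger is not.\<close>

lemma power_le_power_add: "n ^ i \<le> n ^ (i + j) + (1::nat)"
proof (cases "n = 0")
  case False
  then have "n ^ i \<le> n ^ (i + j)" by (intro power_increasing) auto
  then show ?thesis by simp
qed (simp add: power_0_left)

lemma polyfun_bound: "polyfun p \<Longrightarrow> \<exists>a b. \<forall>n. p n \<le> a * n ^ b + a"
proof (induction rule: polyfun.induct)
  case (polyfun_const k)
  show ?case by (rule exI[of _ k]) auto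
next
  case polyfun_id
  show ?case by (rule exI[of _ 1], rule exI[of _ 1]) auto
next
  case (polyfun_add p q)
  then obtain a b a' b' where p: "\<And>n. p n \<le> a * n ^ b + a" and q: "\<And>n. q n \<le> a' * n ^ b' + a'"
    by blast
  have "p n + q n \<le> (2 * a + 2 * a') * n ^ (b + b') + (2 * a + 2 * a')" for n
  proof -
    have "a * n ^ b \<le> a * (n ^ (b + b') + 1)" "a' * n ^ b' \<le> a' * (n ^ (b + b') + 1)"
      using power_le_power_add[of n b b'] power_le_power_add[of n b' b] by (simp_all only: mult_le_mono2 add.commute)
    then show ?thesis using p[of n] q[of n] by (simp add: algebra_simps)
  qed
  then show ?case by blast
next
  case (polyfun_mult p q)
  then obtain a b a' b' where p: "\<And>n. p n \<le> a * n ^ b + a" and q: "\<And>n. q n \<le> a' * n ^ b' + a'"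
    by blast
  have "p n * q n \<le> (4 * a * a') * n ^ (b + b') + 4 * a * a'" for n
  proof -
    have "p n * q n \<le> (a * (n ^ b + 1)) * (a' * (n ^ b' + 1))"
      using mult_mono[OF p[of n] q[of n]] by (simp add: algebra_simps)
    also have "\<dots> = a * a' * (n ^ (b + b') + n ^ b + n ^ b' + 1)"
      by (simp add: algebra_simps power_add)
    also have "\<dots> \<le> a * a' * (4 * n ^ (b + b') + 4)"
    proof (rule mult_le_mono2)
      show "n ^ (b + b') + n ^ b + n ^ b' + 1 \<le> 4 * n ^ (b + b') + 4"
        using power_le_power_add[of n b b'] power_le_power_add[of n b' b] by (simp add: add.commute)
    qed
    finally show ?thesis by (simp add: algebra_simps)
  qed
  then show ?case by blast
qed

subsection \<open>Trees on the main stack\<close>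

datatype tree = Lf | Br tree tree

text \<open>Preorder is self-delimiting: a reader that counts the subtrees still missing knows where
  a code ends, so values can be stacked without separators.\<close>

fun code :: "tree \<Rightarrow> bool list" where
  "code Lf = [False]"
| "code (Br a b) = True # code a @ code b"

definition St :: "bool list \<Rightarrow> bool list \<Rightarrow> bool list \<Rightarrow> bool list \<Rightarrow> bool list \<Rightarrow> store" where
  "St io m a b c = (\<lambda>i. case i of IO \<Rightarrow> io | MS \<Rightarrow> m | SA \<Rightarrow> a | SB \<Rightarrow> b | SC \<Rightarrow> c)"

lemma St_simps [simp]:
  "St io m a b c IO = io" "St io m a b c MS = m" "St io m a b c SA = a"
  "St io m a b c SB = b" "St io m a b c SC = c"
  "(St io m a b c)(IO := x) = St x m a b c" "(St io m a b c)(MS := x) = St io x a b c"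
  "(St io m a b c)(SA := x) = St io m x b c" "(St io m a b c)(SB := x) = St io m a x c"
  "(St io m a b c)(SC := x) = St io m a b x"
  by (auto simp: St_def fun_eq_iff split: stk.splits)

abbreviation Main :: "bool list \<Rightarrow> store" where
  "Main m \<equiv> St [] m [] [] []"

lemma srun_eq: "srun c s t s' \<Longrightarrow> s' = s'' \<Longrightarrow> t \<le> u \<Longrightarrow> srun c s u s''"
  using srun_mono by blast

lemmas srun_basic = srun_Seq srun_Push srun_Pop srun_Skip

section \<open>Moving words and coded trees between stacks\<close>

definition flush :: "stk \<Rightarrow> stk \<Rightarrow> scmd" where
  "flush i j = SWhile i (\<lambda>x. x \<noteq> None)
     (SIf i (\<lambda>x. x = Some True) (Pop i ;; Push j True) (Pop i ;; Push j False))"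

definition flush2 :: "stk \<Rightarrow> stk \<Rightarrow> stk \<Rightarrow> scmd" where
  "flush2 i j k = SWhile i (\<lambda>x. x \<noteq> None)
     (SIf i (\<lambda>x. x = Some True) (Pop i ;; Push j True ;; Push k True) (Pop i ;; Push j False ;; Push k False))"

definition clear :: "stk \<Rightarrow> scmd" where
  "clear i = SWhile i (\<lambda>x. x \<noteq> None) (Pop i)"

lemma srun_flush:
  "s i = xs \<Longrightarrow> i \<noteq> j \<Longrightarrow> srun (flush i j) s (5 * length xs + 1) (s(i := [], j := rev xs @ s j))"
proof (induction xs arbitrary: s)
  case Nil
  then show ?case unfolding flush_def
    by (intro srun_eq[OF srun_While_False]) auto
next
  case (Cons b xs)
  let ?s = "s(i := xs, j := b # s j)"
  have "srun (SIf i (\<lambda>x. x = Some True) (Pop i ;; Push j True) (Pop i ;; Push j False)) s (1 + 1 + 1 + 1) ?s"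
    by (rule srun_If, cases b) (use Cons.prems in \<open>auto intro!: srun_eq[OF srun_Seq[OF srun_Pop srun_Push]]\<close>)
  moreover have "srun (flush i j) ?s (5 * length xs + 1) (?s(i := [], j := rev xs @ ?s j))"
    by (rule Cons.IH) (use Cons.prems in auto)
  ultimately have "srun (flush i j) s (1 + 1 + 1 + 1 + (5 * length xs + 1) + 1) (?s(i := [], j := rev xs @ ?s j))"
    unfolding flush_def by (rule srun_While_True[rotated]) (simp add: Cons.prems)
  then show ?case by (rule srun_eq) (use Cons.prems in \<open>auto simp: fun_eq_iff\<close>)
qed

lemma srun_flush2:
  "s i = xs \<Longrightarrow> i \<noteq> j \<Longrightarrow> i \<noteq> k \<Longrightarrow> j \<noteq> k \<Longrightarrow>
   srun (flush2 i j k) s (7 * length xs + 1) (s(i := [], j := rev xs @ s j, k := rev xs @ s k))"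
proof (induction xs arbitrary: s)
  case Nil
  then show ?case unfolding flush2_def
    by (intro srun_eq[OF srun_While_False]) auto
next
  case (Cons b xs)
  let ?s = "s(i := xs, j := b # s j, k := b # s k)"
  have "srun (SIf i (\<lambda>x. x = Some True) (Pop i ;; Push j True ;; Push k True) (Pop i ;; Push j False ;; Push k False))
      s (1 + (1 + 1 + 1) + 1 + 1) ?s"
    by (rule srun_If, cases b)
      (use Cons.prems in \<open>auto intro!: srun_eq[OF srun_Seq[OF srun_Pop srun_Seq[OF srun_Push srun_Push]]]\<close>)
  moreover have "srun (flush2 i j k) ?s (7 * length xs + 1) (?s(i := [], j := rev xs @ ?s j, k := rev xs @ ?s k))"
    by (rule Cons.IH) (use Cons.prems in auto)
  ultimately have "srun (flush2 i j k) s (1 + (1 + 1 + 1) + 1 + 1 + (7 * length xs + 1) + 1)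
      (?s(i := [], j := rev xs @ ?s j, k := rev xs @ ?s k))"
    unfolding flush2_def by (rule srun_While_True[rotated]) (simp add: Cons.prems)
  then show ?case by (rule srun_eq) (use Cons.prems in \<open>auto simp: fun_eq_iff\<close>)
qed

lemma srun_clear: "s i = xs \<Longrightarrow> srun (clear i) s (2 * length xs + 1) (s(i := []))"
proof (induction xs arbitrary: s)
  case Nil
  then show ?case unfolding clear_def
    by (intro srun_eq[OF srun_While_False]) auto
next
  case (Cons b xs)
  have "srun (clear i) (s(i := tl (s i))) (2 * length xs + 1) ((s(i := tl (s i)))(i := []))"
    by (rule Cons.IH) (simp add: Cons.prems)
  then have "srun (clear i) s (1 + (2 * length xs + 1) + 1) ((s(i := tl (s i)))(i := []))"
    unfolding clear_def by (rule srun_While_True[OF _ srun_Pop, rotated]) (simp add: Cons.prems)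
  then show ?case by (rule srun_eq) auto
qed

text \<open>The height of \<open>SC\<close> counts the subtrees that are still to be read.\<close>

definition grab_loop :: "stk \<Rightarrow> scmd" where
  "grab_loop j = SWhile SC (\<lambda>x. x \<noteq> None)
     (SIf MS (\<lambda>x. x = Some True) (Pop MS ;; Push j True ;; Push SC True) (Pop MS ;; Push j False ;; Pop SC))"

definition grab :: "stk \<Rightarrow> scmd" where
  "grab j = Push SC True ;; grab_loop j"

text \<open>Continuation form: the run that remains after reading \<open>x\<close> is a hypothesis
  with time \<open>T\<close>. For \<open>Br a b\<close> the second subtree supplies the continuation
  of the first, with one more counter bit on \<open>SC\<close>.\<close>

lemma srun_grab_loop:
  assumes "j \<noteq> MS" "j \<noteq> SC" "s MS = code x @ r" "s SC = y # cs"
    and "srun (grab_loop j) (s(MS := r, j := rev (code x) @ s j, SC := cs)) T s'"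
  shows "srun (grab_loop j) s (T + 7 * length (code x)) s'"
  using assms(3-5)
proof (induction x arbitrary: s r y cs T)
  case Lf
  let ?s = "s(MS := r, j := False # s j, SC := cs)"
  have "srun (SIf MS (\<lambda>x. x = Some True) (Pop MS ;; Push j True ;; Push SC True) (Pop MS ;; Push j False ;; Pop SC))
     s (1 + (1 + 1 + 1) + 1 + 1) ?s"
    by (rule srun_If)
      (use Lf assms(1,2) in \<open>auto intro!: srun_eq[OF srun_Seq[OF srun_Pop srun_Seq[OF srun_Push srun_Pop]]]\<close>)
  moreover have "srun (grab_loop j) ?s T s'"
    using Lf.prems(3) by (simp only: code.simps rev.simps append.simps)
  ultimately have "srun (grab_loop j) s (1 + (1 + 1 + 1) + 1 + 1 + T + 1) s'"
    unfolding grab_loop_def by (rule srun_While_True[rotated]) (simp add: Lf.prems)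
  then show ?case by (rule srun_mono) simp
next
  case (Br a b)
  let ?s = "s(MS := code a @ code b @ r, j := True # s j, SC := True # y # cs)"
  have "srun (SIf MS (\<lambda>x. x = Some True) (Pop MS ;; Push j True ;; Push SC True) (Pop MS ;; Push j False ;; Pop SC))
     s (1 + (1 + 1 + 1) + 1 + 1) ?s"
    by (rule srun_If)
      (use Br assms(1,2) in \<open>auto intro!: srun_eq[OF srun_Seq[OF srun_Pop srun_Seq[OF srun_Push srun_Push]]]\<close>)
  moreover have "srun (grab_loop j) ?s (T + 7 * length (code b) + 7 * length (code a)) s'"
  proof (rule Br.IH(1))
    show "srun (grab_loop j) (?s(MS := code b @ r, j := rev (code a) @ ?s j, SC := y # cs)) (T + 7 * length (code b)) s'"
      by (rule Br.IH(2)[where r = r and y = y and cs = cs])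
        (use Br.prems(3) assms(1,2) in \<open>auto simp: fun_upd_twist elim!: back_subst[of "\<lambda>s. srun _ s _ _"]\<close>)
  qed (use assms(1,2) in auto)
  ultimately have "srun (grab_loop j) s (1 + (1 + 1 + 1) + 1 + 1 + (T + 7 * length (code b) + 7 * length (code a)) + 1) s'"
    unfolding grab_loop_def by (rule srun_While_True[rotated]) (simp add: Br.prems)
  then show ?case by (rule srun_mono) simp
qed

lemma srun_grab:
  assumes "j \<noteq> MS" "j \<noteq> SC" "s MS = code x @ r" "s SC = []"
  shows "srun (grab j) s (7 * length (code x) + 3) (s(MS := r, j := rev (code x) @ s j))"
proof -
  let ?s = "s(SC := True # s SC)"
  have "srun (grab_loop j) ?s (1 + 7 * length (code x)) (s(MS := r, j := rev (code x) @ s j))"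
  proof (rule srun_grab_loop[where r = r and y = True and cs = "[]"])
    show "srun (grab_loop j) (?s(MS := r, j := rev (code x) @ ?s j, SC := [])) 1 (s(MS := r, j := rev (code x) @ s j))"
      unfolding grab_loop_def
      by (rule srun_eq[OF srun_While_False]) (use assms in \<open>auto simp: fun_eq_iff\<close>)
  qed (use assms in auto)
  then have "srun (grab j) s (1 + (1 + 7 * length (code x)) + 1) (s(MS := r, j := rev (code x) @ s j))"
    unfolding grab_def by (rule srun_Seq[OF srun_Push])
  then show ?thesis by (rule srun_mono) simp
qed

definition drop_tree :: scmd where
  "drop_tree = grab SA ;; clear SA"

text \<open>\<open>SB\<close> is arbitrary because \<open>tree_fst\<close> keeps the first component
  there while the second is discarded.\<close>

lemma srun_drop_tree:
  "srun drop_tree (St io (code x @ r) [] b []) (9 * length (code x) + 5) (St io r [] b [])"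
proof -
  have "srun (grab SA) (St io (code x @ r) [] b []) (7 * length (code x) + 3) (St io r (rev (code x)) b [])"
    by (rule srun_eq[OF srun_grab[where r = r]]) auto
  moreover have "srun (clear SA) (St io r (rev (code x)) b []) (2 * length (code x) + 1) (St io r [] b [])"
    by (rule srun_eq[OF srun_clear]) auto
  ultimately show ?thesis unfolding drop_tree_def
    by (intro srun_eq[OF srun_Seq]) auto
qed

text \<open>Every transfer reverses the word, so the second copy goes through \<open>SA\<close> once
  more to arrive upright on \<open>MS\<close>.\<close>

definition dup_tree :: scmd where
  "dup_tree = grab SA ;; flush2 SA MS SB ;; flush SB SA ;; flush SA MS"

lemma srun_dup_tree:
  "srun dup_tree (Main (code x @ r)) (24 * length (code x) + 9) (Main (code x @ code x @ r))"
proof -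
  have "srun (grab SA) (Main (code x @ r)) (7 * length (code x) + 3) (St [] r (rev (code x)) [] [])"
    by (rule srun_eq[OF srun_grab[where r = r]]) auto
  moreover have "srun (flush2 SA MS SB) (St [] r (rev (code x)) [] []) (7 * length (code x) + 1)
      (St [] (code x @ r) [] (code x) [])"
    by (rule srun_eq[OF srun_flush2]) auto
  moreover have "srun (flush SB SA) (St [] (code x @ r) [] (code x) []) (5 * length (code x) + 1)
      (St [] (code x @ r) (rev (code x)) [] [])"
    by (rule srun_eq[OF srun_flush]) auto
  moreover have "srun (flush SA MS) (St [] (code x @ r) (rev (code x)) [] []) (5 * length (code x) + 1)
      (Main (code x @ code x @ r))"
    by (rule srun_eq[OF srun_flush]) auto
  ultimately have "srun dup_tree (Main (code x @ r)) (7 * length (code x) + 3 + (7 * length (code x) + 1 +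
      (5 * length (code x) + 1 + (5 * length (code x) + 1) + 1) + 1) + 1) (Main (code x @ code x @ r))"
    unfolding dup_tree_def by (metis srun_Seq)
  then show ?thesis by (rule srun_mono) simp
qed

definition swap_trees :: scmd where
  "swap_trees = grab SA ;; grab SB ;; flush SA MS ;; flush SB MS"

lemma srun_swap_trees:
  "srun swap_trees (Main (code x @ code y @ r)) (12 * length (code x) + 12 * length (code y) + 11)
     (Main (code y @ code x @ r))"
proof -
  have "srun (grab SA) (Main (code x @ code y @ r)) (7 * length (code x) + 3) (St [] (code y @ r) (rev (code x)) [] [])"
    by (rule srun_eq[OF srun_grab[where r = "code y @ r"]]) auto
  moreover have "srun (grab SB) (St [] (code y @ r) (rev (code x)) [] []) (7 * length (code y) + 3)
      (St [] r (rev (code x)) (rev (code y)) [])"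
    by (rule srun_eq[OF srun_grab[where r = r]]) auto
  moreover have "srun (flush SA MS) (St [] r (rev (code x)) (rev (code y)) []) (5 * length (code x) + 1)
      (St [] (code x @ r) [] (rev (code y)) [])"
    by (rule srun_eq[OF srun_flush]) auto
  moreover have "srun (flush SB MS) (St [] (code x @ r) [] (rev (code y)) []) (5 * length (code y) + 1)
      (Main (code y @ code x @ r))"
    by (rule srun_eq[OF srun_flush]) auto
  ultimately have "srun swap_trees (Main (code x @ code y @ r)) (7 * length (code x) + 3 + (7 * length (code y) + 3 +
      (5 * length (code x) + 1 + (5 * length (code y) + 1) + 1) + 1) + 1) (Main (code y @ code x @ r))"
    unfolding swap_trees_def by (metis srun_Seq)
  then show ?thesis by (rule srun_mono) simp
qed

definition tree_fst :: scmd where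
  "tree_fst = Pop MS ;; grab SB ;; drop_tree ;; flush SB MS"

lemma srun_tree_fst:
  "srun tree_fst (Main (code (Br x y) @ r)) (13 * length (code (Br x y)) + 13) (Main (code x @ r))"
proof -
  have "srun (Pop MS) (Main (code (Br x y) @ r)) 1 (Main (code x @ code y @ r))"
    by (rule srun_eq[OF srun_Pop]) auto
  moreover have "srun (grab SB) (Main (code x @ code y @ r)) (7 * length (code x) + 3) (St [] (code y @ r) [] (rev (code x)) [])"
    by (rule srun_eq[OF srun_grab[where r = "code y @ r"]]) auto
  moreover have "srun (flush SB MS) (St [] r [] (rev (code x)) []) (5 * length (code x) + 1) (Main (code x @ r))"
    by (rule srun_eq[OF srun_flush]) auto
  ultimately have "srun tree_fst (Main (code (Br x y) @ r)) (1 + (7 * length (code x) + 3 +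
      (9 * length (code y) + 5 + (5 * length (code x) + 1) + 1) + 1) + 1) (Main (code x @ r))"
    unfolding tree_fst_def using srun_drop_tree by (metis srun_Seq)
  then show ?thesis by (rule srun_mono) simp
qed

definition tree_snd :: scmd where
  "tree_snd = Pop MS ;; drop_tree"

lemma srun_tree_snd:
  "srun tree_snd (Main (code (Br x y) @ r)) (13 * length (code (Br x y)) + 13) (Main (code y @ r))"
proof -
  have "srun (Pop MS) (Main (code (Br x y) @ r)) 1 (Main (code x @ code y @ r))"
    by (rule srun_eq[OF srun_Pop]) auto
  from srun_Seq[OF this srun_drop_tree] show ?thesis
    unfolding tree_snd_def by (rule srun_mono) simp
qed

fun push_list :: "bool list \<Rightarrow> scmd" where
  "push_list [] = Skip"
| "push_list (b # bs) = push_list bs ;; Push MS b"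

lemma srun_push_list: "srun (push_list xs) (Main r) (2 * length xs + 1) (Main (xs @ r))"
proof (induction xs)
  case Nil
  then show ?case using srun_Skip by simp
next
  case (Cons b xs)
  have "srun (Push MS b) (Main (xs @ r)) 1 (Main (b # xs @ r))"
    by (rule srun_eq[OF srun_Push]) auto
  from srun_Seq[OF Cons.IH this] show ?case by (simp add: srun_mono)
qed

subsection \<open>Typed polynomial-time functions\<close>

class dat =
  fixes to_tree :: "'a \<Rightarrow> tree"

instantiation bool :: dat
begin
definition to_tree_bool :: "bool \<Rightarrow> tree" where
  "to_tree_bool b = (if b then Br Lf Lf else Lf)"
instance ..
end

instantiation prod :: (dat, dat) dat
begin
definition to_tree_prod :: "'a \<times> 'b \<Rightarrow> tree" where
  "to_tree_prod x = Br (to_tree (fst x)) (to_tree (snd x))"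
instance ..
end

instantiation list :: (dat) dat
begin
primrec to_tree_list :: "'a list \<Rightarrow> tree" where
  "to_tree_list [] = Lf"
| "to_tree_list (x # xs) = Br (to_tree x) (to_tree_list xs)"
instance ..
end

definition cd :: "'a::dat \<Rightarrow> bool list" where
  "cd x = code (to_tree x)"

definition sz :: "'a::dat \<Rightarrow> nat" where
  "sz x = length (cd x)"

lemma cd_simps [simp]:
  "cd True = [True, False, False]" "cd False = [False]"
  "cd (a, b) = True # cd a @ cd b"
  "cd [] = [False]" "cd (y # ys) = True # cd y @ cd ys"
  by (simp_all add: cd_def to_tree_bool_def to_tree_prod_def)

lemma sz_simps [simp]:
  "sz True = 3" "sz False = 1" "sz (a, b) = Suc (sz a + sz b)"
  "sz [] = 1" "sz (y # ys) = Suc (sz y + sz ys)"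
  by (simp_all add: sz_def)

lemma sz_pos: "0 < sz x"
  by (cases "to_tree x") (auto simp: sz_def cd_def)

text \<open>The rest \<open>r\<close> below the argument is left alone and does not enter the time
  bound, so a program may run above saved data; this is what the closure properties rest on.\<close>

definition polytime :: "('a::dat \<Rightarrow> 'b::dat) \<Rightarrow> bool" where
  "polytime f \<longleftrightarrow> (\<exists>c p. polyfun p \<and> (\<forall>x r. srun c (Main (cd x @ r)) (p (sz x)) (Main (cd (f x) @ r))))"

lemma polytimeI:
  assumes "polyfun p" "\<And>x r. srun c (Main (cd x @ r)) (p (sz x)) (Main (cd (f x) @ r))"
  shows "polytime f"
  using assms unfolding polytime_def by blast

text \<open>A program adds at most one bit to \<open>MS\<close> per time unit. Enlarging the time
  polynomial by its argument makes the same \<open>p\<close> bound time and output size.\<close>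

lemma polytimeE:
  assumes "polytime f"
  obtains c p where "polyfun p" "\<And>x r. srun c (Main (cd x @ r)) (p (sz x)) (Main (cd (f x) @ r))"
    "\<And>x. sz (f x) \<le> p (sz x)"
proof -
  obtain c p where p: "polyfun p" "\<And>x r. srun c (Main (cd x @ r)) (p (sz x)) (Main (cd (f x) @ r))"
    using assms unfolding polytime_def by blast
  have "srun c (Main (cd x @ r)) (sz x + p (sz x)) (Main (cd (f x) @ r))" for x r
    using p(2) by (rule srun_mono) simp
  moreover have "sz (f x) \<le> sz x + p (sz x)" for x
    using srun_length[OF p(2)[of x "[]"], of MS] by (simp add: sz_def)
  ultimately show ?thesis
    using that[of "\<lambda>n. n + p n" c] p(1) by (simp add: polyfun_intros)
qed

lemma polytime_size:
  assumes "polytime f"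
  obtains q where "polyfun q" "\<And>x. sz (f x) \<le> q (sz x)"
  using polytimeE[OF assms] by metis

lemma polytime_id: "polytime (\<lambda>x. x)"
  by (rule polytimeI[OF polyfun_const srun_Skip])

lemma polytime_comp:
  assumes "polytime g" "polytime f"
  shows "polytime (\<lambda>x. g (f x))"
proof -
  obtain c p where c: "polyfun p" "\<And>x r. srun c (Main (cd x @ r)) (p (sz x)) (Main (cd (g x) @ r))"
    using polytimeE[OF assms(1)] by metis
  obtain d q where d: "polyfun q" "\<And>x r. srun d (Main (cd x @ r)) (q (sz x)) (Main (cd (f x) @ r))"
    "\<And>x. sz (f x) \<le> q (sz x)"
    using polytimeE[OF assms(2)] by metis
  show ?thesis
  proof (rule polytimeI)
    show "polyfun (\<lambda>n. q n + p (q n) + 1)"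
      by (intro polyfun_intros c d polyfun_comp[OF c(1)])
    show "srun (d ;; c) (Main (cd x @ r)) (q (sz x) + p (q (sz x)) + 1) (Main (cd (g (f x)) @ r))" for x r
      by (rule srun_mono[OF srun_Seq[OF d(2) c(2)]]) (simp add: polyfun_mono[OF c(1) d(3)])
  qed
qed

lemma srun_drop: "srun drop_tree (Main (cd x @ r)) (9 * sz x + 5) (Main r)"
  unfolding cd_def sz_def by (rule srun_drop_tree)

lemma srun_dup: "srun dup_tree (Main (cd x @ r)) (24 * sz x + 9) (Main (cd x @ cd x @ r))"
  unfolding cd_def sz_def by (rule srun_dup_tree)

lemma srun_swap: "srun swap_trees (Main (cd x @ cd y @ r)) (12 * sz x + 12 * sz y + 11) (Main (cd y @ cd x @ r))"
  unfolding cd_def sz_def by (rule srun_swap_trees)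

lemma polytime_const: "polytime (\<lambda>_. k)"
proof (rule polytimeI)
  show "polyfun (\<lambda>n. 9 * n + 5 + (2 * length (cd k) + 1) + 1)" by (intro polyfun_intros)
  show "srun (drop_tree ;; push_list (cd k)) (Main (cd x @ r)) (9 * sz x + 5 + (2 * length (cd k) + 1) + 1) (Main (cd k @ r))"
    for x :: 'a and r
    by (rule srun_Seq[OF srun_drop srun_push_list])
qed

lemma polytime_fst:
  fixes f :: "'a::dat \<Rightarrow> 'b::dat \<times> 'c::dat"
  assumes "polytime f"
  shows "polytime (\<lambda>x. fst (f x))"
proof -
  have "polytime (fst :: 'b \<times> 'c \<Rightarrow> 'b)"
  proof (rule polytimeI)
    show "polyfun (\<lambda>n. 13 * n + 13)" by (intro polyfun_intros)
    show "srun tree_fst (Main (cd x @ r)) (13 * sz x + 13) (Main (cd (fst x) @ r))" for x :: "'b \<times> 'c" and r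
      using srun_tree_fst[of "to_tree (fst x)" "to_tree (snd x)" r]
      by (simp add: cd_def sz_def to_tree_prod_def)
  qed
  then show ?thesis using assms by (rule polytime_comp)
qed

lemma polytime_snd:
  fixes f :: "'a::dat \<Rightarrow> 'b::dat \<times> 'c::dat"
  assumes "polytime f"
  shows "polytime (\<lambda>x. snd (f x))"
proof -
  have "polytime (snd :: 'b \<times> 'c \<Rightarrow> 'c)"
  proof (rule polytimeI)
    show "polyfun (\<lambda>n. 13 * n + 13)" by (intro polyfun_intros)
    show "srun tree_snd (Main (cd x @ r)) (13 * sz x + 13) (Main (cd (snd x) @ r))" for x :: "'b \<times> 'c" and r
      using srun_tree_snd[of "to_tree (fst x)" "to_tree (snd x)" r]
      by (simp add: cd_def sz_def to_tree_prod_def)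
  qed
  then show ?thesis using assms by (rule polytime_comp)
qed

text \<open>\<open>g\<close> is computed first, since in preorder its result lies below that of
  \<open>f\<close>; the swap brings the saved input back to the top, and the final
  \<open>True\<close> is the pair node.\<close>

lemma polytime_Pair:
  assumes "polytime f" "polytime g"
  shows "polytime (\<lambda>x. (f x, g x))"
proof -
  obtain c p where c: "polyfun p" "\<And>x r. srun c (Main (cd x @ r)) (p (sz x)) (Main (cd (f x) @ r))"
    using polytimeE[OF assms(1)] by metis
  obtain d q where d: "polyfun q" "\<And>x r. srun d (Main (cd x @ r)) (q (sz x)) (Main (cd (g x) @ r))"
    "\<And>x. sz (g x) \<le> q (sz x)"
    using polytimeE[OF assms(2)] by metis
  show ?thesis
  proof (rule polytimeI)
    show "polyfun (\<lambda>n. 24 * n + 9 + (q n + (12 * q n + 12 * n + 11 + (p n + 1 + 1) + 1) + 1) + 1)"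
      by (intro polyfun_intros c d)
    show "srun (dup_tree ;; d ;; swap_trees ;; c ;; Push MS True) (Main (cd x @ r))
      (24 * sz x + 9 + (q (sz x) + (12 * q (sz x) + 12 * sz x + 11 + (p (sz x) + 1 + 1) + 1) + 1) + 1) (Main (cd (f x, g x) @ r))"
      for x r
    proof -
      have "srun swap_trees (Main (cd (g x) @ cd x @ r)) (12 * q (sz x) + 12 * sz x + 11) (Main (cd x @ cd (g x) @ r))"
        by (rule srun_mono[OF srun_swap]) (use d(3)[of x] in simp)
      moreover have "srun (c ;; Push MS True) (Main (cd x @ cd (g x) @ r)) (p (sz x) + 1 + 1) (Main (cd (f x, g x) @ r))"
        by (rule srun_Seq[OF c(2)], rule srun_eq[OF srun_Push]) auto
      ultimately have "srun (swap_trees ;; c ;; Push MS True) (Main (cd (g x) @ cd x @ r))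
          (12 * q (sz x) + 12 * sz x + 11 + (p (sz x) + 1 + 1) + 1) (Main (cd (f x, g x) @ r))"
        by (rule srun_Seq)
      then show ?thesis by (rule srun_Seq[OF srun_dup srun_Seq[OF d(2)]])
    qed
  qed
qed

text \<open>A nonempty list and the pair of its head and tail have the same tree.\<close>

lemma polytime_Cons: "polytime f \<Longrightarrow> polytime g \<Longrightarrow> polytime (\<lambda>x. f x # g x)"
  using polytime_Pair[of f g] by (simp add: polytime_def)

lemma polytime_If:
  assumes "polytime b" "polytime f" "polytime g"
  shows "polytime (\<lambda>x. if b x then f x else g x)"
proof -
  obtain a o' where a: "polyfun o'" "\<And>x r. srun a (Main (cd x @ r)) (o' (sz x)) (Main (cd (b x) @ r))"
    using polytimeE[OF assms(1)] by metis
  obtain c p where c: "polyfun p" "\<And>x r. srun c (Main (cd x @ r)) (p (sz x)) (Main (cd (f x) @ r))"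
    using polytimeE[OF assms(2)] by metis
  obtain d q where d: "polyfun q" "\<And>x r. srun d (Main (cd x @ r)) (q (sz x)) (Main (cd (g x) @ r))"
    using polytimeE[OF assms(3)] by metis
  show ?thesis
  proof (rule polytimeI)
    \<comment> \<open>32 = 9 * 3 + 5 is the cost of dropping the code of \<open>True\<close>, the
      longer of the two Boolean codes.\<close>
    show "polyfun (\<lambda>n. 24 * n + 9 + (o' n + (32 + (p n + q n) + 1 + 1) + 1) + 1)"
      by (intro polyfun_intros a c d)
    show "srun (dup_tree ;; a ;; SIf MS (\<lambda>x. x = Some True) (drop_tree ;; c) (drop_tree ;; d)) (Main (cd x @ r))
      (24 * sz x + 9 + (o' (sz x) + (32 + (p (sz x) + q (sz x)) + 1 + 1) + 1) + 1) (Main (cd (if b x then f x else g x) @ r))"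
      for x r
    proof (rule srun_Seq[OF srun_dup srun_Seq[OF a(2) srun_If]])
      have "srun (drop_tree ;; c) (Main (cd (b x) @ cd x @ r)) (32 + (p (sz x) + q (sz x)) + 1) (Main (cd (f x) @ r))" if "b x"
        by (rule srun_mono[OF srun_Seq[OF srun_drop c(2)]]) (use that in simp)
      moreover have "srun (drop_tree ;; d) (Main (cd (b x) @ cd x @ r)) (32 + (p (sz x) + q (sz x)) + 1) (Main (cd (g x) @ r))" if "\<not> b x"
        by (rule srun_mono[OF srun_Seq[OF srun_drop d(2)]]) (use that in simp)
      ultimately show "srun (if top_of (Main (cd (b x) @ cd x @ r) MS) = Some True then drop_tree ;; c else drop_tree ;; d)
        (Main (cd (b x) @ cd x @ r)) (32 + (p (sz x) + q (sz x)) + 1) (Main (cd (if b x then f x else g x) @ r))"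
        by (cases "b x") auto
    qed
  qed
qed

text \<open>In the nonempty case the saved input is brought above the list and one
  \<open>True\<close> is pushed. Since \<open>y # ys\<close> has the code of the pair
  \<open>(y, ys)\<close>, the stack then shows \<open>(x, y, ys)\<close> without any
  rebuilding.\<close>

lemma polytime_case_list:
  assumes "polytime f" "polytime g" "polytime (\<lambda>z. h (fst z) (fst (snd z)) (snd (snd z)))"
  shows "polytime (\<lambda>x. case f x of [] \<Rightarrow> g x | y # ys \<Rightarrow> h x y ys)"
proof -
  obtain a o' where a: "polyfun o'" "\<And>x r. srun a (Main (cd x @ r)) (o' (sz x)) (Main (cd (f x) @ r))"
      "\<And>x. sz (f x) \<le> o' (sz x)"
    using polytimeE[OF assms(1)] by metis
  obtain c p where c: "polyfun p" "\<And>x r. srun c (Main (cd x @ r)) (p (sz x)) (Main (cd (g x) @ r))"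
    using polytimeE[OF assms(2)] by metis
  obtain d q where d: "polyfun q" "\<And>z r. srun d (Main (cd z @ r)) (q (sz z)) (Main (cd (h (fst z) (fst (snd z)) (snd (snd z))) @ r))"
    using polytimeE[OF assms(3)] by metis
  let ?T = "\<lambda>n. 14 + p n + 1 + (12 * o' n + 12 * n + 11 + (1 + q (n + o' n + 1) + 1) + 1)"
  show ?thesis
  proof (rule polytimeI)
    show "polyfun (\<lambda>n. 24 * n + 9 + (o' n + (?T n + 1) + 1) + 1)"
      by (intro polyfun_intros a c polyfun_comp[OF d(1)])
    show "srun (dup_tree ;; a ;; SIf MS (\<lambda>x. x = Some True) (swap_trees ;; Push MS True ;; d) (drop_tree ;; c)) (Main (cd x @ r))
      (24 * sz x + 9 + (o' (sz x) + (?T (sz x) + 1) + 1) + 1)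
      (Main (cd (case f x of [] \<Rightarrow> g x | y # ys \<Rightarrow> h x y ys) @ r))"
      for x r
    proof (rule srun_Seq[OF srun_dup srun_Seq[OF a(2) srun_If]])
      have "srun (if top_of (cd (f x) @ cd x @ r) = Some True then swap_trees ;; Push MS True ;; d else drop_tree ;; c)
        (Main (cd (f x) @ cd x @ r)) (?T (sz x)) (Main (cd (case f x of [] \<Rightarrow> g x | y # ys \<Rightarrow> h x y ys) @ r))"
      proof (cases "f x")
        case Nil
        have "srun (drop_tree ;; c) (Main (cd (f x) @ cd x @ r)) (?T (sz x)) (Main (cd (g x) @ r))"
          by (rule srun_mono[OF srun_Seq[OF srun_drop c(2)]]) (use Nil in simp)
        then show ?thesis using Nil by simp
      next
        case (Cons y ys)
        have "srun swap_trees (Main (cd (f x) @ cd x @ r)) (12 * sz (f x) + 12 * sz x + 11) (Main (cd x @ cd (f x) @ r))"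
          by (rule srun_swap)
        moreover have "srun (Push MS True) (Main (cd x @ cd (f x) @ r)) 1 (Main (cd (x, y, ys) @ r))"
          by (rule srun_eq[OF srun_Push]) (use Cons in auto)
        moreover have "srun d (Main (cd (x, y, ys) @ r)) (q (sz (x, y, ys))) (Main (cd (h x y ys) @ r))"
          using d(2)[of "(x, y, ys)" r] by simp
        ultimately have "srun (swap_trees ;; Push MS True ;; d) (Main (cd (f x) @ cd x @ r))
            (12 * sz (f x) + 12 * sz x + 11 + (1 + q (sz (x, y, ys)) + 1) + 1) (Main (cd (h x y ys) @ r))"
          by (intro srun_Seq)
        moreover have "sz (x, y, ys) \<le> sz x + o' (sz x) + 1"
          using a(3)[of x] Cons by simp
        then have "q (sz (x, y, ys)) \<le> q (sz x + o' (sz x) + 1)"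
          by (rule polyfun_mono[OF d(1)])
        then have "12 * sz (f x) + 12 * sz x + 11 + (1 + q (sz (x, y, ys)) + 1) + 1 \<le> ?T (sz x)"
          using a(3)[of x] by linarith
        ultimately have "srun (swap_trees ;; Push MS True ;; d) (Main (cd (f x) @ cd x @ r)) (?T (sz x)) (Main (cd (h x y ys) @ r))"
          by (rule srun_mono)
        then show ?thesis using Cons by simp
      qed
      then show "srun (if top_of (Main (cd (f x) @ cd x @ r) MS) = Some True then swap_trees ;; Push MS True ;; d else drop_tree ;; c)
        (Main (cd (f x) @ cd x @ r)) (?T (sz x)) (Main (cd (case f x of [] \<Rightarrow> g x | y # ys \<Rightarrow> h x y ys) @ r))"
        by simp
    qed
  qed
qed

text \<open>Iterating a polynomial-time function can make its data grow exponentially. Hence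
  \<open>q\<close> must bound the number of rounds and all intermediate states in terms of the
  original input. The count \<open>n x\<close> exists only in the analysis; the program stops by
  evaluating \<open>b\<close>.\<close>

lemma polytime_while:
  fixes g :: "'a::dat \<Rightarrow> 'a" and f :: "'b::dat \<Rightarrow> 'a"
  assumes "polytime b" "polytime g" "polyfun q" "polytime f"
    and n: "\<And>x. n x \<le> q (sz x)"
    and bound: "\<And>x i. i \<le> n x \<Longrightarrow> sz ((g ^^ i) (f x)) \<le> q (sz x)"
    and stay: "\<And>x i. i < n x \<Longrightarrow> b ((g ^^ i) (f x))"
    and leave: "\<And>x. \<not> b ((g ^^ n x) (f x))"
  shows "polytime (\<lambda>x. (g ^^ n x) (f x))"
proof -
  obtain a o' where a: "polyfun o'" "\<And>x r. srun a (Main (cd x @ r)) (o' (sz x)) (Main (cd (b x) @ r))"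
    using polytimeE[OF assms(1)] by metis
  obtain c p where c: "polyfun p" "\<And>x r. srun c (Main (cd x @ r)) (p (sz x)) (Main (cd (g x) @ r))"
    using polytimeE[OF assms(2)] by metis
  obtain d o0 where d: "polyfun o0" "\<And>x r. srun d (Main (cd x @ r)) (o0 (sz x)) (Main (cd (f x) @ r))"
    using polytimeE[OF assms(4)] by metis
  define body where "body = drop_tree ;; c ;; dup_tree ;; a"
  define T where "T m = 32 + (p (q m) + (24 * q m + 9 + o' (q m) + 1) + 1) + 1" for m
  have T: "polyfun T" unfolding T_def
    by (intro polyfun_intros polyfun_comp[OF a(1)] polyfun_comp[OF c(1)] assms(3))
  \<comment> \<open>Invariant: the value of the test lies above the current state, so its top bit
    decides on another round. The last such value, \<open>False\<close>, is dropped after the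
    loop.\<close>
  have loop: "srun (SWhile MS (\<lambda>x. x = Some True) body) (Main (cd (b ((g ^^ i) (f x))) @ cd ((g ^^ i) (f x)) @ r))
      (k * (T (sz x) + 1) + 1) (Main (cd False @ cd ((g ^^ n x) (f x)) @ r))" if "i + k = n x" for i k x r
    using that
  proof (induction k arbitrary: i)
    case 0
    then show ?case using leave[of x] by (auto intro: srun_While_False[simplified])
  next
    case (Suc k)
    let ?x = "(g ^^ i) (f x)"
    have bx: "b ?x" using stay[of i x] Suc.prems by simp
    have s1: "sz ?x \<le> q (sz x)" and s2: "sz (g ?x) \<le> q (sz x)"
      using bound[of i x] bound[of "Suc i" x] Suc.prems by simp_all
    have "srun drop_tree (Main (cd (b ?x) @ cd ?x @ r)) 32 (Main (cd ?x @ r))"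
      by (rule srun_mono[OF srun_drop]) (simp add: bx)
    moreover have "srun c (Main (cd ?x @ r)) (p (q (sz x))) (Main (cd (g ?x) @ r))"
      by (rule srun_mono[OF c(2)]) (rule polyfun_mono[OF c(1) s1])
    moreover have "srun dup_tree (Main (cd (g ?x) @ r)) (24 * q (sz x) + 9) (Main (cd (g ?x) @ cd (g ?x) @ r))"
      by (rule srun_mono[OF srun_dup]) (use s2 in simp)
    moreover have "srun a (Main (cd (g ?x) @ cd (g ?x) @ r)) (o' (q (sz x))) (Main (cd (b (g ?x)) @ cd (g ?x) @ r))"
      by (rule srun_mono[OF a(2)]) (rule polyfun_mono[OF a(1) s2])
    ultimately have "srun body (Main (cd (b ?x) @ cd ?x @ r)) (T (sz x)) (Main (cd (b (g ?x)) @ cd (g ?x) @ r))"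
      unfolding body_def T_def by (intro srun_Seq)
    moreover have "srun (SWhile MS (\<lambda>x. x = Some True) body) (Main (cd (b (g ?x)) @ cd (g ?x) @ r))
      (k * (T (sz x) + 1) + 1) (Main (cd False @ cd ((g ^^ n x) (f x)) @ r))"
      using Suc.IH[of "Suc i"] Suc.prems by simp
    ultimately have "srun (SWhile MS (\<lambda>x. x = Some True) body) (Main (cd (b ?x) @ cd ?x @ r))
      (T (sz x) + (k * (T (sz x) + 1) + 1) + 1) (Main (cd False @ cd ((g ^^ n x) (f x)) @ r))"
      using bx by (intro srun_While_True) simp_all
    then show ?case by (rule srun_mono) simp
  qed
  show ?thesis
  proof (rule polytimeI)
    show "polyfun (\<lambda>m. o0 m + (24 * q m + 9 + (o' (q m) + (q m * (T m + 1) + 1 + 14 + 1) + 1) + 1) + 1)"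
      by (intro polyfun_intros d polyfun_comp[OF a(1)] T assms(3))
    show "srun (d ;; dup_tree ;; a ;; SWhile MS (\<lambda>x. x = Some True) body ;; drop_tree) (Main (cd x @ r))
      (o0 (sz x) + (24 * q (sz x) + 9 + (o' (q (sz x)) + (q (sz x) * (T (sz x) + 1) + 1 + 14 + 1) + 1) + 1) + 1)
      (Main (cd ((g ^^ n x) (f x)) @ r))" for x r
    proof (rule srun_Seq[OF d(2) srun_Seq[OF _ srun_Seq[OF _ srun_Seq]]])
      have s: "sz (f x) \<le> q (sz x)" using bound[of 0 x] by simp
      show "srun dup_tree (Main (cd (f x) @ r)) (24 * q (sz x) + 9) (Main (cd (f x) @ cd (f x) @ r))"
        by (rule srun_mono[OF srun_dup]) (use s in simp)
      show "srun a (Main (cd (f x) @ cd (f x) @ r)) (o' (q (sz x))) (Main (cd (b (f x)) @ cd (f x) @ r))"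
        by (rule srun_mono[OF a(2)]) (rule polyfun_mono[OF a(1) s])
      have "srun (SWhile MS (\<lambda>x. x = Some True) body) (Main (cd (b (f x)) @ cd (f x) @ r))
         (n x * (T (sz x) + 1) + 1) (Main (cd False @ cd ((g ^^ n x) (f x)) @ r))"
        using loop[of 0 "n x" x r] by simp
      then show "srun (SWhile MS (\<lambda>x. x = Some True) body) (Main (cd (b (f x)) @ cd (f x) @ r))
         (q (sz x) * (T (sz x) + 1) + 1) (Main (cd False @ cd ((g ^^ n x) (f x)) @ r))"
        by (rule srun_mono) (simp only: add_le_mono1 mult_le_mono1 n)
      show "srun drop_tree (Main (cd False @ cd ((g ^^ n x) (f x)) @ r)) 14 (Main (cd ((g ^^ n x) (f x)) @ r))"
        by (rule srun_mono[OF srun_drop]) simp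
    qed
  qed
qed

subsection \<open>From polynomial-time functions to Turing machines\<close>

text \<open>The top of \<open>IO\<close> is the last input bit, so the list is built from its end. A
  list cell is \<open>True\<close> followed by the code of the bit, and these bits are pushed in
  reverse order. Conversely, \<open>unload\<close> pushes the result from its first bit on and so
  leaves it reversed on \<open>IO\<close>.\<close>

definition load :: scmd where
  "load = Push MS False ;; SWhile IO (\<lambda>x. x \<noteq> None)
     (SIf IO (\<lambda>x. x = Some True)
       (Pop IO ;; Push MS False ;; Push MS False ;; Push MS True ;; Push MS True)
       (Pop IO ;; Push MS False ;; Push MS True))"

definition unload :: scmd where
  "unload = SWhile MS (\<lambda>x. x = Some True)
     (Pop MS ;; SIf MS (\<lambda>x. x = Some True)
       (Pop MS ;; Pop MS ;; Pop MS ;; Push IO True)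
       (Pop MS ;; Push IO False)) ;; Pop MS"

lemma srun_load: "srun load (St (rev w) [] [] [] []) (11 * length w + 3) (Main (cd w))"
proof -
  define W where "W = SWhile IO (\<lambda>x. x \<noteq> None)
     (SIf IO (\<lambda>x. x = Some True)
       (Pop IO ;; Push MS False ;; Push MS False ;; Push MS True ;; Push MS True)
       (Pop IO ;; Push MS False ;; Push MS True))"
  have loop: "srun W (St (rev u) (cd v) [] [] []) (11 * length u + 1) (Main (cd (u @ v)))" for u v
  proof (induction u arbitrary: v rule: rev_induct)
    case Nil
    then show ?case unfolding W_def by (intro srun_eq[OF srun_While_False]) auto
  next
    case (snoc b u)
    have "srun (SIf IO (\<lambda>x. x = Some True)
       (Pop IO ;; Push MS False ;; Push MS False ;; Push MS True ;; Push MS True)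
       (Pop IO ;; Push MS False ;; Push MS True)) (St (rev (u @ [b])) (cd v) [] [] [])
       (1 + (1 + (1 + (1 + 1 + 1) + 1) + 1) + 1 + 1) (St (rev u) (cd (b # v)) [] [] [])"
    proof (rule srun_If, cases b)
      case True
      then show "srun (if top_of (St (rev (u @ [b])) (cd v) [] [] [] IO) = Some True
        then Pop IO ;; Push MS False ;; Push MS False ;; Push MS True ;; Push MS True
        else Pop IO ;; Push MS False ;; Push MS True) (St (rev (u @ [b])) (cd v) [] [] [])
        (1 + (1 + (1 + (1 + 1 + 1) + 1) + 1) + 1) (St (rev u) (cd (b # v)) [] [] [])"
        by simp (rule srun_eq, (rule srun_basic)+, simp_all)
    next
      case False
      then show "srun (if top_of (St (rev (u @ [b])) (cd v) [] [] [] IO) = Some True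
        then Pop IO ;; Push MS False ;; Push MS False ;; Push MS True ;; Push MS True
        else Pop IO ;; Push MS False ;; Push MS True) (St (rev (u @ [b])) (cd v) [] [] [])
        (1 + (1 + (1 + (1 + 1 + 1) + 1) + 1) + 1) (St (rev u) (cd (b # v)) [] [] [])"
        by simp (rule srun_eq, (rule srun_basic)+, simp_all)
    qed
    from srun_While_True[OF _ this snoc.IH[of "b # v", unfolded W_def]]
    show ?case unfolding W_def by (auto intro: srun_mono)
  qed
  have "srun (Push MS False) (St (rev w) [] [] [] []) 1 (St (rev w) (cd ([] :: bool list)) [] [] [])"
    by (rule srun_eq[OF srun_Push]) auto
  from srun_Seq[OF this loop[of w "[]"]] show ?thesis
    unfolding load_def W_def by (auto intro: srun_mono)
qed

lemma srun_unload: "srun unload (Main (cd w)) (12 * length w + 3) (St (rev w) [] [] [] [])"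
proof -
  define W where "W = SWhile MS (\<lambda>x. x = Some True)
     (Pop MS ;; SIf MS (\<lambda>x. x = Some True)
       (Pop MS ;; Pop MS ;; Pop MS ;; Push IO True)
       (Pop MS ;; Push IO False))"
  have loop: "srun W (St io (cd w) [] [] []) (12 * length w + 1) (St (rev w @ io) [False] [] [] [])" for io
  proof (induction w arbitrary: io)
    case Nil
    then show ?case unfolding W_def by (intro srun_eq[OF srun_While_False]) auto
  next
    case (Cons b w)
    let ?m = "(if b then [True, False, False] else [False]) @ cd w"
    have "srun (Pop MS) (St io (cd (b # w)) [] [] []) 1 (St io ?m [] [] [])"
      by (rule srun_eq[OF srun_Pop]) auto
    moreover have "srun (SIf MS (\<lambda>x. x = Some True) (Pop MS ;; Pop MS ;; Pop MS ;; Push IO True)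
       (Pop MS ;; Push IO False)) (St io ?m [] [] []) (8 + 1) (St (b # io) (cd w) [] [] [])"
    proof (rule srun_If, cases b)
      case True
      then show "srun (if top_of (St io ?m [] [] [] MS) = Some True then Pop MS ;; Pop MS ;; Pop MS ;; Push IO True
        else Pop MS ;; Push IO False) (St io ?m [] [] []) 8 (St (b # io) (cd w) [] [] [])"
        by simp (rule srun_eq, (rule srun_basic)+, simp_all)
    next
      case False
      then show "srun (if top_of (St io ?m [] [] [] MS) = Some True then Pop MS ;; Pop MS ;; Pop MS ;; Push IO True
        else Pop MS ;; Push IO False) (St io ?m [] [] []) 8 (St (b # io) (cd w) [] [] [])"
        by simp (rule srun_eq, (rule srun_basic)+, simp_all)
    qed
    ultimately have "srun (Pop MS ;; SIf MS (\<lambda>x. x = Some True)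
       (Pop MS ;; Pop MS ;; Pop MS ;; Push IO True)
       (Pop MS ;; Push IO False)) (St io (cd (b # w)) [] [] []) (1 + (8 + 1) + 1) (St (b # io) (cd w) [] [] [])"
      by (rule srun_Seq)
    from srun_While_True[OF _ this Cons.IH[of "b # io", unfolded W_def]]
    show ?case unfolding W_def by (auto intro: srun_mono)
  qed
  have "srun (Pop MS) (St (rev w @ []) [False] [] [] []) 1 (St (rev w) [] [] [] [])"
    by (rule srun_eq[OF srun_Pop]) auto
  from srun_Seq[OF loop[of "[]"] this] show ?thesis
    unfolding unload_def W_def by (auto intro: srun_mono)
qed

lemma sz_bits: "sz (w :: bool list) \<le> 4 * length w + 1" "length w \<le> sz w"
proof -
  show "sz w \<le> 4 * length w + 1"
  proof (induction w)
    case (Cons b w)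
    then show ?case by (cases b) auto
  qed simp
  show "length w \<le> sz w" by (induction w) auto
qed

theorem polytime_imp_tm:
  fixes f :: "bool list \<Rightarrow> bool list"
  assumes "polytime f"
  obtains M a b where "wf_tm M" "\<And>w. \<exists>t \<le> a * length w ^ b + a. tm_computes_within M w (f w) t"
proof -
  obtain c p where c: "polyfun p" "\<And>x r. srun c (Main (cd x @ r)) (p (sz x)) (Main (cd (f x) @ r))"
      "\<And>x. sz (f x) \<le> p (sz x)"
    using polytimeE[OF assms] by metis
  obtain M where M: "wf_tm M"
    "\<And>w v t. srun (load ;; c ;; unload) ((\<lambda>_. [])(IO := rev w)) t ((\<lambda>_. [])(IO := rev v))
      \<Longrightarrow> \<exists>u \<le> t * (10 * (length w + t) + 30) + 9. tm_computes_within M w v u"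
    using tm_computes_if_srun[of "load ;; c ;; unload"] by metis
  define T where "T n = 11 * n + 3 + (p (4 * n + 1) + (12 * p (4 * n + 1) + 3) + 1) + 1" for n
  have io: "(\<lambda>_. [])(IO := u) = St u [] [] [] []" for u
    by (auto simp: St_def fun_eq_iff split: stk.splits)
  have run: "srun (load ;; c ;; unload) ((\<lambda>_. [])(IO := rev w)) (T (length w)) ((\<lambda>_. [])(IO := rev (f w)))" for w
  proof -
    have p: "p (sz w) \<le> p (4 * length w + 1)" by (rule polyfun_mono[OF c(1) sz_bits(1)])
    have "srun c (Main (cd w)) (p (4 * length w + 1)) (Main (cd (f w)))"
      using srun_mono[OF c(2)[of w "[]"] p] by simp
    moreover have "srun unload (Main (cd (f w))) (12 * p (4 * length w + 1) + 3) (St (rev (f w)) [] [] [] [])"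
      by (rule srun_mono[OF srun_unload]) (use sz_bits(2)[of "f w"] c(3)[of w] p in linarith)
    ultimately show ?thesis unfolding T_def io by (rule srun_Seq[OF srun_load srun_Seq])
  qed
  have "polyfun T" unfolding T_def
    by (intro polyfun_intros polyfun_comp[OF c(1)])
  then have "polyfun (\<lambda>n. T n * (10 * (n + T n) + 30) + 9)"
    by (intro polyfun_intros)
  then obtain a b where ab: "\<And>n. T n * (10 * (n + T n) + 30) + 9 \<le> a * n ^ b + a"
    using polyfun_bound by blast
  have "\<exists>t \<le> a * length w ^ b + a. tm_computes_within M w (f w) t" for w
    using M(2)[OF run] ab by (meson le_trans)
  with M(1) that show thesis by blast
qed

subsection \<open>List processing in polynomial time\<close>

lemma length_le_sz: "length xs \<le> sz xs"
  by (induction xs) auto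

lemma sz_le_sz_list: "y \<in> set ys \<Longrightarrow> sz y \<le> sz ys"
  by (induction ys) auto

lemma sz_bool: "sz (b :: bool) \<le> 3"
  by (cases b) auto

lemma sz_prod: "sz x = Suc (sz (fst x) + sz (snd x))"
  by (cases x) simp

lemma sz_append: "sz (xs @ ys) + 1 = sz xs + sz ys"
  by (induction xs) auto

lemma sz_drop: "sz (drop i xs) \<le> sz xs"
  using sz_append[of "take i xs" "drop i xs"] sz_pos[of "take i xs"] by simp

text \<open>The loop state carries \<open>x\<close> along because \<open>h\<close> reads it in every
  round. The size bound concerns only accumulators that actually occur, those reached after a prefix
  of the list.\<close>

lemma polytime_fold:
  fixes h :: "'a::dat \<Rightarrow> 'b::dat \<Rightarrow> 'c::dat \<Rightarrow> 'c"
  assumes xs: "polytime xs" and ini: "polytime ini" and h: "polytime (\<lambda>z. h (fst z) (fst (snd z)) (snd (snd z)))"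
    and q: "polyfun q"
    and bound: "\<And>x i. i \<le> length (xs x) \<Longrightarrow> sz (fold (h x) (take i (xs x)) (ini x)) \<le> q (sz x)"
  shows "polytime (\<lambda>x. fold (h x) (xs x) (ini x))"
proof -
  define g where "g s = (case fst (snd s) of [] \<Rightarrow> s | y # ys \<Rightarrow> (fst s, ys, h (fst s) y (snd (snd s))))"
    for s :: "'a \<times> 'b list \<times> 'c"
  define b where "b s = (case fst (snd s) of [] \<Rightarrow> False | y # ys \<Rightarrow> True)"
    for s :: "'a \<times> 'b list \<times> 'c"
  have "polytime (\<lambda>z. h (fst (fst z)) (fst (snd z)) (snd (snd (fst (z :: ('a \<times> 'b list \<times> 'c) \<times> 'b \<times> 'b list)))))"
    using polytime_comp[OF h polytime_Pair[OF polytime_fst[OF polytime_fst[OF polytime_id]] polytime_Pair[OF polytime_fst[OF polytime_snd[OF polytime_id]] polytime_snd[OF polytime_snd[OF polytime_fst[OF polytime_id]]]]]]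
    by simp
  then have g: "polytime g"
    unfolding g_def by (intro polytime_case_list polytime_Pair polytime_fst polytime_snd polytime_id)
  have b: "polytime b"
    unfolding b_def by (intro polytime_case_list polytime_fst polytime_snd polytime_id polytime_const)
  have it: "i \<le> length ys \<Longrightarrow> (g ^^ i) (x, ys, a) = (x, drop i ys, fold (h x) (take i ys) a)" for i x ys a
  proof (induction i)
    case (Suc i)
    then obtain z where z: "drop i ys = z # drop (Suc i) ys" "take (Suc i) ys = take i ys @ [z]"
      by (metis Cons_nth_drop_Suc Suc_le_lessD take_Suc_conv_app_nth)
    show ?case using Suc by (simp add: z g_def)
  qed simp
  obtain qx where qx: "polyfun qx" "\<And>x. sz (xs x) \<le> qx (sz x)"
    using polytime_size[OF xs] by blast
  have "polytime (\<lambda>x. (g ^^ length (xs x)) (x, xs x, ini x))"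
  proof (rule polytime_while[OF b g])
    show "polyfun (\<lambda>n. n + qx n + q n + 2)" by (intro polyfun_intros qx q)
    show "polytime (\<lambda>x. (x, xs x, ini x))" by (intro polytime_Pair polytime_id xs ini)
    show "length (xs x) \<le> sz x + qx (sz x) + q (sz x) + 2" for x
      using qx(2)[of x] length_le_sz[of "xs x"] by simp
    show "sz ((g ^^ i) (x, xs x, ini x)) \<le> sz x + qx (sz x) + q (sz x) + 2" if "i \<le> length (xs x)" for x i
    proof -
      have "sz (drop i (xs x)) \<le> sz (xs x)"
        by (rule sz_drop)
      then show ?thesis using bound[OF that] qx(2)[of x] by (simp add: it[OF that])
    qed
    show "b ((g ^^ i) (x, xs x, ini x))" if "i < length (xs x)" for x i
      using that by (auto simp: it b_def split: list.split)
    show "\<not> b ((g ^^ length (xs x)) (x, xs x, ini x))" for x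
      by (simp add: it b_def)
  qed
  then have "polytime (\<lambda>x. snd (snd ((g ^^ length (xs x)) (x, xs x, ini x))))"
    by (intro polytime_snd)
  then show ?thesis by (simp add: it)
qed

text \<open>If each round adds at most an amount depending on the original input alone, the total
  growth is at most the number of rounds times that amount. A bound in terms of the current
  accumulator would not give this.\<close>

lemma polytime_fold_additive:
  fixes h :: "'a::dat \<Rightarrow> 'b::dat \<Rightarrow> 'c::dat \<Rightarrow> 'c"
  assumes xs: "polytime xs" and ini: "polytime ini" and h: "polytime (\<lambda>z. h (fst z) (fst (snd z)) (snd (snd z)))"
    and q: "polyfun q"
    and bound: "\<And>x y a. y \<in> set (xs x) \<Longrightarrow> sz (h x y a) \<le> sz a + q (sz x)"
  shows "polytime (\<lambda>x. fold (h x) (xs x) (ini x))"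
proof -
  obtain qx where qx: "polyfun qx" "\<And>x. sz (xs x) \<le> qx (sz x)"
    using polytime_size[OF xs] by blast
  obtain qi where qi: "polyfun qi" "\<And>x. sz (ini x) \<le> qi (sz x)"
    using polytime_size[OF ini] by blast
  show ?thesis
  proof (rule polytime_fold[OF xs ini h])
    show "polyfun (\<lambda>n. qi n + qx n * q n)" by (intro polyfun_intros qx qi q)
    fix x i assume i: "i \<le> length (xs x)"
    have "sz (fold (h x) ys a) \<le> sz a + length ys * q (sz x)" if "set ys \<subseteq> set (xs x)" for ys a
      using that
    proof (induction ys arbitrary: a)
      case (Cons y ys)
      then have "sz (fold (h x) ys (h x y a)) \<le> sz (h x y a) + length ys * q (sz x)" by simp
      also have "\<dots> \<le> sz a + q (sz x) + length ys * q (sz x)" using bound[of y x a] Cons.prems by simp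
      finally show ?case by simp
    qed simp
    from this[OF set_take_subset[of i]]
    have "sz (fold (h x) (take i (xs x)) (ini x)) \<le> sz (ini x) + length (take i (xs x)) * q (sz x)" .
    also have "\<dots> \<le> qi (sz x) + qx (sz x) * q (sz x)"
      using qi(2)[of x] qx(2)[of x] length_le_sz[of "xs x"] i
      by (intro add_mono mult_le_mono1) auto
    finally show "sz (fold (h x) (take i (xs x)) (ini x)) \<le> qi (sz x) + qx (sz x) * q (sz x)" .
  qed
qed

lemma polytime_rev:
  assumes "polytime f"
  shows "polytime (\<lambda>x. rev (f x))"
proof -
  obtain q where q: "polyfun q" "\<And>x. sz (f x) \<le> q (sz x)" using polytime_size[OF assms] by blast
  have "polytime (\<lambda>x. fold (\<lambda>y a. y # a) (f x) [])"
  proof (rule polytime_fold_additive[OF assms])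
    show "polyfun (\<lambda>n. q n + 1)" by (intro polyfun_intros q)
    show "sz (y # a) \<le> sz a + (q (sz x) + 1)" if "y \<in> set (f x)" for x y and a :: "'b list"
      using le_trans[OF sz_le_sz_list[OF that] q(2)] by simp
  qed (intro polytime_Cons polytime_fst polytime_snd polytime_id polytime_const)+
  then show ?thesis by (simp add: rev_conv_fold)
qed

lemma polytime_append:
  assumes f: "polytime f" and g: "polytime g"
  shows "polytime (\<lambda>x. f x @ g x)"
proof -
  obtain q where q: "polyfun q" "\<And>x. sz (rev (f x)) \<le> q (sz x)" using polytime_size[OF polytime_rev[OF f]] by blast
  have "polytime (\<lambda>x. fold (\<lambda>y a. y # a) (rev (f x)) (g x))"
  proof (rule polytime_fold_additive[OF polytime_rev[OF f] g])
    show "polyfun (\<lambda>n. q n + 1)" by (intro polyfun_intros q)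
    show "sz (y # a) \<le> sz a + (q (sz x) + 1)" if "y \<in> set (rev (f x))" for x y and a :: "'b list"
      using le_trans[OF sz_le_sz_list[OF that] q(2)] by simp
  qed (intro polytime_Cons polytime_fst polytime_snd polytime_id polytime_const)+
  moreover have "fold (\<lambda>y a. y # a) (rev xs) ys = xs @ ys" for xs ys :: "'b list"
    by (induction xs) auto
  ultimately show ?thesis by simp
qed

lemma polytime_uncurry:
  assumes "polytime (\<lambda>z. h (fst z) (snd z))" "polytime f" "polytime g"
  shows "polytime (\<lambda>x. h (f x) (g x))"
  using polytime_comp[OF assms(1) polytime_Pair[OF assms(2,3)]] by simp

lemma polytime_filter:
  assumes f: "polytime f" and P: "polytime (\<lambda>z. P (fst z) (snd z))"
  shows "polytime (\<lambda>x. filter (P x) (f x))"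
proof -
  obtain q where q: "polyfun q" "\<And>x. sz (rev (f x)) \<le> q (sz x)" using polytime_size[OF polytime_rev[OF f]] by blast
  have P': "polytime (\<lambda>z. P (fst z) (fst (snd z)))"
    by (intro polytime_uncurry[OF P] polytime_fst polytime_snd polytime_id)
  have "polytime (\<lambda>x. fold (\<lambda>y a. if P x y then y # a else a) (rev (f x)) [])"
  proof (rule polytime_fold_additive[OF polytime_rev[OF f]])
    show "polyfun (\<lambda>n. q n + 1)" by (intro polyfun_intros q)
    show "sz (if P x y then y # a else a) \<le> sz a + (q (sz x) + 1)" if "y \<in> set (rev (f x))" for x y a
      using le_trans[OF sz_le_sz_list[OF that] q(2)] by simp
  qed (intro polytime_Cons polytime_If P' polytime_fst polytime_snd polytime_id polytime_const)+
  moreover have "fold (\<lambda>y a. if Q y then y # a else a) (rev xs) [] = filter Q xs" for Q and xs :: "'b list"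
    by (induction xs) auto
  ultimately show ?thesis by simp
qed

lemma polytime_map:
  assumes f: "polytime f" and h: "polytime (\<lambda>z. h (fst z) (snd z))"
  shows "polytime (\<lambda>x. map (h x) (f x))"
proof -
  obtain q where q: "polyfun q" "\<And>x. sz (rev (f x)) \<le> q (sz x)" using polytime_size[OF polytime_rev[OF f]] by blast
  obtain qh where qh: "polyfun qh" "\<And>z. sz (h (fst z) (snd z)) \<le> qh (sz z)" using polytime_size[OF h] by blast
  have h': "polytime (\<lambda>z. h (fst z) (fst (snd z)))"
    by (intro polytime_uncurry[OF h] polytime_fst polytime_snd polytime_id)
  have bd: "sz (h x y) \<le> qh (n + q n + 1)" if "y \<in> set (f x)" "n = sz x" for x y n
  proof -
    have "sz (x, y) \<le> n + q n + 1"
      using le_trans[OF sz_le_sz_list[of y "rev (f x)"] q(2)] that by simp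
    from le_trans[OF qh(2) polyfun_mono[OF qh(1) this]] show ?thesis by simp
  qed
  have "polytime (\<lambda>x. fold (\<lambda>y a. h x y # a) (rev (f x)) [])"
  proof (rule polytime_fold_additive[OF polytime_rev[OF f]])
    show "polyfun (\<lambda>n. qh (n + q n + 1) + 1)" by (intro polyfun_intros q polyfun_comp[OF qh(1)])
    show "sz (h x y # a) \<le> sz a + (qh (sz x + q (sz x) + 1) + 1)" if "y \<in> set (rev (f x))" for x y a
      using bd[of y x "sz x"] that by simp
  qed (intro polytime_Cons h' polytime_fst polytime_snd polytime_id polytime_const)+
  moreover have "fold (\<lambda>y a. k y # a) (rev xs) [] = map k xs" for k :: "'b \<Rightarrow> 'c" and xs :: "'b list"
    by (induction xs) auto
  ultimately show ?thesis by simp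
qed

lemma polytime_concat:
  assumes f: "polytime f"
  shows "polytime (\<lambda>x. concat (f x))"
proof -
  obtain q where q: "polyfun q" "\<And>x. sz (rev (f x)) \<le> q (sz x)" using polytime_size[OF polytime_rev[OF f]] by blast
  have bd: "sz (y @ a) \<le> sz a + q (sz x)" if "y \<in> set (f x)" for x y a
    using le_trans[OF sz_le_sz_list[of y "rev (f x)"] q(2)] sz_append[of y a] that by simp
  have "polytime (\<lambda>x. fold (\<lambda>y a. y @ a) (rev (f x)) [])"
  proof (rule polytime_fold_additive[OF polytime_rev[OF f] _ _ q(1)])
    show "sz (y @ a) \<le> sz a + q (sz x)" if "y \<in> set (rev (f x))" for x y a
      using bd that by simp
  qed (intro polytime_append polytime_fst polytime_snd polytime_id polytime_const)+
  moreover have "fold (\<lambda>y a. y @ a) (rev xs) [] = concat xs" for xs :: "'b list list"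
    by (induction xs) auto
  ultimately show ?thesis by simp
qed

section \<open>Boolean connectives and elementary list operations\<close>

lemma polytime_cong: "polytime f \<Longrightarrow> (\<And>x. f x = g x) \<Longrightarrow> polytime g"
  using ext[of f g] by simp

lemma polytime_Not: "polytime f \<Longrightarrow> polytime (\<lambda>x. \<not> f x)"
  by (rule polytime_cong[OF polytime_If[OF _ polytime_const[of False] polytime_const[of True]]]) auto

lemma polytime_conj: "polytime f \<Longrightarrow> polytime g \<Longrightarrow> polytime (\<lambda>x. f x \<and> g x)"
  by (rule polytime_cong[OF polytime_If[OF _ _ polytime_const[of False], where b = f and f = g]]) auto

lemma polytime_disj: "polytime f \<Longrightarrow> polytime g \<Longrightarrow> polytime (\<lambda>x. f x \<or> g x)"
  by (rule polytime_cong[OF polytime_If[OF _ polytime_const[of True], where b = f and g = g]]) auto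

lemma polytime_eq_bool: "polytime f \<Longrightarrow> polytime g \<Longrightarrow> polytime (\<lambda>x. f x = (g x :: bool))"
  by (rule polytime_cong[OF polytime_If[where b = f and f = g and g = "\<lambda>x. \<not> g x"]]) (auto intro: polytime_Not)

lemma polytime_tl: "polytime f \<Longrightarrow> polytime (\<lambda>x. tl (f x))"
  using polytime_case_list[of f "\<lambda>_. []" "\<lambda>_ _ ys. ys"] by (simp add: polytime_const polytime_fst polytime_snd polytime_id tl_def)

lemma polytime_null: "polytime f \<Longrightarrow> polytime (\<lambda>x. f x = [])"
proof -
  assume "polytime f"
  then have "polytime (\<lambda>x. case f x of [] \<Rightarrow> True | _ # _ \<Rightarrow> False)"
    by (intro polytime_case_list polytime_const)
  moreover have "(case ys of [] \<Rightarrow> True | _ # _ \<Rightarrow> False) = (ys = [])" for ys :: "'b list"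
    by (cases ys) auto
  ultimately show ?thesis by simp
qed

lemmas polytime_intros = polytime_id polytime_const polytime_Pair polytime_fst polytime_snd polytime_Cons polytime_If polytime_case_list polytime_rev polytime_append
  polytime_concat polytime_Not polytime_conj polytime_disj polytime_tl polytime_null

declare bin.simps [simp del]

subsection \<open>Equality, membership and duplicate removal\<close>

definition eq_step :: "'a \<Rightarrow> bool \<times> 'a list \<Rightarrow> bool \<times> 'a list" where
  "eq_step x s = (case snd s of [] \<Rightarrow> (False, []) | y # ys \<Rightarrow> (fst s \<and> x = y, ys))"

lemma eq_step_simps:
  "eq_step x (b, []) = (False, [])" "eq_step x (b, y # ys) = (b \<and> x = y, ys)"
  by (simp_all add: eq_step_def)

text \<open>If \<open>ys\<close> runs out first the flag drops to \<open>False\<close> and never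
  recovers; if \<open>xs\<close> does, the unread rest of \<open>ys\<close> remains. Equality is the
  absence of both and of a mismatch.\<close>

lemma fold_eq_step:
  "fst (fold eq_step xs (b, ys)) \<and> snd (fold eq_step xs (b, ys)) = [] \<longleftrightarrow> b \<and> xs = ys"
proof (induction xs arbitrary: b ys)
  case (Cons x xs)
  show ?case by (cases ys) (auto simp: Cons eq_step_simps)
qed auto

lemma polytime_eq_list:
  fixes f g :: "'b::dat \<Rightarrow> 'a::dat list"
  assumes eq: "polytime (\<lambda>z. fst z = (snd z :: 'a))" and "polytime f" "polytime g"
  shows "polytime (\<lambda>x. f x = g x)"
proof -
  have "polytime (\<lambda>z. fold (\<lambda>y s. eq_step y s) (fst z) (True, snd (z :: 'a list \<times> 'a list)))"
  proof (rule polytime_fold_additive)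
    show "polytime (\<lambda>z. eq_step (fst (snd z)) (snd (snd (z :: ('a list \<times> 'a list) \<times> 'a \<times> bool \<times> 'a list))))"
      unfolding eq_step_def by (intro polytime_intros polytime_uncurry[OF eq])
    show "sz (eq_step y a) \<le> sz a + 3" for x y :: 'a and a
    proof (cases "snd a")
      case (Cons z zs)
      have "sz (eq_step y a) = Suc (sz (fst a \<and> y = z) + sz zs)"
        using Cons by (simp add: eq_step_def)
      moreover have "sz a = Suc (sz (fst a) + Suc (sz z + sz zs))"
        using Cons by (simp add: sz_prod[of a])
      ultimately show ?thesis using sz_bool[of "fst a \<and> y = z"] by linarith
    qed (simp add: eq_step_def sz_prod[of a])
  qed (intro polytime_intros polyfun_intros)+
  then have "polytime (\<lambda>z. fst (fold eq_step (fst z) (True, snd z)) \<and> snd (fold eq_step (fst z) (True, snd z :: 'a list)) = [])"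
    by (intro polytime_intros)
  then have "polytime (\<lambda>z. fst z = (snd z :: 'a list))"
    by (rule polytime_cong) (simp add: fold_eq_step)
  from polytime_uncurry[OF this assms(2,3)] show ?thesis .
qed

lemma polytime_eq_prod:
  fixes f g :: "'b::dat \<Rightarrow> 'a::dat \<times> 'c::dat"
  assumes "polytime (\<lambda>z. fst z = (snd z :: 'a))" "polytime (\<lambda>z. fst z = (snd z :: 'c))" "polytime f" "polytime g"
  shows "polytime (\<lambda>x. f x = g x)"
proof -
  have "polytime (\<lambda>x. fst (f x) = fst (g x) \<and> snd (f x) = snd (g x))"
    by (intro polytime_conj polytime_uncurry[OF assms(1)] polytime_uncurry[OF assms(2)] polytime_fst polytime_snd assms)
  then show ?thesis by (simp add: prod_eq_iff)
qed

lemma polytime_member: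
  fixes f :: "'b::dat \<Rightarrow> 'a::dat"
  assumes eq: "polytime (\<lambda>z. fst z = (snd z :: 'a))" and "polytime f" "polytime g"
  shows "polytime (\<lambda>x. f x \<in> set (g x))"
proof -
  have "polytime (\<lambda>x. fold (\<lambda>y b. b \<or> f x = y) (g x) False)"
  proof (rule polytime_fold_additive)
    show "polytime (\<lambda>z. snd (snd z) \<or> f (fst z) = fst (snd (z :: 'b \<times> 'a \<times> bool)))"
      by (intro polytime_intros polytime_uncurry[OF eq] polytime_comp[OF assms(2)])
    show "sz (a \<or> f x = y) \<le> sz a + 3" for x y a
      using sz_bool[of "a \<or> f x = y"] by simp
  qed (intro polytime_intros polyfun_intros assms)+
  moreover have "fold (\<lambda>y b. b \<or> u = y) ys c \<longleftrightarrow> c \<or> u \<in> set ys" for u :: 'a and ys c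
    by (induction ys arbitrary: c) auto
  ultimately show ?thesis by simp
qed

lemma polytime_dedup:
  fixes f :: "'b::dat \<Rightarrow> 'a::dat list"
  assumes eq: "polytime (\<lambda>z. fst z = (snd z :: 'a))" and f: "polytime f"
  shows "polytime (\<lambda>x. fold List.insert (f x) [])"
proof -
  obtain q where q: "polyfun q" "\<And>x. sz (f x) \<le> q (sz x)" using polytime_size[OF f] by blast
  have "polytime (\<lambda>x. fold (\<lambda>y a. if y \<in> set a then a else y # a) (f x) [])"
  proof (rule polytime_fold_additive)
    show "polyfun (\<lambda>n. q n + 1)" by (intro polyfun_intros q)
    show "sz (if y \<in> set a then a else y # a) \<le> sz a + (q (sz x) + 1)" if "y \<in> set (f x)" for x y a
      using le_trans[OF sz_le_sz_list[OF that] q(2)] by simp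
  qed (intro polytime_intros f polytime_member[OF eq])+
  then show ?thesis by (simp add: List.insert_def[abs_def])
qed

lemma polytime_eq_bits: "polytime f \<Longrightarrow> polytime g \<Longrightarrow> polytime (\<lambda>x. f x = (g x :: bool list))"
  by (rule polytime_eq_list[OF polytime_eq_bool]) (intro polytime_intros)+

subsection \<open>Binary numbers\<close>

fun add_carry :: "bool \<Rightarrow> bool list \<Rightarrow> bool list" where
  "add_carry c [] = (if c then [True] else [])"
| "add_carry c (b # bs) = (c \<noteq> b) # add_carry (c \<and> b) bs"

lemma add_carry_False: "add_carry False bs = bs"
  by (induction bs) auto

definition carry_step :: "bool \<Rightarrow> bool \<times> bool list \<Rightarrow> bool \<times> bool list" where
  "carry_step b s = (fst s \<and> b, (\<not> (fst s = b)) # snd s)"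

lemma fold_carry_step:
  "rev (snd (fold carry_step bs (c, a))) @ (if fst (fold carry_step bs (c, a)) then [True] else [])
     = rev a @ add_carry c bs"
  by (induction bs arbitrary: c a) (auto simp: carry_step_def)

text \<open>An increment turns a run of ones into zeros, which shrinks the code, and then sets one
  digit. The worst case is a new digit \<open>True\<close> at the end, costing 3 for the bit and 1
  for its cell. Constant growth is needed for counting by a fold.\<close>

lemma sz_add_carry: "sz (add_carry c bs) \<le> sz bs + 4"
proof (induction bs arbitrary: c)
  case (Cons b bs)
  show ?case
  proof (cases c)
    case True
    then show ?thesis using Cons[of b] add_carry_False[of bs] by (cases b) auto
  qed (simp add: add_carry_False)
qed simp

lemma polytime_add_carry:
  assumes "polytime f"
  shows "polytime (\<lambda>x. add_carry True (f x))"
proof -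
  have fold: "polytime (\<lambda>x. fold (\<lambda>y s. carry_step y s) (f x) (True, []))"
  proof (rule polytime_fold_additive)
    show "sz (carry_step y a) \<le> sz a + 7" for y a
      using sz_bool[of "fst a \<and> y"] sz_bool[of "\<not> (fst a = y)"] by (simp add: carry_step_def sz_prod[of a])
  qed (unfold carry_step_def, (intro polytime_intros polytime_eq_bool polyfun_intros assms)+)
  have "polytime (\<lambda>x. rev (snd (fold (\<lambda>y s. carry_step y s) (f x) (True, []))) @
      (if fst (fold (\<lambda>y s. carry_step y s) (f x) (True, [])) then [True] else []))"
    by (intro polytime_append polytime_rev polytime_snd polytime_If polytime_fst fold polytime_const)
  then show ?thesis by (simp only: fold_carry_step) simp
qed

lemma bin_0 [simp]: "bin 0 = []"
  by (simp add: bin.simps)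

lemma bin_pos: "0 < n \<Longrightarrow> bin n = odd n # bin (n div 2)"
  by (simp add: bin.simps[of n])

lemma add_carry_bin: "add_carry True (bin n) = bin (Suc n)"
proof (induction n rule: bin.induct)
  case (1 n)
  show ?case
  proof (cases "n = 0")
    case True
    then show ?thesis by (simp add: bin_pos)
  next
    case False
    have "bin (Suc n) = even n # bin (Suc n div 2)" by (simp add: bin_pos)
    then show ?thesis using False 1 by (cases "odd n") (auto simp: bin_pos[of n] add_carry_False)
  qed
qed

definition bin_length :: "'a list \<Rightarrow> bool list" where
  "bin_length xs = fold (\<lambda>_. add_carry True) xs []"

lemma bin_length: "bin_length xs = bin (length xs)"
proof -
  have "fold (\<lambda>_. add_carry True) xs (bin n) = bin (n + length xs)" for n
    by (induction xs arbitrary: n) (auto simp: add_carry_bin)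
  from this[of 0] show ?thesis by (simp add: bin_length_def)
qed

lemma polytime_bin_length:
  assumes "polytime f"
  shows "polytime (\<lambda>x. bin_length (f x))"
  unfolding bin_length_def
  by (rule polytime_fold_additive[where q = "\<lambda>_. 4"]) (intro polytime_add_carry polytime_intros polyfun_intros assms sz_add_carry)+

fun bval :: "bool list \<Rightarrow> nat" where
  "bval [] = 0"
| "bval (b # bs) = of_bool b + 2 * bval bs"

lemma bval_bin: "bval (bin n) = n"
proof (induction n rule: bin.induct)
  case (1 n)
  then show ?case by (cases "n = 0") (auto simp: bin_pos)
qed

lemma bin_inject: "bin m = bin n \<longleftrightarrow> m = n"
  by (metis bval_bin)

lemma last_bin: "bin n = [] \<or> last (bin n)"
proof (induction n rule: bin.induct)
  case (1 n)
  show ?case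
  proof (cases "n = 0")
    case False
    then show ?thesis using 1 by (cases "n = 1") (auto simp: bin_pos)
  qed simp
qed

lemma power_length_bin: "0 < n \<Longrightarrow> 2 ^ length (bin n) \<le> 2 * n"
proof (induction n rule: bin.induct)
  case (1 n)
  show ?case
  proof (cases "n = 1")
    case True
    then show ?thesis by (simp add: bin_pos)
  next
    case False
    then have "2 ^ length (bin (n div 2)) \<le> 2 * (n div 2)" using 1 by simp
    then show ?thesis using 1 by (simp add: bin_pos)
  qed
qed

lemma length_bin_le: "length (bin n) \<le> n"
proof (induction n rule: bin.induct)
  case (1 n)
  show ?case
  proof (cases "n = 0")
    case False
    then have "length (bin (n div 2)) \<le> n div 2" using 1 by simp
    then show ?thesis using False by (simp add: bin_pos)
  qed simp
qed

lemma bin_power: "bin (2 ^ n) = replicate n False @ [True]"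
  by (induction n) (auto simp: bin_pos)

section \<open>Comparison of binary numbers\<close>

definition cmp_step :: "bool \<Rightarrow> bool \<times> bool list \<Rightarrow> bool \<times> bool list" where
  "cmp_step x s = (case snd s of [] \<Rightarrow> (fst s \<and> \<not> x, []) | y # ys \<Rightarrow> (if x = y then fst s else y, ys))"

definition bin_less :: "bool list \<Rightarrow> bool list \<Rightarrow> bool" where
  "bin_less xs ys = (fst (fold (\<lambda>x s. cmp_step x s) xs (False, ys)) \<or> \<not> (snd (fold (\<lambda>x s. cmp_step x s) xs (False, ys)) = []))"

lemma bval_pos: "ys \<noteq> [] \<Longrightarrow> last ys \<Longrightarrow> 0 < bval ys"
  by (induction ys) (auto split: if_splits)

text \<open>Digits arrive least significant first, so each differing pair overrides the verdict
  \<open>c\<close> reached so far. The condition on \<open>last ys\<close> excludes leading zeros,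
  so unread digits of \<open>ys\<close> make it the larger number.\<close>

lemma fold_cmp_step:
  "ys = [] \<or> last ys \<Longrightarrow> fst (fold cmp_step xs (c, ys)) \<or> snd (fold cmp_step xs (c, ys)) \<noteq> []
    \<longleftrightarrow> bval xs < bval ys \<or> bval xs = bval ys \<and> c"
proof (induction xs arbitrary: c ys)
  case Nil
  then show ?case using bval_pos[of ys] by auto
next
  case (Cons x xs)
  show ?case
  proof (cases ys)
    case Nil
    then show ?thesis using Cons.IH[of "[]" "c \<and> \<not> x"] by (auto simp: cmp_step_def)
  next
    case (Cons y zs)
    have "zs = [] \<or> last zs" using Cons.prems Cons by (auto split: if_splits)
    from Cons.IH[OF this, of "if x = y then c else y"]
    show ?thesis using Cons by (cases x; cases y) (auto simp: cmp_step_def)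
  qed
qed

lemma bin_less: "bin_less (bin m) (bin n) \<longleftrightarrow> m < n"
  using fold_cmp_step[OF last_bin, of "bin m" False n] by (simp add: bin_less_def bval_bin)

lemma polytime_bin_less:
  assumes "polytime f" "polytime g"
  shows "polytime (\<lambda>x. bin_less (f x) (g x))"
proof -
  have "polytime (\<lambda>x. fold (\<lambda>y s. cmp_step y s) (f x) (False, g x))"
  proof (rule polytime_fold_additive)
    show "sz (cmp_step y a) \<le> sz a + 3" for y a
    proof (cases "snd a")
      case Nil
      then show ?thesis using sz_bool[of "fst a \<and> \<not> y"] by (simp add: cmp_step_def sz_prod[of a])
    next
      case (Cons z zs)
      then show ?thesis using sz_bool[of "if y = z then fst a else z"] by (simp add: cmp_step_def sz_prod[of a])
    qed
  qed (unfold cmp_step_def, (intro polytime_intros polytime_eq_bool polyfun_intros assms)+)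
  then show ?thesis unfolding bin_less_def
    by (intro polytime_disj polytime_Not polytime_null polytime_fst polytime_snd)
qed

subsection \<open>Decoding instances\<close>

fun decode_nat :: "bool list \<Rightarrow> bool list \<times> bool list" where
  "decode_nat (a # b # w) = (if a = b then (a # fst (decode_nat w), snd (decode_nat w)) else ([], w))"
| "decode_nat _ = ([], [])"

lemma decode_nat_enc: "decode_nat (enc_nat n @ w) = (bin n, w)"
proof -
  have "decode_nat (concat (map (\<lambda>b. [b, b]) bs) @ False # True # w) = (bs, w)" for bs
    by (induction bs) auto
  then show ?thesis by (simp add: enc_nat_def)
qed

lemma sz_decode_nat: "sz (snd (decode_nat w)) \<le> sz w"
  by (induction w rule: decode_nat.induct) auto

text \<open>A version of \<open>decode_nat\<close> for folds: the input word serves as clock, and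
  the flag freezes the state once the terminator has been read. The digits are collected in
  reverse.\<close>

definition decode_nat_step :: "bool \<times> bool list \<times> bool list \<Rightarrow> bool \<times> bool list \<times> bool list" where
  "decode_nat_step s = (if fst s then s else
     case snd (snd s) of [] \<Rightarrow> (True, fst (snd s), [])
     | a # r \<Rightarrow> (case r of [] \<Rightarrow> (True, fst (snd s), [])
       | b # r' \<Rightarrow> (if a = b then (False, a # fst (snd s), r') else (True, fst (snd s), r'))))"

lemma decode_nat_step_simps:
  "decode_nat_step (True, a) = (True, a)" "decode_nat_step (False, bs, []) = (True, bs, [])"
  "decode_nat_step (False, bs, [x]) = (True, bs, [])"
  "decode_nat_step (False, bs, x # y # w) = (if x = y then (False, x # bs, w) else (True, bs, w))"
  by (simp_all add: decode_nat_step_def)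

lemma fold_decode_nat_step_done: "fold (\<lambda>_. decode_nat_step) c (True, a) = (True, a)"
  by (induction c) (auto simp: decode_nat_step_simps)

lemma fold_decode_nat_step:
  "length w \<le> length c \<Longrightarrow> \<exists>d. fold (\<lambda>_. decode_nat_step) c (False, a, w) = (d, rev (fst (decode_nat w)) @ a, snd (decode_nat w))"
proof (induction w arbitrary: a c rule: decode_nat.induct)
  case (1 x y w)
  then obtain z c' where c: "c = z # c'" by (cases c) auto
  show ?case
  proof (cases "x = y")
    case True
    have "\<exists>d. fold (\<lambda>_. decode_nat_step) c' (False, x # a, w) = (d, rev (fst (decode_nat w)) @ x # a, snd (decode_nat w))"
      by (rule "1.IH") (use True c "1.prems" in auto)
    then show ?thesis using True c by (auto simp: decode_nat_step_simps)
  next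
    case False
    then show ?thesis using c by (auto simp: decode_nat_step_simps fold_decode_nat_step_done)
  qed
next
  case ("2_1")
  show ?case
    by (cases c) (auto simp: decode_nat_step_simps fold_decode_nat_step_done)
next
  case ("2_2" v)
  then show ?case
    by (cases c) (auto simp: decode_nat_step_simps fold_decode_nat_step_done)
qed

lemma polytime_decode_nat:
  assumes "polytime f"
  shows "polytime (\<lambda>x. decode_nat (f x))"
proof -
  have fold: "polytime (\<lambda>w. fold (\<lambda>_ s. decode_nat_step s) w (False, [], w))"
  proof (rule polytime_fold_additive)
    show "sz (decode_nat_step s) \<le> sz s + 4" for s
    proof -
      obtain d a w where s: "s = (d, a, w)" by (metis prod_cases3)
      show ?thesis
        by (cases d; cases w rule: decode_nat.cases) (auto simp: s decode_nat_step_def)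
    qed
  qed (unfold decode_nat_step_def, (intro polytime_intros polytime_eq_bool polyfun_intros)+)
  have "polytime (\<lambda>w. (rev (fst (snd (fold (\<lambda>_ s. decode_nat_step s) w (False, [], w)))), snd (snd (fold (\<lambda>_ s. decode_nat_step s) w (False, [], w)))))"
    by (intro polytime_Pair polytime_rev polytime_fst polytime_snd fold)
  then have "polytime decode_nat"
    by (rule polytime_cong) (use fold_decode_nat_step[OF order_refl, of _ "[]"] in \<open>metis (no_types, lifting) append_Nil2 fst_conv prod.collapse rev_rev_ident snd_conv\<close>)
  from polytime_comp[OF this assms] show ?thesis .
qed

text \<open>The counter stays binary and is only compared with the length prefix \<open>n\<close>:
  on an arbitrary word that prefix may denote an exponentially large number, so it cannot drive the
  loop. The word itself is the clock.\<close>

definition decode_list_step ::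
    "(bool list \<Rightarrow> 'a \<times> bool list) \<Rightarrow> bool list \<Rightarrow> bool list \<times> 'a list \<times> bool list \<Rightarrow> bool list \<times> 'a list \<times> bool list" where
  "decode_list_step p n s = (if fst s = n then s else
     (add_carry True (fst s), fst (p (snd (snd s))) # fst (snd s), snd (p (snd (snd s)))))"

definition decode_list_loop :: "(bool list \<Rightarrow> 'a \<times> bool list) \<Rightarrow> bool list \<Rightarrow> bool list \<times> 'a list \<times> bool list" where
  "decode_list_loop p w = fold (\<lambda>_ s. decode_list_step p (fst (decode_nat w)) s) w ([], [], snd (decode_nat w))"

definition decode_list :: "(bool list \<Rightarrow> 'a \<times> bool list) \<Rightarrow> bool list \<Rightarrow> 'a list \<times> bool list" where
  "decode_list p w = (rev (fst (snd (decode_list_loop p w))), snd (snd (decode_list_loop p w)))"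

lemma sz_decode_list_step:
  "sz (fst (decode_list_step p n s)) \<le> sz (fst s) + 4"
  "sz (fst (snd (decode_list_step p n s))) \<le> sz (fst (snd s)) + sz (fst (p (snd (snd s)))) + 1"
  using sz_add_carry[of True "fst s"] by (simp_all add: decode_list_step_def)

text \<open>The unread rest never grows, so each call of \<open>p\<close> sees a word no larger than
  the input and yields an element of bounded size; this gives the additive bound for the accumulated
  list.\<close>

lemma sz_decode_list_rest:
  assumes "\<And>w. sz (snd (p w)) \<le> sz w"
  shows "sz (snd (snd (fold (\<lambda>_ s. decode_list_step p n s) c s))) \<le> sz (snd (snd s))"
proof (induction c arbitrary: s)
  case (Cons y c)
  have "sz (snd (snd (decode_list_step p n s))) \<le> sz (snd (snd s))"
    using assms by (auto simp: decode_list_step_def)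
  with Cons[of "decode_list_step p n s"] show ?case by simp
qed simp

lemma sz_decode_list:
  assumes "\<And>w. sz (snd (p w)) \<le> sz w"
  shows "sz (snd (decode_list p w)) \<le> sz w"
  using sz_decode_list_rest[where p = p, OF assms, of "fst (decode_nat w)" w "([], [], snd (decode_nat w))"] sz_decode_nat[of w]
  by (simp add: decode_list_def decode_list_loop_def)

lemma polytime_decode_list:
  fixes p :: "bool list \<Rightarrow> 'a::dat \<times> bool list"
  assumes p: "polytime p" and rest: "\<And>w. sz (snd (p w)) \<le> sz w" and "polytime f"
  shows "polytime (\<lambda>x. decode_list p (f x))"
proof -
  obtain q where q: "polyfun q" "\<And>w. sz (p w) \<le> q (sz w)" using polytime_size[OF p] by blast
  have "polytime (decode_list_loop p)"
    unfolding decode_list_loop_def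
  proof (rule polytime_fold)
    show "polyfun (\<lambda>n. 2 + (4 * n + 1) + (n * (q n + 1) + 1) + n)" by (intro polyfun_intros q)
    show "sz (fold (\<lambda>_ s. decode_list_step p (fst (decode_nat w)) s) (take i w) ([], [], snd (decode_nat w)))
      \<le> 2 + (4 * sz w + 1) + (sz w * (q (sz w) + 1) + 1) + sz w" if "i \<le> length w" for w i
    proof -
      let ?s = "\<lambda>c. fold (\<lambda>_ s. decode_list_step p (fst (decode_nat w)) s) c ([], [], snd (decode_nat w))"
      have r: "sz (snd (snd (?s c))) \<le> sz w" for c :: "bool list"
        using sz_decode_list_rest[where p = p, OF rest, of "fst (decode_nat w)" c "([], [], snd (decode_nat w))"] sz_decode_nat[of w]
        by simp
      have "sz (fst (?s c)) \<le> 4 * length c + 1 \<and> sz (fst (snd (?s c))) \<le> length c * (q (sz w) + 1) + 1"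
        for c :: "bool list"
      proof (induction c rule: rev_induct)
        case (snoc b c)
        have "sz (p (snd (snd (?s c)))) \<le> q (sz w)"
          using le_trans[OF q(2) polyfun_mono[OF q(1) r]] .
        then have "sz (fst (p (snd (snd (?s c))))) \<le> q (sz w)"
          using sz_prod[of "p (snd (snd (?s c)))"] by linarith
        then show ?case using snoc sz_decode_list_step[of p "fst (decode_nat w)" "?s c"] by simp
      qed simp
      from this[of "take i w"]
      have a: "sz (fst (?s (take i w))) \<le> 4 * i + 1" "sz (fst (snd (?s (take i w)))) \<le> i * (q (sz w) + 1) + 1"
        using that by (simp_all add: min_absorb2)
      have i: "i \<le> sz w" using that length_le_sz[of w] by simp
      then have "i * (q (sz w) + 1) \<le> sz w * (q (sz w) + 1)" by (rule mult_le_mono1)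
      then show ?thesis
        using a i r[of "take i w"] sz_prod[of "?s (take i w)"] sz_prod[of "snd (?s (take i w))"]
        by linarith
    qed
  qed (unfold decode_list_step_def, (intro polytime_intros polytime_eq_bits polytime_add_carry polytime_decode_nat polytime_comp[OF p])+)
  then have "polytime (decode_list p)"
    unfolding decode_list_def[abs_def] by (intro polytime_intros)
  from polytime_comp[OF this assms(3)] show ?thesis .
qed

text \<open>Nonempty element codes ensure that the word is at least as long as the number of
  elements, so the clock does not stop too early.\<close>

lemma decode_list_enc:
  assumes p: "\<And>x w. x \<in> set xs \<Longrightarrow> p (e x @ w) = (r x, w)" and e: "\<And>x. x \<in> set xs \<Longrightarrow> e x \<noteq> []"
  shows "decode_list p (enc_list e xs @ w) = (map r xs, w)"
proof -
  have step: "fold (\<lambda>_ s. decode_list_step p (bin (length xs)) s) c (bin i, rev (map r (take i xs)), concat (map e (drop i xs)) @ w)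
      = (bin (length xs), rev (map r xs), w)"
    if "i \<le> length xs" "length xs - i \<le> length c" for c :: "bool list" and i
    using that
  proof (induction c arbitrary: i)
    case (Cons b c)
    show ?case
    proof (cases "i = length xs")
      case True
      then show ?thesis using Cons.IH[of i] by (simp add: decode_list_step_def)
    next
      case False
      then have i: "i < length xs" using Cons.prems by simp
      have "drop i xs = xs ! i # drop (Suc i) xs" "take (Suc i) xs = take i xs @ [xs ! i]"
        using i by (simp_all add: Cons_nth_drop_Suc take_Suc_conv_app_nth)
      then have "decode_list_step p (bin (length xs)) (bin i, rev (map r (take i xs)), concat (map e (drop i xs)) @ w)
        = (bin (Suc i), rev (map r (take (Suc i) xs)), concat (map e (drop (Suc i) xs)) @ w)"
        using i p[of "xs ! i"] by (simp add: decode_list_step_def bin_inject add_carry_bin)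
      then show ?thesis using Cons.IH[of "Suc i"] Cons.prems i by simp
    qed
  qed simp
  have "length xs \<le> length (concat (map e xs))"
    using e
  proof (induction xs)
    case (Cons x xs)
    then have "e x \<noteq> []" "length xs \<le> length (concat (map e xs))" by auto
    then show ?case by (cases "e x") auto
  qed simp
  then have "length xs \<le> length (enc_list e xs @ w)" by (simp add: enc_list_def)
  then have "decode_list_loop p (enc_list e xs @ w) = (bin (length xs), rev (map r xs), w)"
    using step[of 0 "enc_list e xs @ w"] by (simp add: decode_list_loop_def enc_list_def decode_nat_enc)
  then show ?thesis by (simp add: decode_list_def rev_map)
qed

type_synonym raw = "bool \<times> bool list"

text \<open>Inside the stack programs an integer stays a sign with binary digits. Only equality and
  order of values are ever used, and both can be decided on this form.\<close>

definition raw :: "int \<Rightarrow> raw" where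
  "raw i = (i < 0, bin (nat \<bar>i\<bar>))"

lemma raw_inject: "raw i = raw j \<longleftrightarrow> i = j"
  by (auto simp: raw_def bin_inject)

definition decode_int :: "bool list \<Rightarrow> raw \<times> bool list" where
  "decode_int w = (case w of [] \<Rightarrow> ((False, []), []) | s # r \<Rightarrow> ((s, fst (decode_nat r)), snd (decode_nat r)))"

lemma decode_int_enc: "decode_int (enc_int i @ w) = (raw i, w)"
  by (simp add: decode_int_def enc_int_def decode_nat_enc raw_def)

lemma polytime_decode_int: "polytime decode_int"
  unfolding decode_int_def[abs_def] by (intro polytime_intros polytime_decode_nat)

lemma sz_decode_int: "sz (snd (decode_int w)) \<le> sz w"
proof (cases w)
  case (Cons b r)
  then show ?thesis using sz_decode_nat[of r] by (simp add: decode_int_def)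
qed (simp add: decode_int_def)

definition decode_examples :: "bool list \<Rightarrow> raw list list \<times> bool list" where
  "decode_examples = decode_list (decode_list decode_int)"

lemma enc_list_nonempty: "enc_list e xs \<noteq> []"
  by (simp add: enc_list_def enc_nat_def)

lemma decode_examples_enc: "decode_examples (enc_list (enc_list enc_int) es @ w) = (map (map raw) es, w)"
  unfolding decode_examples_def
  by (intro decode_list_enc enc_list_nonempty decode_int_enc) (simp add: enc_int_def)

lemma polytime_decode_examples: "polytime f \<Longrightarrow> polytime (\<lambda>x. decode_examples (f x))"
  unfolding decode_examples_def
  by (rule polytime_decode_list[OF polytime_decode_list[OF polytime_decode_int sz_decode_int polytime_id] sz_decode_list[OF sz_decode_int]])

subsection \<open>The kernelization on encodings\<close>

definition raw_less :: "raw \<Rightarrow> raw \<Rightarrow> bool" where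
  "raw_less a b = (if fst a then (if fst b then bin_less (snd b) (snd a) else True)
     else (if fst b then False else bin_less (snd a) (snd b)))"

lemma raw_less: "raw_less (raw i) (raw j) \<longleftrightarrow> i < j"
  by (auto simp: raw_less_def raw_def bin_less)

lemma polytime_raw_less: "polytime f \<Longrightarrow> polytime g \<Longrightarrow> polytime (\<lambda>x. raw_less (f x) (g x))"
  unfolding raw_less_def by (intro polytime_If polytime_fst polytime_snd polytime_const polytime_bin_less)

lemma polytime_eq_raw: "polytime f \<Longrightarrow> polytime g \<Longrightarrow> polytime (\<lambda>x. f x = (g x :: raw))"
  by (rule polytime_eq_prod[OF polytime_eq_bool polytime_eq_bits]) (intro polytime_intros)+

lemma polytime_eq_raws: "polytime f \<Longrightarrow> polytime g \<Longrightarrow> polytime (\<lambda>x. f x = (g x :: raw list))"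
  by (rule polytime_eq_list[OF polytime_eq_raw]) (intro polytime_intros)+

section \<open>Writing the output encoding\<close>

definition enc_bits :: "bool list \<Rightarrow> bool list" where
  "enc_bits bs = concat (map (\<lambda>b. [b, b]) bs) @ [False, True]"

lemma enc_bits_bin: "enc_bits (bin n) = enc_nat n"
  by (simp add: enc_bits_def enc_nat_def)

lemma polytime_enc_bits: "polytime f \<Longrightarrow> polytime (\<lambda>x. enc_bits (f x))"
  unfolding enc_bits_def by (intro polytime_append polytime_concat polytime_map polytime_Cons polytime_snd polytime_id polytime_const)

text \<open>A value \<open>v\<close> is replaced by \<open>2 ^ r\<close> where \<open>r\<close> counts the entries smaller than \<open>v\<close>:
  powers of two have an encoding that can be written down without binary arithmetic.\<close>

definition enc_val :: "raw list \<Rightarrow> raw \<Rightarrow> bool list" where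
  "enc_val A v = False # concat (map (\<lambda>_. [False, False]) (filter (\<lambda>u. raw_less u v) A)) @ [True, True, False, True]"

definition rank_power :: "int list \<Rightarrow> int \<Rightarrow> int" where
  "rank_power A v = 2 ^ length (filter (\<lambda>u. u < v) A)"

text \<open>\<open>bin (2 ^ r)\<close> is \<open>r\<close> zeros followed by a one. Doubling gives
  \<open>[False, False]\<close> for each smaller entry, then \<open>[True, True]\<close> for the one
  and \<open>[False, True]\<close> as terminator; the leading \<open>False\<close> is the
  sign.\<close>

lemma enc_val: "enc_val (map raw A) (raw v) = enc_int (rank_power A v)"
proof -
  have "length (filter (\<lambda>u. raw_less u (raw v)) (map raw A)) = length (filter (\<lambda>u. u < v) A)"
    by (simp add: filter_map comp_def raw_less)
  moreover have "concat (map (\<lambda>_. [False, False]) xs) = concat (map (\<lambda>b. [b, b]) (replicate (length xs) False))" for xs :: "raw list"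
    by (induction xs) auto
  ultimately show ?thesis
    by (simp add: enc_val_def enc_int_def rank_power_def enc_nat_def nat_power_eq bin_power not_less)
qed

lemma polytime_enc_val: "polytime f \<Longrightarrow> polytime g \<Longrightarrow> polytime (\<lambda>x. enc_val (f x) (g x))"
proof (rule polytime_uncurry[of enc_val])
  show "polytime (\<lambda>z. enc_val (fst z) (snd z))"
    unfolding enc_val_def by (intro polytime_Cons polytime_append polytime_concat polytime_map polytime_filter polytime_raw_less polytime_fst polytime_snd polytime_id polytime_const)
qed

definition enc_ex :: "raw list \<Rightarrow> raw list \<Rightarrow> bool list" where
  "enc_ex A e = enc_bits (bin_length e) @ concat (map (\<lambda>v. enc_val A v) e)"

lemma enc_ex: "enc_ex (map raw A) (map raw e) = enc_list enc_int (map (rank_power A) e)"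
  by (simp add: enc_ex_def enc_list_def bin_length enc_bits_bin enc_val comp_def)

lemma polytime_enc_ex: "polytime f \<Longrightarrow> polytime g \<Longrightarrow> polytime (\<lambda>x. enc_ex (f x) (g x))"
proof (rule polytime_uncurry[of enc_ex])
  show "polytime (\<lambda>z. enc_ex (fst z) (snd z))"
    unfolding enc_ex_def by (intro polytime_append polytime_concat polytime_map polytime_enc_bits polytime_bin_length polytime_enc_val polytime_fst polytime_snd polytime_id)
qed

definition enc_exs :: "raw list \<Rightarrow> raw list list \<Rightarrow> bool list" where
  "enc_exs A es = enc_bits (bin_length es) @ concat (map (\<lambda>e. enc_ex A e) es)"

lemma enc_exs: "enc_exs (map raw A) (map (map raw) es) = enc_list (enc_list enc_int) (map (map (rank_power A)) es)"
  by (simp add: enc_exs_def enc_list_def[of "enc_list enc_int"] bin_length enc_bits_bin enc_ex comp_def)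

lemma polytime_enc_exs: "polytime f \<Longrightarrow> polytime g \<Longrightarrow> polytime (\<lambda>x. enc_exs (f x) (g x))"
proof (rule polytime_uncurry[of enc_exs])
  show "polytime (\<lambda>z. enc_exs (fst z) (snd z))"
    unfolding enc_exs_def by (intro polytime_append polytime_concat polytime_map polytime_enc_bits polytime_bin_length polytime_enc_ex polytime_fst polytime_snd polytime_id)
qed

text \<open>The list \<open>l\<close> acts as a unary number: one digit of \<open>s\<close> is
  removed per entry, and if digits remain, \<open>s\<close> is replaced by the digits of a power of
  two.\<close>

definition cap_bits :: "bool list \<Rightarrow> bool list \<Rightarrow> bool list" where
  "cap_bits l s = (if fold (\<lambda>_ s. tl s) l s = [] then s else map (\<lambda>_. False) l @ [True])"

definition cap :: "nat \<Rightarrow> nat \<Rightarrow> nat" where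
  "cap l s = (if length (bin s) \<le> l then s else 2 ^ l)"

lemma cap_bits: "cap_bits l (bin s) = bin (cap (length l) s)"
proof -
  have "fold (\<lambda>_ s. tl s) l s = drop (length l) s" for s :: "bool list"
    by (induction l arbitrary: s) (auto simp: drop_Suc)
  then show ?thesis by (simp add: cap_bits_def cap_def bin_power map_replicate_const)
qed

lemma polytime_cap_bits:
  assumes "polytime f" "polytime g"
  shows "polytime (\<lambda>x. cap_bits (f x) (g x))"
proof -
  have "polytime (\<lambda>x. fold (\<lambda>_ s. tl s) (f x) (g x))"
  proof (rule polytime_fold_additive)
    show "sz (tl a) \<le> sz a + 0" for a :: "bool list" by (cases a) auto
  qed (intro polytime_intros polyfun_intros assms)+
  then show ?thesis
    unfolding cap_bits_def by (intro polytime_If polytime_null polytime_append polytime_map polytime_const assms)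
qed

section \<open>Assembling the kernelization\<close>

definition kernel_pos :: "bool list \<Rightarrow> raw list list \<times> bool list" where
  "kernel_pos w = decode_examples (snd (decode_nat w))"

definition kernel_neg :: "bool list \<Rightarrow> raw list list \<times> bool list" where
  "kernel_neg w = decode_examples (snd (kernel_pos w))"

definition dedup :: "'a list \<Rightarrow> 'a list" where
  "dedup xs = fold List.insert xs []"

definition kernel_vals :: "bool list \<Rightarrow> raw list" where
  "kernel_vals w = concat (dedup (fst (kernel_pos w)) @ dedup (fst (kernel_neg w)))"

definition kernel_enc_pos :: "bool list \<Rightarrow> bool list" where
  "kernel_enc_pos w = enc_exs (kernel_vals w) (dedup (fst (kernel_pos w)))"

definition kernel_enc_neg :: "bool list \<Rightarrow> bool list" where
  "kernel_enc_neg w = enc_exs (kernel_vals w) (dedup (fst (kernel_neg w)))"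

text \<open>A yes-instance for size and for depth: without examples a single leaf classifies, and it
  needs no budget.\<close>

definition trivial_inst :: "ci \<times> nat" where
  "trivial_inst = (\<lparr>nfeat = 0, pos = [], neg = []\<rparr>, 0)"

text \<open>The already written code of the positive examples is reused as the unary bound for the
  budget, so no product of \<open>F\<close> and the number of examples is computed.\<close>

definition kernel_enc :: "bool list \<Rightarrow> bool list" where
  "kernel_enc w = (if fst (kernel_pos w) = [] \<or> fst (kernel_neg w) = [] then enc_inst trivial_inst
     else enc_bits (fst (decode_nat w)) @ kernel_enc_pos w @ kernel_enc_neg w
       @ enc_bits (cap_bits (kernel_enc_pos w) (fst (decode_nat (snd (kernel_neg w))))))"

lemma polytime_kernel_enc: "polytime kernel_enc"
proof -
  have pos: "polytime kernel_pos"
    unfolding kernel_pos_def[abs_def] by (intro polytime_decode_examples polytime_snd polytime_decode_nat polytime_id)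
  have neg: "polytime kernel_neg"
    unfolding kernel_neg_def[abs_def] by (intro polytime_decode_examples polytime_snd pos)
  have dpos: "polytime (\<lambda>w. dedup (fst (kernel_pos w)))" and dneg: "polytime (\<lambda>w. dedup (fst (kernel_neg w)))"
    unfolding dedup_def by (intro polytime_dedup[OF polytime_eq_raws] polytime_fst polytime_snd polytime_id pos neg)+
  have vals: "polytime kernel_vals"
    unfolding kernel_vals_def[abs_def] by (intro polytime_concat polytime_append dpos dneg)
  have epos: "polytime kernel_enc_pos" and eneg: "polytime kernel_enc_neg"
    unfolding kernel_enc_pos_def[abs_def] kernel_enc_neg_def[abs_def]
    by (intro polytime_enc_exs vals dpos dneg)+
  show ?thesis
    unfolding kernel_enc_def[abs_def]
    by (intro polytime_If polytime_disj polytime_null polytime_append polytime_enc_bits polytime_cap_bits polytime_fst polytime_snd polytime_decode_nat polytime_id polytime_const pos neg epos eneg)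
qed

definition kernel_of :: "ci \<times> nat \<Rightarrow> ci \<times> nat" where
  "kernel_of x = (if pos (fst x) = [] \<or> neg (fst x) = [] then trivial_inst else
     let P = dedup (pos (fst x)); N = dedup (neg (fst x)); \<rho> = map (rank_power (concat (P @ N)))
     in (\<lparr>nfeat = nfeat (fst x), pos = map \<rho> P, neg = map \<rho> N\<rparr>,
         cap (length (enc_list (enc_list enc_int) (map \<rho> P))) (snd x)))"

text \<open>The program removes duplicates among decoded examples, \<open>kernel_of\<close> among
  lists of integers; injectivity of decoding makes the results correspond, including their
  order.\<close>

lemma dedup_map:
  assumes "inj f"
  shows "dedup (map f xs) = map f (dedup xs)"
proof -
  have "fold List.insert (map f xs) (map f ys) = map f (fold List.insert xs ys)" for ys
  proof (induction xs arbitrary: ys)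
    case (Cons x xs)
    have "List.insert (f x) (map f ys) = map f (List.insert x ys)"
      using assms by (auto simp: List.insert_def inj_image_mem_iff)
    then show ?case using Cons by simp
  qed simp
  from this[of "[]"] show ?thesis by (simp add: dedup_def)
qed

lemma kernel_enc: "kernel_enc (enc_inst x) = enc_inst (kernel_of x)"
proof -
  let ?w = "enc_inst x" and ?P = "pos (fst x)" and ?N = "neg (fst x)"
  have inj: "inj (map raw)" by (simp add: inj_def raw_inject)
  have kp: "kernel_pos ?w = (map (map raw) ?P, enc_list (enc_list enc_int) ?N @ enc_nat (snd x))"
    by (simp add: kernel_pos_def enc_inst_def decode_nat_enc decode_examples_enc)
  have kn: "kernel_neg ?w = (map (map raw) ?N, enc_nat (snd x))"
    by (simp add: kernel_neg_def kp decode_examples_enc)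
  have s: "decode_nat (enc_nat (snd x)) = (bin (snd x), [])" using decode_nat_enc[of "snd x" "[]"] by simp
  have n: "fst (decode_nat ?w) = bin (nfeat (fst x))" by (simp add: enc_inst_def decode_nat_enc)
  have vals: "kernel_vals ?w = map raw (concat (dedup ?P @ dedup ?N))"
    by (simp add: kernel_vals_def kp kn dedup_map[OF inj] map_concat)
  show ?thesis
    unfolding kernel_enc_def kernel_of_def kernel_enc_pos_def kernel_enc_neg_def vals
    by (simp add: kp kn n s dedup_map[OF inj] enc_exs enc_bits_bin cap_bits Let_def enc_inst_def[of "(_, _)"]
        del: concat_append map_append)
qed

section \<open>Correctness and size of the kernel\<close>

lemma set_fold_insert: "set (fold List.insert xs ys) = set xs \<union> set ys"
  by (induction xs arbitrary: ys) auto

lemma set_dedup: "set (dedup xs) = set xs"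
  by (simp add: dedup_def set_fold_insert)

lemma length_dedup: "length (dedup xs) = card (set xs)"
proof -
  have "distinct ys \<Longrightarrow> distinct (fold List.insert xs ys)" for ys
    by (induction xs arbitrary: ys) auto
  then have "distinct (dedup xs)" by (simp add: dedup_def)
  then show ?thesis using distinct_card[of "dedup xs"] by (simp add: set_dedup)
qed

text \<open>Entries below \<open>u\<close> are also below \<open>v\<close>, and \<open>u\<close>
  itself is counted for \<open>v\<close> only. Repetitions in \<open>A\<close> do no harm, so the
  pooled entries can be used as they are.\<close>

lemma rank_power_strict_mono:
  assumes "u < v" "u \<in> set A"
  shows "rank_power A u < rank_power A v"
proof -
  have le: "length (filter (\<lambda>a. a < u) B) \<le> length (filter (\<lambda>a. a < v) B)" for B
    using assms(1) by (induction B) auto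
  have "length (filter (\<lambda>a. a < u) A) < length (filter (\<lambda>a. a < v) A)"
    using assms(2)
  proof (induction A)
    case (Cons a A)
    then show ?case using le[of A] assms(1) by (cases "u = a") auto
  qed simp
  then show ?thesis by (simp add: rank_power_def)
qed

subsection \<open>Transferring decision trees along order embeddings\<close>

lemma threshold_transfer:
  fixes \<rho> :: "int \<Rightarrow> int"
  assumes "finite A" "\<And>u v. u \<in> A \<Longrightarrow> v \<in> A \<Longrightarrow> u < v \<Longrightarrow> \<rho> u < \<rho> v"
  shows "\<exists>t'. \<forall>v\<in>A. v \<le> t \<longleftrightarrow> \<rho> v \<le> t'"
proof (cases "{v \<in> A. v \<le> t} = {}")
  case True
  \<comment> \<open>No value passes the test, so any threshold below all images works. For empty
    \<open>A\<close> the minimum is unspecified but the claim is vacuous.\<close>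
  have "\<rho> v > Min (\<rho> ` A) - 1" if "v \<in> A" for v
  proof -
    have "Min (\<rho> ` A) \<le> \<rho> v" using assms(1) that by (intro Min_le) auto
    then show ?thesis by simp
  qed
  then have "\<forall>v\<in>A. v \<le> t \<longleftrightarrow> \<rho> v \<le> Min (\<rho> ` A) - 1" using True by fastforce
  then show ?thesis by blast
next
  case False
  define m where "m = Max {v \<in> A. v \<le> t}"
  have fin: "finite {v \<in> A. v \<le> t}" using assms(1) by simp
  have m: "m \<in> A" "m \<le> t" using Max_in[OF fin False] by (simp_all add: m_def)
  have "v \<le> t \<longleftrightarrow> \<rho> v \<le> \<rho> m" if v: "v \<in> A" for v
  proof
    assume "v \<le> t"
    then have "v \<le> m" using fin v by (simp add: m_def)
    then show "\<rho> v \<le> \<rho> m" using assms(2)[OF v m(1)] by (cases "v = m") auto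
  next
    assume "\<rho> v \<le> \<rho> m"
    then have "\<not> m < v" using assms(2)[OF m(1) v] by auto
    then show "v \<le> t" using m(2) by simp
  qed
  then show ?thesis by blast
qed

lemma dt_transfer:
  fixes \<rho> :: "int \<Rightarrow> int"
  assumes "finite A" "\<And>u v. u \<in> A \<Longrightarrow> v \<in> A \<Longrightarrow> u < v \<Longrightarrow> \<rho> u < \<rho> v"
  shows "\<exists>T'. dt_size T' = dt_size T \<and> dt_depth T' = dt_depth T \<and> dt_feats T' = dt_feats T \<and>
    (\<forall>e. set e \<subseteq> A \<and> (\<forall>f\<in>dt_feats T. f < length e) \<longrightarrow> dt_eval T' (map \<rho> e) = dt_eval T e)"
proof (induction T)
  case (Leaf b)
  show ?case by (rule exI[of _ "Leaf b"]) simp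
next
  case (Node f t l r)
  from Node.IH obtain l' r' where
    l: "dt_size l' = dt_size l" "dt_depth l' = dt_depth l" "dt_feats l' = dt_feats l"
      "\<And>e. set e \<subseteq> A \<Longrightarrow> (\<forall>f\<in>dt_feats l. f < length e) \<Longrightarrow> dt_eval l' (map \<rho> e) = dt_eval l e"
    and r: "dt_size r' = dt_size r" "dt_depth r' = dt_depth r" "dt_feats r' = dt_feats r"
      "\<And>e. set e \<subseteq> A \<Longrightarrow> (\<forall>f\<in>dt_feats r. f < length e) \<Longrightarrow> dt_eval r' (map \<rho> e) = dt_eval r e"
    by blast
  obtain t' where t': "\<And>v. v \<in> A \<Longrightarrow> v \<le> t \<longleftrightarrow> \<rho> v \<le> t'"
    using threshold_transfer[of A \<rho>, OF assms] by blast
  have "dt_eval (Node f t' l' r') (map \<rho> e) = dt_eval (Node f t l r) e"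
    if "set e \<subseteq> A" "\<forall>f\<in>dt_feats (Node f t l r). f < length e" for e
  proof -
    have f: "f < length e" "e ! f \<in> A" using that nth_mem[of f e] by auto
    show ?thesis using that f t'[OF f(2)] l(4)[of e] r(4)[of e] by simp
  qed
  then show ?case using l r by (intro exI[of _ "Node f t' l' r'"]) simp
qed

definition entries :: "ci \<Rightarrow> int set" where
  "entries I = \<Union>(set ` examples I)"

lemma finite_entries: "finite (entries I)"
  by (simp add: entries_def examples_def)

lemma classifies_transfer:
  fixes \<rho> :: "int \<Rightarrow> int"
  assumes wf: "wf_ci I" and mono: "\<And>u v. u \<in> entries I \<Longrightarrow> v \<in> entries I \<Longrightarrow> u < v \<Longrightarrow> \<rho> u < \<rho> v"
    and J: "nfeat J = nfeat I" "set (pos J) = map \<rho> ` set (pos I)" "set (neg J) = map \<rho> ` set (neg I)"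
    and T: "classifies T I"
  shows "\<exists>T'. classifies T' J \<and> dt_size T' = dt_size T \<and> dt_depth T' = dt_depth T"
proof -
  obtain T' where T': "dt_size T' = dt_size T" "dt_depth T' = dt_depth T" "dt_feats T' = dt_feats T"
    "\<And>e. set e \<subseteq> entries I \<Longrightarrow> (\<forall>f\<in>dt_feats T. f < length e) \<Longrightarrow> dt_eval T' (map \<rho> e) = dt_eval T e"
    using dt_transfer[where A = "entries I" and \<rho> = \<rho> and T = T, OF finite_entries mono] by blast
  have "dt_eval T' (map \<rho> e) = dt_eval T e" if "e \<in> examples I" for e
    by (rule T'(4)) (use that wf T in \<open>auto simp: entries_def wf_ci_def classifies_def\<close>)
  then have "classifies T' J"
    using T J T'(3) by (auto simp: classifies_def examples_def)
  then show ?thesis using T' by blast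
qed

lemma map_inj_on_entries:
  assumes "inj_on \<rho> (entries I)" "e \<in> examples I" "e' \<in> examples I" "map \<rho> e = map \<rho> e'"
  shows "e = e'"
  using assms by (intro map_inj_on[of \<rho>]) (auto simp: entries_def intro: inj_on_subset)

lemma wf_transfer:
  assumes wf: "wf_ci I" and inj: "inj_on \<rho> (entries I)"
    and J: "nfeat J = nfeat I" "set (pos J) = map \<rho> ` set (pos I)" "set (neg J) = map \<rho> ` set (neg I)"
  shows "wf_ci J"
proof -
  have "z \<notin> set (neg J)" if "z \<in> set (pos J)" for z
  proof
    assume "z \<in> set (neg J)"
    then obtain p q where pq: "p \<in> set (pos I)" "q \<in> set (neg I)" "z = map \<rho> p" "z = map \<rho> q"
      using \<open>z \<in> set (pos J)\<close> unfolding J by (elim imageE) blast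
    have "p = q"
      by (rule map_inj_on_entries[OF inj]) (use pq in \<open>simp_all add: examples_def\<close>)
    then show False using pq wf by (auto simp: wf_ci_def)
  qed
  then have "set (pos J) \<inter> set (neg J) = {}" by blast
  then show ?thesis using wf J by (auto simp: wf_ci_def examples_def)
qed

text \<open>The inverse of \<open>\<rho>\<close> on the entries is again an order embedding and maps
  \<open>J\<close> back to \<open>I\<close>, so one direction gives both. Size and depth are fixed
  individually so that any measure determined by them can be transferred.\<close>

lemma classifies_transfer_iff:
  fixes \<rho> :: "int \<Rightarrow> int"
  assumes wf: "wf_ci I" and mono: "\<And>u v. u \<in> entries I \<Longrightarrow> v \<in> entries I \<Longrightarrow> u < v \<Longrightarrow> \<rho> u < \<rho> v"
    and J: "nfeat J = nfeat I" "set (pos J) = map \<rho> ` set (pos I)" "set (neg J) = map \<rho> ` set (neg I)"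
  shows "(\<exists>T. classifies T J \<and> dt_size T = m \<and> dt_depth T = d) \<longleftrightarrow> (\<exists>T. classifies T I \<and> dt_size T = m \<and> dt_depth T = d)"
proof -
  let ?\<sigma> = "inv_into (entries I) \<rho>"
  have inj: "inj_on \<rho> (entries I)"
    using mono by (metis (no_types, lifting) inj_onI less_irrefl linorder_less_linear)
  have valJ: "entries J = \<rho> ` entries I"
    using J by (auto simp: entries_def examples_def)
  have inv: "?\<sigma> (\<rho> v) = v" if "v \<in> entries I" for v using inj that by simp
  have mono': "?\<sigma> u < ?\<sigma> v" if uv: "u \<in> entries J" "v \<in> entries J" "u < v" for u v
  proof -
    obtain a b where ab: "a \<in> entries I" "b \<in> entries I" "u = \<rho> a" "v = \<rho> b" using uv(1,2) unfolding valJ by (elim imageE) blast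
    then have "a < b" using mono[of b a] uv(3) by (metis less_asym linorder_less_linear order_less_irrefl)
    then show ?thesis using ab inv by simp
  qed
  have retract: "map ?\<sigma> (map \<rho> e) = e" if "e \<in> examples I" for e
  proof -
    have "?\<sigma> (\<rho> v) = v" if "v \<in> set e" for v
      using inv[of v] that \<open>e \<in> examples I\<close> by (auto simp: entries_def)
    then show ?thesis by (simp add: map_idI)
  qed
  have "map ?\<sigma> ` map \<rho> ` S = S" if "S \<subseteq> examples I" for S
  proof -
    have "(\<lambda>e. map ?\<sigma> (map \<rho> e)) ` S = (\<lambda>e. e) ` S"
      using retract that by (intro image_cong) auto
    then show ?thesis by (simp add: image_image)
  qed
  then have I: "set (pos I) = map ?\<sigma> ` set (pos J)" "set (neg I) = map ?\<sigma> ` set (neg J)"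
    unfolding J by (simp_all only: examples_def Un_upper1 Un_upper2)
  have wfJ: "wf_ci J" by (rule wf_transfer[OF wf inj J])
  show ?thesis
  proof
    assume "\<exists>T. classifies T J \<and> dt_size T = m \<and> dt_depth T = d"
    then obtain T where T: "classifies T J" "dt_size T = m" "dt_depth T = d" by blast
    from classifies_transfer[of J ?\<sigma> I, OF wfJ mono' J(1)[symmetric] I T(1)] T(2,3)
    show "\<exists>T. classifies T I \<and> dt_size T = m \<and> dt_depth T = d" by auto
  next
    assume "\<exists>T. classifies T I \<and> dt_size T = m \<and> dt_depth T = d"
    then obtain T where T: "classifies T I" "dt_size T = m" "dt_depth T = d" by blast
    from classifies_transfer[of I \<rho> J, OF wf mono J T(1)] T(2,3)
    show "\<exists>T. classifies T J \<and> dt_size T = m \<and> dt_depth T = d" by auto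
  qed
qed

lemma delta_max_le_iff:
  "delta_max I \<le> c \<longleftrightarrow> (\<forall>p\<in>set (pos I). \<forall>q\<in>set (neg I). card (diff_feats I p q) \<le> c)"
proof -
  have "{card (diff_feats I p q) | p q. p \<in> set (pos I) \<and> q \<in> set (neg I)}
      = (\<lambda>(p, q). card (diff_feats I p q)) ` (set (pos I) \<times> set (neg I))" by auto
  then have "finite {card (diff_feats I p q) | p q. p \<in> set (pos I) \<and> q \<in> set (neg I)}" by simp
  then show ?thesis unfolding delta_max_def by (subst Max_le_iff) auto
qed

text \<open>Injectivity on the pooled entries preserves the very set of differing features, not
  merely its cardinality.\<close>

lemma delta_max_transfer:
  assumes wf: "wf_ci I" and inj: "inj_on \<rho> (entries I)"
    and J: "nfeat J = nfeat I" "set (pos J) = map \<rho> ` set (pos I)" "set (neg J) = map \<rho> ` set (neg I)"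
    and "delta_max I \<le> c"
  shows "delta_max J \<le> c"
  unfolding delta_max_le_iff
proof (intro ballI)
  fix p' q' assume "p' \<in> set (pos J)" "q' \<in> set (neg J)"
  then obtain p q where pq: "p \<in> set (pos I)" "q \<in> set (neg I)" "p' = map \<rho> p" "q' = map \<rho> q"
    using J by auto
  have len: "length p = nfeat I" "length q = nfeat I"
    using wf pq by (auto simp: wf_ci_def examples_def)
  have "\<rho> (p ! f) = \<rho> (q ! f) \<longleftrightarrow> p ! f = q ! f" if "f < nfeat I" for f
  proof -
    have "p ! f \<in> set p" "q ! f \<in> set q" using that len by simp_all
    then have "p ! f \<in> entries I" "q ! f \<in> entries I"
      using pq by (auto simp: entries_def examples_def)
    then show ?thesis using inj by (auto dest: inj_onD)
  qed
  then have "diff_feats J p' q' = diff_feats I p q"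
    using pq len J by (auto simp: diff_feats_def)
  then show "card (diff_feats J p' q') \<le> c"
    using assms(6) pq by (simp add: delta_max_le_iff)
qed

subsection \<open>Consistent instances have decision trees\<close>

text \<open>Over the integers, equality with \<open>e ! f\<close> is tested by the two thresholds
  \<open>e ! f\<close> and \<open>e ! f - 1\<close>. The tree \<open>no\<close> is copied at every
  failing test, so depth is additive while size is not; size is bounded through depth later.\<close>

fun match_dt :: "int list \<Rightarrow> nat list \<Rightarrow> dt \<Rightarrow> dt" where
  "match_dt e [] no = Leaf True"
| "match_dt e (f # fs) no = Node f (e ! f) (Node f (e ! f - 1) no (match_dt e fs no)) no"

lemma match_dt:
  "dt_eval (match_dt e fs no) x \<longleftrightarrow> (\<forall>f\<in>set fs. x ! f = e ! f) \<or> dt_eval no x"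
  "dt_depth (match_dt e fs no) \<le> 2 * length fs + dt_depth no"
  "dt_feats (match_dt e fs no) \<subseteq> set fs \<union> dt_feats no"
  by (induction fs) auto

text \<open>The matching trees of the positive examples are chained, each failing into the next. Any
  list \<open>ps\<close> with the right set is allowed, so the bound can be stated with the
  deduplicated list even for the original instance.\<close>

lemma ex_classifying_dt:
  assumes wf: "wf_ci I" and ps: "set ps = set (pos I)"
  shows "\<exists>T. classifies T I \<and> dt_depth T \<le> 2 * nfeat I * length ps"
proof -
  let ?F = "nfeat I"
  have "\<exists>T. (\<forall>x. length x = ?F \<longrightarrow> dt_eval T x = (x \<in> set es)) \<and> dt_depth T \<le> 2 * ?F * length es \<and> dt_feats T \<subseteq> {..<?F}"
    if "\<forall>e\<in>set es. length e = ?F" for es :: "int list list"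
    using that
  proof (induction es)
    case Nil
    show ?case by (rule exI[of _ "Leaf False"]) simp
  next
    case (Cons e es)
    then obtain T where T: "\<forall>x. length x = ?F \<longrightarrow> dt_eval T x = (x \<in> set es)"
      "dt_depth T \<le> 2 * ?F * length es" "dt_feats T \<subseteq> {..<?F}" by auto
    let ?T = "match_dt e [0..<?F] T"
    have "dt_eval ?T x = (x \<in> set (e # es))" if "length x = ?F" for x
    proof -
      have "(\<forall>f\<in>set [0..<?F]. x ! f = e ! f) \<longleftrightarrow> x = e"
      proof
        assume eq: "\<forall>f\<in>set [0..<?F]. x ! f = e ! f"
        show "x = e"
          by (rule nth_equalityI) (use eq that Cons.prems in simp_all)
      qed simp
      then show ?thesis using T(1) that by (simp add: match_dt(1))
    qed
    moreover have "dt_depth ?T \<le> 2 * ?F * length (e # es)"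
      using match_dt(2)[of e "[0..<?F]" T] T(2) by simp
    moreover have "dt_feats ?T \<subseteq> {..<?F}"
      using match_dt(3)[of e "[0..<?F]" T] T(3) by auto
    ultimately show ?case by blast
  qed
  from this[of ps] obtain T where T: "\<And>x. length x = ?F \<Longrightarrow> dt_eval T x = (x \<in> set ps)"
      "dt_depth T \<le> 2 * ?F * length ps" "dt_feats T \<subseteq> {..<?F}"
    using wf ps by (auto simp: wf_ci_def examples_def)
  have "classifies T I"
    using T(1,3) wf ps by (auto simp: classifies_def wf_ci_def examples_def)
  then show ?thesis using T(2) by blast
qed

lemma dt_size_less: "dt_size T < 2 ^ dt_depth T"
proof (induction T)
  case (Node f t l r)
  have "(2::nat) ^ dt_depth l \<le> 2 ^ max (dt_depth l) (dt_depth r)" "(2::nat) ^ dt_depth r \<le> 2 ^ max (dt_depth l) (dt_depth r)"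
    by (simp_all only: power_increasing max.cobounded1 max.cobounded2 one_le_numeral)
  then show ?case using Node unfolding dt_size.simps dt_depth.simps power_add power_one_right by linarith
qed simp

subsection \<open>Counting examples\<close>

definition feat_values :: "ci \<Rightarrow> nat \<Rightarrow> int set" where
  "feat_values I f = {e ! f | e. e \<in> examples I}"

lemma finite_feat_values: "finite (feat_values I f)"
  by (simp add: feat_values_def examples_def setcompr_eq_image)

lemma card_feat_values: "f < nfeat I \<Longrightarrow> card (feat_values I f) \<le> D_max I"
proof -
  assume f: "f < nfeat I"
  have "{card {e ! f | e. e \<in> examples I} | f. f < nfeat I} = (\<lambda>f. card {e ! f | e. e \<in> examples I}) ` {..<nfeat I}"
    by auto
  then have "finite {card {e ! f | e. e \<in> examples I} | f. f < nfeat I}" by simp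
  then show ?thesis unfolding D_max_def feat_values_def using f by (intro Max_ge) auto
qed

text \<open>Induction on the radius: a word at positive distance arises from one at distance smaller
  by one by changing a single coordinate, and there are at most \<open>F * D\<close> pairs of a
  coordinate and a value. This gives one factor \<open>1 + F * D\<close> per unit of radius.\<close>

lemma card_hamming_ball:
  fixes V :: "nat \<Rightarrow> 'a set"
  assumes fin: "\<And>f. f < F \<Longrightarrow> finite (V f)" and card: "\<And>f. f < F \<Longrightarrow> card (V f) \<le> D"
    and q: "length q = F" "\<And>f. f < F \<Longrightarrow> q ! f \<in> V f"
  defines "B \<equiv> \<lambda>k. {e. length e = F \<and> (\<forall>f<F. e ! f \<in> V f) \<and> card {f. f < F \<and> e ! f \<noteq> q ! f} \<le> k}"
  shows "finite (B k) \<and> card (B k) \<le> (1 + F * D) ^ k"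
proof (induction k)
  case 0
  have "e = q" if "e \<in> B 0" for e
    using that q by (auto simp: B_def list_eq_iff_nth_eq)
  then have "B 0 \<subseteq> {q}" by blast
  then show ?case using finite_subset[of "B 0" "{q}"] card_mono[of "{q}" "B 0"] by simp
next
  case (Suc k)
  let ?U = "SIGMA f:{..<F}. V f" and ?h = "\<lambda>(e, f, v). e[f := v]"
  have finU: "finite ?U" using fin by auto
  have cardU: "card ?U \<le> F * D"
  proof -
    have "card ?U = (\<Sum>f<F. card (V f))" using fin by (subst card_SigmaI) auto
    also have "\<dots> \<le> (\<Sum>f<F. D)" by (rule sum_mono) (use card in auto)
    finally show ?thesis by simp
  qed
  have sub: "B (Suc k) \<subseteq> B k \<union> ?h ` (B k \<times> ?U)"
  proof
    fix e assume e: "e \<in> B (Suc k)"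
    show "e \<in> B k \<union> ?h ` (B k \<times> ?U)"
    proof (cases "{f. f < F \<and> e ! f \<noteq> q ! f} = {}")
      case True
      then have "card {f. f < F \<and> e ! f \<noteq> q ! f} = 0" by (simp only: card.empty)
      then have "e \<in> B k" using e unfolding B_def mem_Collect_eq by (metis le0)
      then show ?thesis by blast
    next
      case False
      then obtain f where f: "f < F" "e ! f \<noteq> q ! f" by blast
      \<comment> \<open>Resetting a differing coordinate to that of \<open>q\<close> lowers the
        distance by one, and \<open>?h\<close> undoes the reset.\<close>
      let ?e = "e[f := q ! f]"
      have len: "length e = F" using e by (simp add: B_def)
      have "{g. g < F \<and> ?e ! g \<noteq> q ! g} = {g. g < F \<and> e ! g \<noteq> q ! g} - {f}"
        using len f by (auto simp: nth_list_update split: if_splits)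
      then have "card {g. g < F \<and> ?e ! g \<noteq> q ! g} = card {g. g < F \<and> e ! g \<noteq> q ! g} - 1"
        using f by simp
      then have "?e \<in> B k"
        using e len f q by (auto simp: B_def nth_list_update)
      moreover have "(f, e ! f) \<in> ?U" using e f by (simp add: B_def)
      moreover have "e = ?h (?e, f, e ! f)" by simp
      ultimately show ?thesis by blast
    qed
  qed
  have fin': "finite (B k \<union> ?h ` (B k \<times> ?U))" using Suc finU by simp
  have fS: "finite (B (Suc k))" by (rule finite_subset[OF sub fin'])
  have "card (B (Suc k)) \<le> card (B k \<union> ?h ` (B k \<times> ?U))" by (rule card_mono[OF fin' sub])
  also have "\<dots> \<le> card (B k) + card (B k) * card ?U"
    using card_Un_le[of "B k" "?h ` (B k \<times> ?U)"] card_image_le[of "B k \<times> ?U" ?h] Suc finU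
    by (simp add: card_cartesian_product)
  also have "\<dots> \<le> card (B k) * (1 + F * D)" using cardU by (simp add: algebra_simps)
  also have "\<dots> \<le> (1 + F * D) ^ k * (1 + F * D)" using Suc by (intro mult_le_mono1) simp
  finally show ?case using fS by (simp add: mult.commute)
qed

lemma card_near_examples:
  assumes wf: "wf_ci I" and q: "q \<in> examples I" and S: "S \<subseteq> examples I"
    and near: "\<And>p. p \<in> S \<Longrightarrow> card {f. f < nfeat I \<and> p ! f \<noteq> q ! f} \<le> c"
  shows "card S \<le> (1 + nfeat I * D_max I) ^ c"
proof -
  let ?B = "{e. length e = nfeat I \<and> (\<forall>f<nfeat I. e ! f \<in> feat_values I f) \<and> card {f. f < nfeat I \<and> e ! f \<noteq> q ! f} \<le> c}"
  have B: "finite ?B \<and> card ?B \<le> (1 + nfeat I * D_max I) ^ c"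
  proof (rule card_hamming_ball)
    show "length q = nfeat I" using wf q by (simp add: wf_ci_def)
    show "q ! f \<in> feat_values I f" for f using q by (auto simp: feat_values_def)
  qed (simp_all add: finite_feat_values card_feat_values)
  have "S \<subseteq> ?B" using S near wf by (auto simp: wf_ci_def feat_values_def)
  then show ?thesis using B card_mono[of ?B S] by linarith
qed

lemma card_pos_neg:
  assumes wf: "wf_ci I" and d: "delta_max I \<le> c" and ne: "pos I \<noteq> []" "neg I \<noteq> []"
  shows "card (set (pos I)) \<le> (1 + nfeat I * D_max I) ^ c" "card (set (neg I)) \<le> (1 + nfeat I * D_max I) ^ c"
proof -
  obtain p q where pq: "p \<in> set (pos I)" "q \<in> set (neg I)"
    using ne by (meson ex_in_conv set_empty)
  show "card (set (pos I)) \<le> (1 + nfeat I * D_max I) ^ c"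
    by (rule card_near_examples[OF wf, of q]) (use pq d in \<open>auto simp: examples_def delta_max_le_iff diff_feats_def\<close>)
  have "{f. f < nfeat I \<and> y ! f \<noteq> p ! f} = diff_feats I p y" for y
    by (auto simp: diff_feats_def)
  then show "card (set (neg I)) \<le> (1 + nfeat I * D_max I) ^ c"
    by (intro card_near_examples[OF wf, of p]) (use pq d in \<open>auto simp: examples_def delta_max_le_iff\<close>)
qed

subsection \<open>Length of the encoding\<close>

lemma length_doubled: "length (concat (map (\<lambda>b. [b, b]) bs)) = 2 * length bs"
  by (induction bs) auto

lemma length_enc_nat: "length (enc_nat n) = 2 * length (bin n) + 2"
  by (simp add: enc_nat_def length_doubled)

lemma length_concat_le: "(\<And>x. x \<in> set xs \<Longrightarrow> length (e x) \<le> k) \<Longrightarrow> length (concat (map e xs)) \<le> length xs * k"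
proof (induction xs)
  case (Cons x xs)
  then have "length (e x) \<le> k" "length (concat (map e xs)) \<le> length xs * k" by auto
  then show ?case by simp
qed simp

lemma length_concat_ge: "(\<And>x. x \<in> set xs \<Longrightarrow> k \<le> length (e x)) \<Longrightarrow> length xs * k \<le> length (concat (map e xs))"
proof (induction xs)
  case (Cons x xs)
  then have "k \<le> length (e x)" "length xs * k \<le> length (concat (map e xs))" by auto
  then show ?case by simp
qed simp

lemma length_enc_list_le:
  assumes "\<And>x. x \<in> set xs \<Longrightarrow> length (e x) \<le> k" "length xs \<le> n"
  shows "length (enc_list e xs) \<le> 2 * n + 2 + n * k"
proof -
  have "length (concat (map e xs)) \<le> n * k"
    using length_concat_le[of xs e k, OF assms(1)] mult_le_mono1[OF assms(2), of k] by linarith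
  moreover have "length (bin (length xs)) \<le> n" using length_bin_le[of "length xs"] assms(2) by linarith
  ultimately show ?thesis by (simp add: enc_list_def length_enc_nat)
qed

text \<open>One bit for the sign, \<open>2 * (r + 1)\<close> for the doubled digits of
  \<open>2 ^ r\<close> with \<open>r \<le> length A\<close>, and two for the terminator.\<close>

lemma length_enc_rank_power: "length (enc_int (rank_power A v)) \<le> 2 * length A + 5"
  using length_filter_le[of "\<lambda>u. u < v" A]
  by (simp add: enc_int_def rank_power_def length_enc_nat nat_power_eq bin_power)

lemma length_cap: "length (bin (cap l s)) \<le> l + 1"
  by (simp add: cap_def bin_power)

text \<open>A number with more than \<open>l\<close> digits has its top digit set and is thus at
  least \<open>2 ^ l\<close>. If the budget changes at all, old and new budget both suffice for
  every tree of depth at most \<open>l\<close>.\<close>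

lemma cap_cases: "cap l s = s \<or> 2 ^ l \<le> cap l s \<and> 2 ^ l \<le> s"
proof (cases "length (bin s) \<le> l")
  case False
  then have "0 < s" by (cases "s = 0") auto
  from power_length_bin[OF this] have "(2::nat) ^ length (bin s) \<le> 2 * s" .
  moreover have "(2::nat) ^ Suc l \<le> 2 ^ length (bin s)" using False by (intro power_increasing) auto
  ultimately have "2 ^ l \<le> s" by simp
  then show ?thesis using False by (simp add: cap_def)
qed (simp add: cap_def)

text \<open>\<open>g\<close> bounds the examples per class and \<open>2 * g * k\<close> the number
  of pooled entries, hence \<open>2 * (2 * g * k) + 5\<close> bits per value; \<open>y\<close>
  bounds the code of one class. The budget has at most \<open>y + 1\<close> digits. The summand 8 is
  the exact code length of the trivial instance.\<close>

definition kernel_size :: "nat \<Rightarrow> nat \<Rightarrow> nat" where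
  "kernel_size c k = (let g = (1 + k * k) ^ c; y = 2 * g + 2 + g * (2 * k + 2 + k * (2 * (2 * g * k) + 5))
     in 8 + (2 * k + 2) + y + y + (2 * (y + 1) + 2))"

lemma polyfun_kernel_size: "polyfun (kernel_size c)"
  unfolding kernel_size_def[abs_def] Let_def by (intro polyfun_intros)

subsection \<open>The kernel\<close>

text \<open>The measure \<open>\<mu>\<close> stands for size or depth. Dependence on size and depth
  alone makes it survive the order embedding, and the bound by \<open>2 ^ dt_depth T\<close> makes
  one cut of the budget valid for both.\<close>

lemma kernel_of_props:
  assumes wf: "wf_ci (fst x)" and d: "delta_max (fst x) \<le> c"
    and Leaf: "\<And>b. \<mu> (Leaf b) = 0"
    and pow: "\<And>T. \<mu> T \<le> 2 ^ dt_depth T"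
    and cong: "\<And>T T'. dt_size T = dt_size T' \<Longrightarrow> dt_depth T = dt_depth T' \<Longrightarrow> \<mu> T = (\<mu> T' :: nat)"
  defines "P \<equiv> \<lambda>x. \<exists>T. classifies T (fst x) \<and> \<mu> T \<le> (snd x :: nat)"
  shows "wf_ci (fst (kernel_of x))" "delta_max (fst (kernel_of x)) \<le> c"
    "P (kernel_of x) \<longleftrightarrow> P x" "length (enc_inst (kernel_of x)) \<le> kernel_size c (param (fst x))"
proof -
  let ?I = "fst x" and ?s = "snd x"
  have "wf_ci (fst (kernel_of x)) \<and> delta_max (fst (kernel_of x)) \<le> c \<and> (P (kernel_of x) \<longleftrightarrow> P x) \<and>
    length (enc_inst (kernel_of x)) \<le> kernel_size c (param (fst x))"
  proof (cases "pos ?I = [] \<or> neg ?I = []")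
    case True
    then have y: "kernel_of x = trivial_inst" by (simp add: kernel_of_def)
    have "classifies (Leaf (neg ?I = [])) ?I" using True by (auto simp: classifies_def)
    then have "P x" unfolding P_def using Leaf by (metis le0)
    moreover have "classifies (Leaf True) (fst trivial_inst)" by (simp add: classifies_def trivial_inst_def)
    then have "P trivial_inst" unfolding P_def using Leaf by (metis le0)
    moreover have "wf_ci (fst trivial_inst)" "delta_max (fst trivial_inst) \<le> c"
      by (simp_all add: trivial_inst_def wf_ci_def examples_def delta_max_le_iff)
    moreover have "length (enc_inst trivial_inst) \<le> kernel_size c (param ?I)"
      by (simp add: trivial_inst_def enc_inst_def enc_list_def enc_nat_def kernel_size_def Let_def)
    ultimately show ?thesis by (simp add: y)
  next
    case False
    define Ps where "Ps = dedup (pos ?I)"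
    define Ns where "Ns = dedup (neg ?I)"
    define A where "A = concat (Ps @ Ns)"
    define \<rho> where "\<rho> = rank_power A"
    define J where "J = \<lparr>nfeat = nfeat ?I, pos = map (map \<rho>) Ps, neg = map (map \<rho>) Ns\<rparr>"
    define L where "L = length (enc_list (enc_list enc_int) (map (map \<rho>) Ps))"
    have y: "kernel_of x = (J, cap L ?s)"
      using False by (simp add: kernel_of_def Let_def J_def L_def Ps_def Ns_def A_def \<rho>_def)
    have sets: "set Ps = set (pos ?I)" "set Ns = set (neg ?I)"
      by (simp_all add: Ps_def Ns_def set_dedup)
    have J: "nfeat J = nfeat ?I" "set (pos J) = map \<rho> ` set (pos ?I)" "set (neg J) = map \<rho> ` set (neg ?I)"
      by (simp_all add: J_def sets)
    have "entries ?I = set A" by (auto simp: entries_def A_def examples_def sets)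
    then have mono: "\<And>u v. u \<in> entries ?I \<Longrightarrow> v \<in> entries ?I \<Longrightarrow> u < v \<Longrightarrow> \<rho> u < \<rho> v"
      unfolding \<rho>_def by (simp add: rank_power_strict_mono)
    then have inj: "inj_on \<rho> (entries ?I)"
      by (metis (no_types, lifting) inj_onI less_irrefl linorder_less_linear)
    have len: "length e = nfeat ?I" if "e \<in> set Ps \<or> e \<in> set Ns" for e
      using that wf by (auto simp: wf_ci_def examples_def sets)
    have wfJ: "wf_ci J" by (rule wf_transfer[OF wf inj J])
    have dJ: "delta_max J \<le> c" by (rule delta_max_transfer[OF wf inj J d])
    \<comment> \<open>The code of a value has at least two bits, so \<open>L\<close> dominates the
      depth of the explicit tree for \<open>Ps\<close>.\<close>
    have "length Ps * (2 * nfeat ?I) \<le> L"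
    proof -
      have "2 * nfeat ?I \<le> length (enc_list enc_int e)" if "e \<in> set (map (map \<rho>) Ps)" for e
      proof -
        have "length e * 2 \<le> length (concat (map enc_int e))"
          by (rule length_concat_ge) (simp add: enc_int_def length_enc_nat)
        then show ?thesis using that len by (auto simp: enc_list_def)
      qed
      from length_concat_ge[of "map (map \<rho>) Ps" "2 * nfeat ?I" "enc_list enc_int", OF this]
      show ?thesis unfolding L_def enc_list_def[of "enc_list enc_int"] by simp
    qed
    then have L: "2 * nfeat ?I * length Ps \<le> L" by (simp add: ac_simps)
    \<comment> \<open>Stated for any \<open>K\<close> because it is applied to the original instance
      and to the compressed one.\<close>
    have yes: "P (K, s)" if K: "wf_ci K" "nfeat K = nfeat ?I" "set ps = set (pos K)" "length ps = length Ps" "2 ^ L \<le> s" for K s ps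
    proof -
      obtain T where T: "classifies T K" "dt_depth T \<le> L"
        using ex_classifying_dt[OF K(1,3)] L unfolding K(2,4) by (metis le_trans)
      have "\<mu> T \<le> 2 ^ L"
        using pow[of T] power_increasing[OF T(2), of "2::nat"] by linarith
      then show ?thesis using T K(5) unfolding P_def by (metis fst_conv le_trans snd_conv)
    qed
    have PJ: "P (J, s) \<longleftrightarrow> P (?I, s)" for s
    proof -
      \<comment> \<open>This separates which pairs of size and depth the instance admits from which
        of them the budget permits; only the first part depends on \<open>K\<close>.\<close>
      have *: "P (K, s) \<longleftrightarrow> (\<exists>m d. (\<exists>T. classifies T K \<and> dt_size T = m \<and> dt_depth T = d) \<and>
          (\<exists>T. dt_size T = m \<and> dt_depth T = d \<and> \<mu> T \<le> s))" for K
        unfolding P_def using cong by (metis fst_conv snd_conv)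
      have "(\<exists>T. classifies T J \<and> dt_size T = m \<and> dt_depth T = d) \<longleftrightarrow>
          (\<exists>T. classifies T ?I \<and> dt_size T = m \<and> dt_depth T = d)" for m d
        by (rule classifies_transfer_iff[OF wf _ J]) (rule mono)
      then show ?thesis by (simp only: *)
    qed
    have "P (J, cap L ?s) \<longleftrightarrow> P (?I, ?s)"
      using cap_cases[of L ?s]
    proof
      assume "cap L ?s = ?s"
      then show ?thesis using PJ by simp
    next
      assume c: "2 ^ L \<le> cap L ?s \<and> 2 ^ L \<le> ?s"
      have "P (J, cap L ?s)" by (rule yes[OF wfJ, of "map (map \<rho>) Ps"]) (use c in \<open>simp_all add: J_def\<close>)
      moreover have "P (?I, ?s)" by (rule yes[OF wf, of Ps]) (use c sets in simp_all)
      ultimately show ?thesis by simp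
    qed
    moreover have "length (enc_inst (J, cap L ?s)) \<le> kernel_size c (param ?I)"
    proof -
      define k where "k = param ?I"
      define g where "g = (1 + k * k) ^ c"
      have F: "nfeat ?I \<le> k" and D: "D_max ?I \<le> k" by (simp_all add: k_def param_def)
      have "(1 + nfeat ?I * D_max ?I) ^ c \<le> g"
        unfolding g_def using F D by (intro power_mono add_left_mono mult_mono) auto
      then have lPN: "length Ps \<le> g" "length Ns \<le> g"
        using card_pos_neg[OF wf d] False by (auto simp: Ps_def Ns_def length_dedup intro: order_trans)
      have "length A \<le> 2 * g * k"
      proof -
        have "length (concat (map id (Ps @ Ns))) \<le> length (Ps @ Ns) * k"
          by (rule length_concat_le) (use len F in auto)
        also have "\<dots> \<le> (2 * g) * k" by (rule mult_le_mono1) (use lPN in simp)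
        finally show ?thesis by (simp add: A_def)
      qed
      then have val: "length (enc_int (\<rho> v)) \<le> 2 * (2 * g * k) + 5" for v
        using length_enc_rank_power[of A v] unfolding \<rho>_def by linarith
      define z where "z = 2 * k + 2 + k * (2 * (2 * g * k) + 5)"
      have ex: "length (enc_list enc_int (map \<rho> e)) \<le> z" if "e \<in> set Ps \<or> e \<in> set Ns" for e
        unfolding z_def by (rule length_enc_list_le) (use val len[OF that] F in auto)
      define w where "w = 2 * g + 2 + g * z"
      have PL: "length (enc_list (enc_list enc_int) (map (map \<rho>) Ps)) \<le> w"
        and NL: "length (enc_list (enc_list enc_int) (map (map \<rho>) Ns)) \<le> w"
        unfolding w_def by (rule length_enc_list_le; use ex lPN in auto)+
      have "length (enc_nat (nfeat ?I)) \<le> 2 * k + 2"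
        using length_bin_le[of "nfeat ?I"] F by (simp add: length_enc_nat)
      moreover have "length (enc_nat (cap L ?s)) \<le> 2 * (w + 1) + 2"
        using length_cap[of L ?s] PL by (simp add: length_enc_nat L_def)
      ultimately have "length (enc_inst (J, cap L ?s)) \<le> 8 + (2 * k + 2) + w + w + (2 * (w + 1) + 2)"
        using PL NL by (simp add: enc_inst_def J_def)
      also have "\<dots> = kernel_size c k"
        by (simp add: kernel_size_def Let_def w_def z_def g_def)
      finally show ?thesis by (simp add: k_def)
    qed
    ultimately show ?thesis using wfJ dJ by (simp add: y)
  qed
  then show "wf_ci (fst (kernel_of x))" "delta_max (fst (kernel_of x)) \<le> c"
    "P (kernel_of x) \<longleftrightarrow> P x" "length (enc_inst (kernel_of x)) \<le> kernel_size c (param (fst x))"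
    by blast+
qed

lemma poly_kernel:
  assumes Leaf: "\<And>b. \<mu> (Leaf b) = 0"
    and pow: "\<And>T. \<mu> T \<le> 2 ^ dt_depth T"
    and cong: "\<And>T T'. dt_size T = dt_size T' \<Longrightarrow> dt_depth T = dt_depth T' \<Longrightarrow> \<mu> T = (\<mu> T' :: nat)"
  shows "has_poly_kernel (\<lambda>x. \<exists>T. classifies T (fst x) \<and> \<mu> T \<le> snd x) (\<lambda>I. delta_max I \<le> c) param"
proof -
  obtain M a b where M: "wf_tm M" "\<And>w. \<exists>t \<le> a * length w ^ b + a. tm_computes_within M w (kernel_enc w) t"
    using polytime_imp_tm[OF polytime_kernel_enc] by blast
  obtain a' b' where ab': "\<And>k. kernel_size c k \<le> a' * k ^ b' + a'"
    using polyfun_bound[OF polyfun_kernel_size] by blast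
  show ?thesis
    unfolding has_poly_kernel_def
  proof (rule exI[of _ M], rule exI[of _ a], rule exI[of _ b], rule exI[of _ a'], rule exI[of _ b'],
      intro conjI allI impI M(1))
    fix x :: "ci \<times> nat"
    assume x: "wf_ci (fst x) \<and> delta_max (fst x) \<le> c"
    obtain t where t: "t \<le> a * length (enc_inst x) ^ b + a" "tm_computes_within M (enc_inst x) (enc_inst (kernel_of x)) t"
      using M(2)[of "enc_inst x"] by (auto simp: kernel_enc)
    note props = kernel_of_props[of x c \<mu>, OF conjunct1[OF x] conjunct2[OF x] Leaf pow cong]
    show "\<exists>y t. tm_computes_within M (enc_inst x) (enc_inst y) t \<and> t \<le> a * length (enc_inst x) ^ b + a \<and>
        wf_ci (fst y) \<and> delta_max (fst y) \<le> c \<and>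
        ((\<exists>T. classifies T (fst y) \<and> \<mu> T \<le> snd y) \<longleftrightarrow> (\<exists>T. classifies T (fst x) \<and> \<mu> T \<le> snd x)) \<and>
        length (enc_inst y) \<le> a' * param (fst x) ^ b' + a'"
      using t props le_trans[OF props(4) ab'] by blast
  qed
qed

theorem theorem3:
  fixes c :: nat
  shows "has_poly_kernel DTS (\<lambda>I. delta_max I \<le> c) param
       \<and> has_poly_kernel DTD (\<lambda>I. delta_max I \<le> c) param"
proof
  show "has_poly_kernel DTS (\<lambda>I. delta_max I \<le> c) param"
    unfolding DTS_def[abs_def]
    by (rule poly_kernel) (auto intro: less_imp_le[OF dt_size_less])
  show "has_poly_kernel DTD (\<lambda>I. delta_max I \<le> c) param"
    unfolding DTD_def[abs_def]
    by (rule poly_kernel) (auto intro: less_imp_le[OF less_exp])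
qed

end
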